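(* Let $u^i_t=(V^i(\mathbf u))_x$, $i=1,\dots,n$, be a strictly hyperbolic system of conservation laws whose associated congruence of lines $y^i=u^iy^{n+1}+V^i(\mathbf u)y^{n+2}$, $i=1,\dots,n$, in $\mathbb P^{n+1}$ is linear, specified by an $n$-dimensional space $A$ of 2-forms on the $(n+2)$-dimensional vector space underlying $\mathbb P^{n+1}$, and let $A^1,\dots,A^n$ be a basis of $A$. Then the system is Hamiltonian with respect to some non-degenerate third-order Hamiltonian operator $P^{ij}=\partial_x(g^{ij}\partial_x+c^{ij}_ku^k_x)\partial_x$ in the coordinates $u^i$ if and only if there exists a non-degenerate symmetric constant $n\times n$ matrix $\phi_{\beta\gamma}$ such that $$\phi_{\beta\gamma}\,A^\beta\wedge A^\gamma=0 .$$
   Context: Summation over repeated indices is understood; a comma in a lower index denotes a partial derivative. Strict hyperbolicity: the eigenvalues of $(\partial V^i/\partial u^j)$ are real and distinct. Linear congruence: $(y^1:\dots:y^{n+2})$ are homogeneous coordinates in $\mathbb P^{n+1}$. The line of the congruence with parameter $\mathbf u$ is spanned by the vectors $p(\mathbf u)=(u^1,\dots,u^n,1,0)$ and $q(\mathbf u)=(V^1(\mathbf u),\dots,V^n(\mathbf u),0,1)$, and its Plücker coordinates are the $2\times2$ minors of the matrix with rows $p,q$, namely (up to sign) $u^iV^j-u^jV^i$, $u^i$, $V^i$, $1$. A 2-form $B$ (skew-symmetric bilinear form) on the $(n+2)$-dimensional vector space gives the linear relation $B(p,q)=0$ among Plücker coordinates. The congruence is linear, specified by an $n$-dimensional space $A$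 of 2-forms, if it is an open part of the codimension-$n$ linear section of the Grassmannian $G(1,n+1)$ cut out by $A$: that is, $B(p(\mathbf u),q(\mathbf u))=0$ for all $B\in A$ and all $\mathbf u$ in the domain, and for each such $\mathbf u$ these $n$ relations, viewed as linear equations for $V^1,\dots,V^n$, determine $V(\mathbf u)$ uniquely. Third-order Hamiltonian operator: $g^{ij}(\mathbf u)$ is symmetric with $\det g^{ij}\neq0$, $g_{ij}$ is its inverse, $c_{ijk}=g_{iq}g_{jp}c^{pq}_k$; $P$ is Hamiltonian (defines a skew-symmetric bracket $\{F,G\}=\int\frac{\delta F}{\delta u^i}P^{ij}\frac{\delta G}{\delta u^j}dx$ satisfying the Jacobi identity), which is known to be equivalent to $$g_{mp,k}=-c_{mpk}-c_{pmk},\quad c_{mpk}=-c_{mkp},\quad c_{mpk}+c_{pkm}+c_{kmp}=0,\quad c_{mpk,l}=-g^{sq}c_{sml}c_{qpk}.$$ Known result (Balandin and Potemin): the general such $g$ is $g_{ij}=\phi_{\beta\gamma}\psi^\beta_i\psi^\gamma_j$ with $\phi$ constant, symmetric, non-degenerate and $\psi^\gamma_k=\psi^\gamma_{km}u^m+\omega^\gamma_k$, where the constants $\psi^\gamma_{km}=-\psi^\gamma_{mk}$ and $\omega^\gamma_k$ satisfy $$\phi_{\beta\gamma}(\psi^\beta_{is}\psi^\gamma_{jk}+\psi^\beta_{js}\psi^\gamma_{ki}+\psi^\beta_{ks}\psi^\gamma_{ij})=0,\qquad \phi_{\beta\gamma}(\omega^\beta_i\psi^\gamma_{jk}+\omega^\beta_j\psi^\gamma_{ki}+\omega^\beta_k\psi^\gamma_{ij})=0.$$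 A system is Hamiltonian with respect to $P$ if $\mathbf u_t=(V(\mathbf u))_x=P\,\delta H/\delta\mathbf u$ for some functional $H=\int h\,dx$, possibly nonlocal: $h$ may depend on $x$, the potentials $b^i$ with $b^i_x=u^i$, and finitely many $x$-derivatives of $b^i$. *)

theory Defs
  imports "HOL-Analysis.Analysis"
begin

definition partial_deriv :: "'n \<Rightarrow> (real^'n \<Rightarrow> real) \<Rightarrow> real^'n \<Rightarrow> real" where
  "partial_deriv i f u = deriv (\<lambda>t. f (u + t *\<^sub>R axis i 1)) 0"

text \<open>Used only on open sets \<open>U\<close>: all partial derivatives of order at most \<open>k\<close> exist
  and are continuous.\<close>

primrec Ck_on :: "nat \<Rightarrow> (real^'n) set \<Rightarrow> (real^'n \<Rightarrow> real) \<Rightarrow> bool" where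
  "Ck_on 0 U f \<longleftrightarrow> continuous_on U f"
| "Ck_on (Suc k) U f \<longleftrightarrow> continuous_on U f \<and>
     (\<forall>i. (\<forall>u\<in>U. (\<lambda>t. f (u + t *\<^sub>R axis i 1)) field_differentiable (at 0)) \<and>
          Ck_on k U (partial_deriv i f))"

definition smooth_on :: "(real^'n) set \<Rightarrow> (real^'n \<Rightarrow> real) \<Rightarrow> bool" where
  "smooth_on U f \<longleftrightarrow> (\<forall>k. Ck_on k U f)"

definition jacobian_matrix :: "(real^'n \<Rightarrow> real^'n) \<Rightarrow> real^'n \<Rightarrow> real^'n^'n" where
  "jacobian_matrix V u = (\<chi> i j. partial_deriv j (\<lambda>v. V v $ i) u)"

text \<open>An \<open>n \<times> n\<close> matrix has all its eigenvalues real and pairwise distinct iff its set of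
  real eigenvalues has \<open>n\<close> elements.\<close>

definition strictly_hyperbolic :: "(real^'n) set \<Rightarrow> (real^'n \<Rightarrow> real^'n) \<Rightarrow> bool" where
  "strictly_hyperbolic U V \<longleftrightarrow>
     (\<forall>u\<in>U. card {l::real. \<exists>r. r \<noteq> 0 \<and> jacobian_matrix V u *v r = l *\<^sub>R r} = CARD('n))"

text \<open>The \<open>(n+2)\<close>-dimensional vector space underlying projective \<open>(n+1)\<close>-space; the last two
  factors carry the homogeneous coordinates \<open>y\<close> with upper indices \<open>n+1\<close> and \<open>n+2\<close>.\<close>

type_synonym 'n hvec = "(real^'n) \<times> real \<times> real"

type_synonym 'n bilin = "'n hvec \<Rightarrow>\<^sub>L 'n hvec \<Rightarrow>\<^sub>L real"

abbreviation ev2 :: "('n::finite) bilin \<Rightarrow> 'n hvec \<Rightarrow> 'n hvec \<Rightarrow> real" where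
  "ev2 B w w' \<equiv> blinfun_apply (blinfun_apply B w) w'"

definition two_forms :: "('n::finite) bilin set" where
  "two_forms = {B. \<forall>w w'. ev2 B w w' = - ev2 B w' w}"

definition wedge :: "('n::finite) bilin \<Rightarrow> 'n bilin \<Rightarrow>
    'n hvec \<Rightarrow> 'n hvec \<Rightarrow> 'n hvec \<Rightarrow> 'n hvec \<Rightarrow> real" where
  "wedge A B w1 w2 w3 w4 =
     ev2 A w1 w2 * ev2 B w3 w4 - ev2 A w1 w3 * ev2 B w2 w4 + ev2 A w1 w4 * ev2 B w2 w3
   + ev2 A w2 w3 * ev2 B w1 w4 - ev2 A w2 w4 * ev2 B w1 w3 + ev2 A w3 w4 * ev2 B w1 w2"

text \<open>The line of the congruence with parameter \<open>u\<close> is spanned by \<open>line_p u\<close> and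
  \<open>line_q (V u)\<close>.\<close>

definition line_p :: "real^'n \<Rightarrow> 'n hvec" where
  "line_p u = (u, 1, 0)"

definition line_q :: "real^'n \<Rightarrow> 'n hvec" where
  "line_q v = (v, 0, 1)"

definition linear_congruence ::
    "(real^'n) set \<Rightarrow> (real^'n \<Rightarrow> real^'n) \<Rightarrow> 'n bilin set \<Rightarrow> bool" where
  "linear_congruence U V \<A> \<longleftrightarrow>
     \<A> \<subseteq> two_forms \<and> subspace \<A> \<and> dim \<A> = CARD('n) \<and>
     (\<forall>u\<in>U. (\<forall>B\<in>\<A>. ev2 B (line_p u) (line_q (V u)) = 0) \<and>
            (\<forall>v. (\<forall>B\<in>\<A>. ev2 B (line_p u) (line_q v) = 0) \<longrightarrow> v = V u))"

text \<open>A jet \<open>(x, z)\<close> consists of the independent variable \<open>x\<close> and the values \<open>z m\<close> of the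
  \<open>m\<close>-th \<open>x\<close>-derivatives of the dependent variables. Two families of dependent variables are
  used: the fields \<open>u\<close>, with \<open>u = z 0\<close>, and the potentials \<open>b\<close> with \<open>b_x = u\<close>, for which
  \<open>b = z 0\<close> and \<open>u = z 1\<close>. The parameter \<open>s\<close> below (\<open>0\<close> or \<open>1\<close>) is the position of \<open>u\<close>.\<close>

type_synonym 'n jet = "real \<times> (nat \<Rightarrow> real^'n)"

definition jets_over :: "nat \<Rightarrow> (real^'n) set \<Rightarrow> 'n jet set" where
  "jets_over s U = {(x, z). z s \<in> U}"

definition jet_dx :: "(('n::finite) jet \<Rightarrow> real) \<Rightarrow> 'n jet \<Rightarrow> real" where
  "jet_dx f = (\<lambda>(x, z). deriv (\<lambda>t. f (t, z)) x)"

definition jet_dz :: "nat \<Rightarrow> 'n::finite \<Rightarrow> ('n jet \<Rightarrow> real) \<Rightarrow> 'n jet \<Rightarrow> real" where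
  "jet_dz m i f = (\<lambda>(x, z). deriv (\<lambda>t. f (x, z(m := z m + t *\<^sub>R axis i 1))) 0)"

primrec jet_Ck :: "nat \<Rightarrow> ('n::finite) jet set \<Rightarrow> ('n jet \<Rightarrow> real) \<Rightarrow> bool" where
  "jet_Ck 0 \<Omega> f \<longleftrightarrow> continuous_on \<Omega> f"
| "jet_Ck (Suc k) \<Omega> f \<longleftrightarrow> continuous_on \<Omega> f \<and>
     (\<forall>(x, z)\<in>\<Omega>. (\<lambda>t. f (t, z)) field_differentiable (at x)) \<and>
     jet_Ck k \<Omega> (jet_dx f) \<and>
     (\<forall>m i. (\<forall>(x, z)\<in>\<Omega>. (\<lambda>t. f (x, z(m := z m + t *\<^sub>R axis i 1))) field_differentiable (at 0)) \<and>
            jet_Ck k \<Omega> (jet_dz m i f))"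

text \<open>Smooth functions of \<open>x\<close> and of finitely many derivatives of the dependent variables.\<close>

definition diff_fun :: "nat \<Rightarrow> (real^'n) set \<Rightarrow> ('n jet \<Rightarrow> real) \<Rightarrow> bool" where
  "diff_fun s U f \<longleftrightarrow>
     (\<exists>N. \<forall>x z z'. (x, z) \<in> jets_over s U \<and> (x, z') \<in> jets_over s U \<and> (\<forall>m\<le>N. z m = z' m)
            \<longrightarrow> f (x, z) = f (x, z')) \<and>
     (\<forall>k. jet_Ck k (jets_over s U) f)"

text \<open>The total \<open>x\<close>-derivative and the variational derivative. On differential functions the
  series over \<open>m\<close> are finite sums.\<close>

definition total_deriv :: "(('n::finite) jet \<Rightarrow> real) \<Rightarrow> 'n jet \<Rightarrow> real" where
  "total_deriv f = (\<lambda>(x, z). jet_dx f (x, z)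
     + (\<Sum>m. \<Sum>i\<in>UNIV. z (Suc m) $ i * jet_dz m i f (x, z)))"

definition variational_deriv :: "'n::finite \<Rightarrow> ('n jet \<Rightarrow> real) \<Rightarrow> 'n jet \<Rightarrow> real" where
  "variational_deriv i f p = (\<Sum>m. (-1) ^ m * (total_deriv ^^ m) (jet_dz m i f) p)"

text \<open>\<open>inner_op s g c\<close> is the operator with components \<open>g^{ij} D + c^{ij}_k u^k_x\<close>, where \<open>D\<close> is
  the total derivative, \<open>g^{ij}(u) = g u $ i $ j\<close> and \<open>c^{ij}_k(u) = c u $ i $ j $ k\<close>.\<close>

definition inner_op :: "nat \<Rightarrow> (real^'n \<Rightarrow> real^'n^'n) \<Rightarrow> (real^'n \<Rightarrow> real^'n^'n^'n) \<Rightarrow>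
    ('n \<Rightarrow> 'n jet \<Rightarrow> real) \<Rightarrow> 'n \<Rightarrow> 'n jet \<Rightarrow> real" where
  "inner_op s g c w i = (\<lambda>(x, z).
     (\<Sum>j\<in>UNIV. g (z s) $ i $ j * total_deriv (w j) (x, z))
     + (\<Sum>j\<in>UNIV. \<Sum>k\<in>UNIV. c (z s) $ i $ j $ k * z (Suc s) $ k * w j (x, z)))"

definition third_order_op :: "(real^'n \<Rightarrow> real^'n^'n) \<Rightarrow> (real^'n \<Rightarrow> real^'n^'n^'n) \<Rightarrow>
    ('n \<Rightarrow> 'n jet \<Rightarrow> real) \<Rightarrow> 'n \<Rightarrow> 'n jet \<Rightarrow> real" where
  "third_order_op g c w i = total_deriv (inner_op 0 g c (\<lambda>j. total_deriv (w j)) i)"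

text \<open>A functional is represented by its density, a differential function of \<open>u\<close>; densities
  that differ by a total derivative represent the same functional.\<close>

definition null_functional :: "(real^'n) set \<Rightarrow> ('n jet \<Rightarrow> real) \<Rightarrow> bool" where
  "null_functional U f \<longleftrightarrow>
     (\<exists>K. diff_fun 0 U K \<and> (\<forall>p\<in>jets_over 0 U. f p = total_deriv K p))"

definition bracket :: "(real^'n \<Rightarrow> real^'n^'n) \<Rightarrow> (real^'n \<Rightarrow> real^'n^'n^'n) \<Rightarrow>
    ('n jet \<Rightarrow> real) \<Rightarrow> ('n jet \<Rightarrow> real) \<Rightarrow> 'n jet \<Rightarrow> real" where
  "bracket g c F G p =
     (\<Sum>i\<in>UNIV. variational_deriv i F p * third_order_op g c (\<lambda>j. variational_deriv j G) i p)"

definition third_order_hamiltonian_operator ::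
    "(real^'n) set \<Rightarrow> (real^'n \<Rightarrow> real^'n^'n) \<Rightarrow> (real^'n \<Rightarrow> real^'n^'n^'n) \<Rightarrow> bool" where
  "third_order_hamiltonian_operator U g c \<longleftrightarrow>
     (\<forall>i j. smooth_on U (\<lambda>u. g u $ i $ j)) \<and>
     (\<forall>i j k. smooth_on U (\<lambda>u. c u $ i $ j $ k)) \<and>
     (\<forall>u\<in>U. transpose (g u) = g u \<and> det (g u) \<noteq> 0) \<and>
     (\<forall>F G. diff_fun 0 U F \<and> diff_fun 0 U G \<longrightarrow>
        null_functional U (\<lambda>p. bracket g c F G p + bracket g c G F p)) \<and>
     (\<forall>F G H. diff_fun 0 U F \<and> diff_fun 0 U G \<and> diff_fun 0 U H \<longrightarrow>
        null_functional U (\<lambda>p. bracket g c (bracket g c F G) H p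
                             + bracket g c (bracket g c G H) F p
                             + bracket g c (bracket g c H F) G p))"

text \<open>The equation \<open>V_x = P \<delta>H/\<delta>u\<close> for \<open>H = \<integral> h dx\<close>, with \<open>h\<close> a differential function of the
  potentials \<open>b\<close>. Since \<open>u = b_x\<close>, one has \<open>\<delta>H/\<delta>b = - D (\<delta>H/\<delta>u)\<close>. The variable \<open>\<delta>H/\<delta>u\<close>
  is in general nonlocal even in \<open>b\<close>, but \<open>P = D (g D + c u_x) D\<close> involves only
  \<open>D (\<delta>H/\<delta>u) = - \<delta>H/\<delta>b\<close>, which is local in \<open>b\<close>.\<close>

definition hamiltonian_wrt ::
    "(real^'n) set \<Rightarrow> (real^'n \<Rightarrow> real^'n) \<Rightarrow>
     (real^'n \<Rightarrow> real^'n^'n) \<Rightarrow> (real^'n \<Rightarrow> real^'n^'n^'n) \<Rightarrow> bool" where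
  "hamiltonian_wrt U V g c \<longleftrightarrow>
     (\<exists>h. diff_fun 1 U h \<and>
        (\<forall>p\<in>jets_over 1 U. \<forall>i.
           total_deriv (\<lambda>(x, z). V (z 1) $ i) p
           = total_deriv (inner_op 1 g c (\<lambda>j q. - variational_deriv j h q) i) p))"

end

theory Submission
  imports Defs "HOL-Analysis.Analysis" "HOL-Library.Function_Algebras"
begin

text \<open>
  Put \<open>\<langle>x, y\<rangle> = g\<^sub>i\<^sub>j x\<^sup>i y\<^sup>j\<close> and \<open>[x, y]\<^sup>p = g\<^sub>i\<^sub>m c\<^sup>m\<^sup>p\<^sub>k x\<^sup>i y\<^sup>k\<close>. The operator is Hamiltonian iff the
  bracket is skew, \<open>\<langle>x, [y, z]\<rangle>\<close> has vanishing cyclic sum, and \<open>\<partial>\<^sub>v [x, y] = [[x, y], v]\<close>; the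
  necessity comes from the highest derivatives in the Jacobi identity. If \<open>V\<^sub>x\<close> equals
  \<open>P \<delta>H/\<delta>u\<close>, the Helmholtz conditions for \<open>\<delta>H/\<delta>b\<close> make the Jacobian \<open>J\<close> of \<open>V\<close> symmetric for
  \<open>\<langle>_, _\<rangle>\<close>, give \<open>\<langle>J x, [y, z]\<rangle>\<close> a vanishing cyclic sum, and express the second derivatives of \<open>V\<close>
  by \<open>J\<close> and the bracket.

  For the vector-valued form \<open>A = (A\<^sup>1, \<dots>, A\<^sup>n)\<close> let \<open>M(u) x = A(p(u), (x, 0, 0))\<close>, which is
  invertible because \<open>V\<close> is determined by the congruence. Differentiating \<open>A(p, q) = 0\<close> twice
  and using that \<open>J\<close> has simple spectrum gives \<open>A(x, y) = M [x, y]\<close> for a Hamiltonian system, so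
  at a single point \<open>\<phi>(M x, M y) = \<langle>x, y\<rangle>\<close> defines a form with \<open>\<phi> A \<and> A = 0\<close>. Conversely the two
  equations define \<open>g\<close> and \<open>c\<close> from \<open>\<phi>\<close>, and the density
  \<open>h = 1/3 \<phi>(A(P\<^sub>x, P), A(P, f))\<close> with \<open>P = (b, x, 0)\<close> and \<open>f = (0, 0, 1)\<close> generates the system.
\<close>

section \<open>Variational calculus in differential algebras\<close>

text \<open>The obstacle to necessity is that the Jacobi identity may be tested only on variational
  derivatives, not on arbitrary covectors. Densities with explicit powers of x supply constant
  covectors and their multiples by x; the square of a fourth derivative supplies a covector of order
  far above all others. The structure conditions then fall out of successive top orders.

  The calculus is done in an abstract differential algebra because it is used twice: with u as
  zeroth jet coordinate for the operator, and with the potential b as zeroth and u as first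
  coordinate for the Hamiltonian.

  One point of U suffices to produce \<phi> because the forms are constant: the vectors (x, 0, 0)
  together with p and q at that point span the whole space. At that point the difference d of A(x,
  y) and M [x, y] is skew and satisfies d(x, J y) + d(y, J x) = 0, so it vanishes on pairs of
  eigenvectors of J.

  The density is chosen so that its variational derivative is \<phi>(A(P_x, e_j), A(P, f)): this
  covector contains A(P, f), whose total derivative A(p, f) equals - M V.\<close>

definition derivation_on :: "'r::comm_ring_1 set \<Rightarrow> ('r \<Rightarrow> 'r) \<Rightarrow> bool" where
  "derivation_on S d \<longleftrightarrow> (\<forall>f\<in>S. d f \<in> S) \<and> (\<forall>f\<in>S. \<forall>g\<in>S. d (f + g) = d f + d g)
     \<and> (\<forall>f\<in>S. \<forall>g\<in>S. d (f * g) = d f * g + f * d g)"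

lemma sum_swap_pairs:
  fixes f :: "'x \<Rightarrow> 'y \<Rightarrow> 'c \<Rightarrow> 'd \<Rightarrow> 'e::comm_monoid_add"
  shows "(\<Sum>m\<in>A. \<Sum>i\<in>B. \<Sum>k\<in>C. \<Sum>j\<in>E. f m i k j) = (\<Sum>k\<in>C. \<Sum>j\<in>E. \<Sum>m\<in>A. \<Sum>i\<in>B. f m i k j)"
proof -
  have 3: "(\<Sum>i\<in>X. \<Sum>k\<in>C. \<Sum>j\<in>E. h i k j) = (\<Sum>k\<in>C. \<Sum>j\<in>E. \<Sum>i\<in>X. h i k j)"
    for X :: "'z set" and h :: "'z \<Rightarrow> 'c \<Rightarrow> 'd \<Rightarrow> 'e"
    by (subst sum.swap, intro sum.cong refl sum.swap)
  show ?thesis by (subst 3, subst 3, rule refl)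
qed

lemma sum_delta_mult:
  fixes t :: "'n::finite \<Rightarrow> 'a::comm_ring_1"
  shows "(\<Sum>i\<in>UNIV. (if i = j then c else 0) * t i) = c * t j"
    and "(\<Sum>i\<in>UNIV. (if j = i then c else 0) * t i) = c * t j"
    and "(\<Sum>i\<in>UNIV. t i * (if i = j then c else 0)) = t j * c"
    and "(\<Sum>i\<in>UNIV. t i * (if j = i then c else 0)) = t j * c"
  by (simp_all add: if_distrib[of "\<lambda>x. x * _"] if_distrib[of "\<lambda>x. _ * x"] cong: if_cong)

text \<open>The axioms hold for jets of \<open>u\<close> and for jets of the potentials alike.
  \<open>AA\<close> is a carrier inside a larger ring because smooth functions form only a part of
  the function type. \<open>pd_0_D\<close> and \<open>pd_Suc_D\<close> are the commutators of
  \<open>D\<close> with the jet derivatives; \<open>torsion_free\<close> is what the arguments use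
  of characteristic zero.\<close>

locale diff_algebra =
  fixes AA :: "'r::comm_ring_1 set" and D :: "'r \<Rightarrow> 'r"
    and pd :: "nat \<Rightarrow> 'n::finite \<Rightarrow> 'r \<Rightarrow> 'r"
    and z :: "nat \<Rightarrow> 'n \<Rightarrow> 'r" and xx :: 'r
  assumes one_in [simp]: "1 \<in> AA"
    and add_in [simp]: "f \<in> AA \<Longrightarrow> g \<in> AA \<Longrightarrow> f + g \<in> AA"
    and mult_in [simp]: "f \<in> AA \<Longrightarrow> g \<in> AA \<Longrightarrow> f * g \<in> AA"
    and uminus_in [simp]: "f \<in> AA \<Longrightarrow> - f \<in> AA"
    and z_in [simp]: "z m i \<in> AA" and x_in [simp]: "xx \<in> AA"
    and der_D: "derivation_on AA D" and der_pd: "derivation_on AA (pd m i)"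
    and pd_commute: "f \<in> AA \<Longrightarrow> pd m i (pd l j f) = pd l j (pd m i f)"
    and pd_0_D: "f \<in> AA \<Longrightarrow> pd 0 i (D f) = D (pd 0 i f)"
    and pd_Suc_D: "f \<in> AA \<Longrightarrow> pd (Suc m) i (D f) = D (pd (Suc m) i f) + pd m i f"
    and finite_order: "f \<in> AA \<Longrightarrow> \<exists>N. \<forall>m>N. \<forall>i. pd m i f = 0"
    and D_z [simp]: "D (z m i) = z (Suc m) i" and D_x [simp]: "D xx = 1"
    and pd_z: "pd m i (z l j) = (if m = l \<and> i = j then 1 else 0)"
    and pd_x [simp]: "pd m i xx = 0"
    and torsion_free: "f \<in> AA \<Longrightarrow> of_nat (Suc k) * f = 0 \<Longrightarrow> f = 0"
begin

lemma zero_in [simp]: "0 \<in> AA"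
  using add_in[of 1 "- 1"] by simp

lemma diff_in [simp]: "f \<in> AA \<Longrightarrow> g \<in> AA \<Longrightarrow> f - g \<in> AA"
  using add_in[of f "- g"] by simp

lemma sum_in [simp]: "(\<And>i. i \<in> I \<Longrightarrow> f i \<in> AA) \<Longrightarrow> sum f I \<in> AA"
  by (induction I rule: infinite_finite_induct) auto

lemma power_in [simp]: "f \<in> AA \<Longrightarrow> f ^ k \<in> AA"
  by (induction k) auto

lemma of_nat_in [simp]: "of_nat k \<in> AA"
  by (induction k) auto

lemma numeral_in [simp]: "numeral k \<in> AA"
  using of_nat_in[of "numeral k"] by simp

abbreviation der :: "('r \<Rightarrow> 'r) \<Rightarrow> bool" where "der \<equiv> derivation_on AA"

context
  fixes d assumes d: "der d"
begin

lemma der_in: "f \<in> AA \<Longrightarrow> d f \<in> AA"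
  and der_add: "f \<in> AA \<Longrightarrow> g \<in> AA \<Longrightarrow> d (f + g) = d f + d g"
  and der_mult: "f \<in> AA \<Longrightarrow> g \<in> AA \<Longrightarrow> d (f * g) = d f * g + f * d g"
  using d by (auto simp: derivation_on_def)

lemma der_0: "d 0 = 0"
  using der_add[of 0 0] by simp

lemma der_1: "d 1 = 0"
  using der_mult[of 1 1] by simp

lemma der_uminus: "f \<in> AA \<Longrightarrow> d (- f) = - d f"
  using der_add[of f "- f"] der_0 by (simp add: eq_neg_iff_add_eq_0 add.commute)

lemma der_diff: "f \<in> AA \<Longrightarrow> g \<in> AA \<Longrightarrow> d (f - g) = d f - d g"
  using der_add[of f "- g"] der_uminus[of g] by simp

lemma der_sum: "(\<And>i. i \<in> I \<Longrightarrow> f i \<in> AA) \<Longrightarrow> d (sum f I) = (\<Sum>i\<in>I. d (f i))"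
  by (induction I rule: infinite_finite_induct) (auto simp: der_add der_0)

lemma der_of_nat: "d (of_nat k) = 0"
  by (induction k) (auto simp: der_0 der_1 der_add)

lemma der_numeral: "d (numeral k) = 0"
  using der_of_nat[of "numeral k"] by simp

lemma der_pm1: "d ((-1) ^ k) = 0" "f \<in> AA \<Longrightarrow> d ((-1) ^ k * f) = (-1) ^ k * d f"
  using power_minus1_even[where 'a='r] by (cases "even k"; simp add: der_uminus der_1)+

lemmas der_simps = der_in der_add der_mult der_0 der_1 der_uminus der_diff der_sum der_of_nat
  der_numeral

end

lemmas D_simps [simp] = der_simps[OF der_D]
lemmas pd_simps [simp] = der_simps[OF der_pd]

lemma D_pow_in [simp]: "f \<in> AA \<Longrightarrow> (D ^^ m) f \<in> AA"
  by (induction m) auto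

lemma D_pow_0 [simp]: "(D ^^ m) 0 = 0"
  by (induction m) auto

lemma D_pow_add [simp]: "f \<in> AA \<Longrightarrow> g \<in> AA \<Longrightarrow> (D ^^ m) (f + g) = (D ^^ m) f + (D ^^ m) g"
  by (induction m) auto

lemma D_pow_diff [simp]: "f \<in> AA \<Longrightarrow> g \<in> AA \<Longrightarrow> (D ^^ m) (f - g) = (D ^^ m) f - (D ^^ m) g"
  by (induction m) auto

lemma D_pow_of_nat [simp]: "f \<in> AA \<Longrightarrow> (D ^^ m) (of_nat k * f) = of_nat k * (D ^^ m) f"
  by (induction m) auto

lemma D_pow_D [simp]: "(D ^^ m) (D f) = D ((D ^^ m) f)"
  by (simp add: funpow_swap1)

text \<open>For m = 0 the truncated exponent \<open>m - 1\<close> does no harm, as its coefficient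
  is zero.\<close>

lemma D_pow_x: "f \<in> AA \<Longrightarrow> (D ^^ m) (xx * f) = xx * (D ^^ m) f + of_nat m * (D ^^ (m - 1)) f"
proof (induction m)
  case (Suc m)
  then show ?case by (cases m) (auto simp: algebra_simps)
qed simp

lemma D_pow_z [simp]: "(D ^^ m) (z l i) = z (m + l) i"
  by (induction m) auto

subsection \<open>Order\<close>

definition ordle :: "nat \<Rightarrow> 'r \<Rightarrow> bool" where
  "ordle N f \<longleftrightarrow> f \<in> AA \<and> (\<forall>m>N. \<forall>i. pd m i f = 0)"

lemma ordle_in [simp, dest]: "ordle N f \<Longrightarrow> f \<in> AA"
  by (simp add: ordle_def)

lemma ordleD: "ordle N f \<Longrightarrow> N < m \<Longrightarrow> pd m i f = 0"
  by (simp add: ordle_def)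

lemma ordle_mono: "ordle N f \<Longrightarrow> N \<le> M \<Longrightarrow> ordle M f"
  by (auto simp: ordle_def)

lemma ordle_ex: "f \<in> AA \<Longrightarrow> \<exists>N. ordle N f"
  using finite_order by (auto simp: ordle_def)

lemma ordle_0 [simp]: "ordle N 0" and ordle_1 [simp]: "ordle N 1"
  by (auto simp: ordle_def)

lemma ordle_add: "ordle N f \<Longrightarrow> ordle N g \<Longrightarrow> ordle N (f + g)"
  and ordle_diff: "ordle N f \<Longrightarrow> ordle N g \<Longrightarrow> ordle N (f - g)"
  and ordle_mult: "ordle N f \<Longrightarrow> ordle N g \<Longrightarrow> ordle N (f * g)"
  and ordle_uminus: "ordle N f \<Longrightarrow> ordle N (- f)"
  by (auto simp: ordle_def)

lemma ordle_sum: "(\<And>i. i \<in> I \<Longrightarrow> ordle N (f i)) \<Longrightarrow> ordle N (sum f I)"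
  by (induction I rule: infinite_finite_induct) (auto intro: ordle_add)

lemma ordle_z: "m \<le> N \<Longrightarrow> ordle N (z m i)" and ordle_x: "ordle N xx"
  by (auto simp: ordle_def pd_z)

lemma ordle_pd: "ordle N f \<Longrightarrow> ordle N (pd m i f)"
  unfolding ordle_def by (metis pd_commute pd_simps(1,4))

lemma ordle_D: assumes "ordle N f" shows "ordle (Suc N) (D f)"
  unfolding ordle_def
proof (intro conjI allI impI)
  fix m i assume "Suc N < m"
  then obtain k where "m = Suc k" "k > N" by (cases m) auto
  then show "pd m i (D f) = 0" using assms by (simp add: pd_Suc_D ordleD)
qed (use assms in auto)

lemma pd_top_D: "ordle N f \<Longrightarrow> pd (Suc N) i (D f) = pd N i f"
  by (simp add: pd_Suc_D ordleD)

lemma ordle_lower: "ordle (Suc N) f \<Longrightarrow> (\<And>i. pd (Suc N) i f = 0) \<Longrightarrow> ordle N f"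
  unfolding ordle_def by (metis Suc_lessI)

text \<open>Descent along the commutator: by \<open>pd_Suc_D\<close>, if the derivative of index
  \<open>Suc m\<close> vanishes then so does the one of index m, and finite order provides the
  start.\<close>

lemma D_eq_0_pd: assumes "f \<in> AA" "D f = 0" shows "pd m i f = 0"
proof -
  obtain N where N: "ordle N f" using ordle_ex assms by blast
  have "\<forall>m i. N - k < m \<longrightarrow> pd m i f = 0" for k
  proof (induction k)
    case 0 then show ?case using N by (simp add: ordleD)
  next
    case (Suc k)
    show ?case
    proof (intro allI impI)
      fix m i assume m: "N - Suc k < m"
      have "pd (Suc m) i f = 0" using Suc m by simp
      then show "pd m i f = 0" using pd_Suc_D[OF assms(1), of m i] assms(2) by simp
    qed
  qed
  \<comment> \<open>Truncated subtraction stops at 0, so the descent covers the positive indices;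
    index 0 takes one further use of \<open>pd_Suc_D\<close>.\<close>
  from this[of N] have pos: "\<And>m i. 0 < m \<Longrightarrow> pd m i f = 0" by simp
  have "pd 0 i f = 0" using pd_Suc_D[OF assms(1), of 0 i] assms(2) pos by simp
  with pos show ?thesis by (cases m) auto
qed

subsection \<open>Evolutionary derivations and the Euler operator\<close>

definition vct :: "('n \<Rightarrow> 'r) \<Rightarrow> bool" where "vct a \<longleftrightarrow> (\<forall>i. a i \<in> AA)"

text \<open>Prolongation of the evolutionary vector field with characteristic \<open>X\<close>.
  Summing over the indices that contribute makes the value independent of any chosen order;
  \<open>pr_eq\<close> then substitutes an order bound.\<close>

definition pr :: "('n \<Rightarrow> 'r) \<Rightarrow> 'r \<Rightarrow> 'r" where
  "pr X f = (\<Sum>m | \<exists>i. pd m i f \<noteq> 0. \<Sum>i\<in>UNIV. (D ^^ m) (X i) * pd m i f)"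

definition euler :: "'n \<Rightarrow> 'r \<Rightarrow> 'r" where
  "euler i f = (\<Sum>m | pd m i f \<noteq> 0. (-1) ^ m * (D ^^ m) (pd m i f))"

lemma pr_eq: assumes "ordle N f"
  shows "pr X f = (\<Sum>m\<le>N. \<Sum>i\<in>UNIV. (D ^^ m) (X i) * pd m i f)"
  unfolding pr_def
proof (rule sum.mono_neutral_left)
  show "{m. \<exists>i. pd m i f \<noteq> 0} \<subseteq> {..N}" using assms ordleD not_le_imp_less by blast
qed auto

lemma euler_eq: assumes "ordle N f"
  shows "euler i f = (\<Sum>m\<le>N. (-1) ^ m * (D ^^ m) (pd m i f))"
  unfolding euler_def
proof (rule sum.mono_neutral_left)
  show "{m. pd m i f \<noteq> 0} \<subseteq> {..N}" using assms ordleD not_le_imp_less by blast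
qed auto

lemma vctD [simp]: "vct a \<Longrightarrow> a i \<in> AA" by (simp add: vct_def)

lemma euler_in [simp]: "f \<in> AA \<Longrightarrow> euler i f \<in> AA"
  unfolding euler_def by (auto intro!: sum_in)

lemma der_pr: assumes X: "vct X" shows "der (pr X)"
  unfolding derivation_on_def
proof (intro conjI ballI)
  fix f assume f: "f \<in> AA"
  show "pr X f \<in> AA" unfolding pr_def using X f by (auto intro!: sum_in)
  fix g assume g: "g \<in> AA"
  obtain N M where "ordle N f" "ordle M g" using f g ordle_ex by blast
  then have o: "ordle (max N M) f" "ordle (max N M) g" by (auto intro: ordle_mono)
  show "pr X (f + g) = pr X f + pr X g"
    using X f g by (simp add: pr_eq[OF o(1)] pr_eq[OF o(2)] pr_eq[OF ordle_add[OF o]]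
        algebra_simps sum.distrib)
  have "(D ^^ m) (X i) * pd m i (f * g)
      = ((D ^^ m) (X i) * pd m i f) * g + f * ((D ^^ m) (X i) * pd m i g)" for m i
    using f g by (simp add: algebra_simps)
  then show "pr X (f * g) = pr X f * g + f * pr X g"
    by (simp only: pr_eq[OF o(1)] pr_eq[OF o(2)] pr_eq[OF ordle_mult[OF o]]
        sum.distrib sum_distrib_left sum_distrib_right)
qed

lemma pr_in [simp]: "vct X \<Longrightarrow> f \<in> AA \<Longrightarrow> pr X f \<in> AA"
  using der_in der_pr by blast

text \<open>The index shift in \<open>pd_Suc_D\<close> supplies exactly the terms that the product
  rule creates when \<open>D\<close> falls on \<open>(D ^^ m) (X i)\<close>.\<close>

lemma pr_D: assumes X: "vct X" and f: "f \<in> AA" shows "pr X (D f) = D (pr X f)"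
proof -
  obtain N where N: "ordle N f" using f ordle_ex by blast
  have "pr X (D f) = (\<Sum>m\<le>Suc N. \<Sum>i\<in>UNIV. (D ^^ m) (X i) * D (pd m i f))
      + (\<Sum>m\<le>N. \<Sum>i\<in>UNIV. (D ^^ Suc m) (X i) * pd m i f)"
    using f by (simp add: pr_eq[OF ordle_D[OF N]] sum.atMost_Suc_shift pd_0_D pd_Suc_D
        algebra_simps sum.distrib del: sum.atMost_Suc)
  also have "\<dots> = D (pr X f)"
    using X f N by (simp add: pr_eq[OF N] ordleD sum.distrib)
  finally show ?thesis .
qed

lemma pr_D_pow: "vct X \<Longrightarrow> f \<in> AA \<Longrightarrow> pr X ((D ^^ m) f) = (D ^^ m) (pr X f)"
  by (induction m) (auto simp: pr_D)

lemma pr_z: "vct X \<Longrightarrow> pr X (z m i) = (D ^^ m) (X i)"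
proof -
  assume X: "vct X"
  have "pr X (z m i) = (\<Sum>k\<le>m. \<Sum>j\<in>UNIV. if j = i then (if k = m then (D ^^ m) (X i) else 0) else 0)"
    by (subst pr_eq[OF ordle_z[of m m]], simp, intro sum.cong refl) (simp add: pd_z)
  then show ?thesis by simp
qed

text \<open>Null Lagrangians: \<open>nul (f - g)\<close> says that the densities f and g define the
  same functional.\<close>

definition nul :: "'r \<Rightarrow> bool" where "nul f \<longleftrightarrow> (\<exists>K\<in>AA. f = D K)"

lemma nul_D [intro]: "K \<in> AA \<Longrightarrow> nul (D K)" by (auto simp: nul_def)

lemma nul_0 [simp]: "nul 0" using nul_D[OF zero_in] by simp

lemma nul_add: "nul f \<Longrightarrow> nul g \<Longrightarrow> nul (f + g)"
  unfolding nul_def using add_in D_simps(2) by metis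

lemma nul_uminus: "nul f \<Longrightarrow> nul (- f)"
  unfolding nul_def using uminus_in D_simps(6) by metis

lemma nul_diff: "nul f \<Longrightarrow> nul g \<Longrightarrow> nul (f - g)"
  using nul_add[of f "- g"] nul_uminus by simp

lemma nul_sum: "(\<And>i. i \<in> I \<Longrightarrow> nul (f i)) \<Longrightarrow> nul (sum f I)"
  by (induction I rule: infinite_finite_induct) (auto intro: nul_add)

lemma nul_trans: "nul f \<Longrightarrow> nul (f - g) \<Longrightarrow> nul g"
  using nul_diff[of f "f - g"] by simp

lemma nul_D_pow: "f \<in> AA \<Longrightarrow> g \<in> AA \<Longrightarrow> nul (f * (D ^^ m) g - (-1) ^ m * (D ^^ m) f * g)"
proof (induction m arbitrary: f g)
  case 0 then show ?case by simp
next
  case (Suc m)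
  have 1: "nul (f * (D ^^ m) (D g) - (-1) ^ m * (D ^^ m) f * D g)" by (rule Suc.IH) (use Suc in auto)
  have "D ((-1) ^ m * ((D ^^ m) f * g)) = (-1) ^ m * D ((D ^^ m) f * g)"
    using Suc by (intro der_pm1(2)[OF der_D]) auto
  then have "(-1) ^ m * (D ^^ m) f * D g - (-1) ^ Suc m * (D ^^ Suc m) f * g = D ((-1) ^ m * ((D ^^ m) f * g))"
    using Suc by (simp add: algebra_simps del: D_simps(3)) (simp add: algebra_simps)
  then have 2: "nul ((-1) ^ m * (D ^^ m) f * D g - (-1) ^ Suc m * (D ^^ Suc m) f * g)"
    using nul_D[of "(-1) ^ m * ((D ^^ m) f * g)"] Suc by simp
  show ?case using nul_add[OF 1 2] by simp
qed

text \<open>The alternating signs make the sum telescope against the index-shifted terms coming from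
  \<open>pd_Suc_D\<close>.\<close>

lemma euler_D: assumes f: "f \<in> AA" shows "euler i (D f) = 0"
proof -
  obtain N where N: "ordle N f" using f ordle_ex by blast
  have "euler i (D f) = (\<Sum>m\<le>Suc N. (-1) ^ m * (D ^^ m) (D (pd m i f)))
      + (\<Sum>m\<le>N. (-1) ^ Suc m * (D ^^ Suc m) (pd m i f))"
    using f by (simp add: euler_eq[OF ordle_D[OF N]] sum.atMost_Suc_shift pd_0_D pd_Suc_D
        algebra_simps sum.distrib sum_subtractf sum_negf del: sum.atMost_Suc)
  also have "\<dots> = 0"
    using f N by (simp add: ordleD sum_negf)
  finally show ?thesis .
qed

lemma euler_nul: "nul f \<Longrightarrow> euler i f = 0"
  by (auto simp: nul_def euler_D)

text \<open>The first variation formula: \<open>nul_D_pow\<close> strips the derivatives off each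
  \<open>X i\<close>.\<close>

lemma euler_pr: assumes X: "vct X" and f: "f \<in> AA"
  shows "nul (pr X f - (\<Sum>i\<in>UNIV. X i * euler i f))"
proof -
  obtain N where N: "ordle N f" using f ordle_ex by blast
  have "pr X f - (\<Sum>i\<in>UNIV. X i * euler i f)
    = (\<Sum>m\<le>N. \<Sum>i\<in>UNIV. pd m i f * (D ^^ m) (X i) - (-1) ^ m * (D ^^ m) (pd m i f) * X i)"
    by (simp add: pr_eq[OF N] euler_eq[OF N] sum_subtractf sum_distrib_left sum.swap[of _ UNIV]
        algebra_simps)
  also have "nul \<dots>" using X f by (intro nul_sum nul_D_pow) auto
  finally show ?thesis .
qed

lemma pr_nul: "vct X \<Longrightarrow> nul f \<Longrightarrow> nul (pr X f)"
  unfolding nul_def using pr_D pr_in by blast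

text \<open>The terms with second jet derivatives are symmetric in the two fields and cancel; what
  remains is each derivation acting on the characteristic of the other.\<close>

lemma pr_commute: assumes X: "vct X" and Y: "vct Y" and f: "f \<in> AA"
  shows "pr X (pr Y f) - pr Y (pr X f) = pr (\<lambda>i. pr X (Y i) - pr Y (X i)) f"
proof -
  obtain N where N: "ordle N f" using f ordle_ex by blast
  have *: "pr X (pr Y f) = (\<Sum>m\<le>N. \<Sum>i\<in>UNIV. (D ^^ m) (pr X (Y i)) * pd m i f)
     + (\<Sum>m\<le>N. \<Sum>i\<in>UNIV. \<Sum>k\<le>N. \<Sum>j\<in>UNIV. (D ^^ m) (Y i) * ((D ^^ k) (X j) * pd k j (pd m i f)))"
    if X: "vct X" and Y: "vct Y" for X Y
    unfolding pr_eq[OF N, of Y] pr_eq[OF ordle_pd[OF N], symmetric] sum_distrib_left[symmetric]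
    using X Y f by (simp add: der_simps[OF der_pr[OF X]] pr_D_pow sum.distrib)
  have "(\<Sum>m\<le>N. \<Sum>i\<in>UNIV. \<Sum>k\<le>N. \<Sum>j\<in>UNIV. (D ^^ m) (Y i) * ((D ^^ k) (X j) * pd k j (pd m i f)))
      = (\<Sum>k\<le>N. \<Sum>j\<in>UNIV. \<Sum>m\<le>N. \<Sum>i\<in>UNIV. (D ^^ m) (Y i) * ((D ^^ k) (X j) * pd k j (pd m i f)))"
    by (rule sum_swap_pairs)
  also have "\<dots> = (\<Sum>m\<le>N. \<Sum>i\<in>UNIV. \<Sum>k\<le>N. \<Sum>j\<in>UNIV. (D ^^ m) (X i) * ((D ^^ k) (Y j) * pd k j (pd m i f)))"
    using f by (intro sum.cong refl) (simp add: pd_commute mult.left_commute)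
  finally show ?thesis
    unfolding *[OF X Y] *[OF Y X] using X Y f
    by (simp add: left_diff_distrib sum_subtractf pr_eq[OF N, of "\<lambda>i. pr X (Y i) - pr Y (X i)"])
qed

text \<open>Self-adjointness of the linearization of a variational derivative. The first variation
  formula for Y is prolonged along X and antisymmetrized; the commutator of the two prolongations is
  absorbed by the first variation formula for the commutator field \<open>Z\<close>.\<close>

lemma helmholtz: assumes X: "vct X" and Y: "vct Y" and f: "f \<in> AA"
  shows "nul ((\<Sum>i\<in>UNIV. Y i * pr X (euler i f)) - (\<Sum>i\<in>UNIV. X i * pr Y (euler i f)))"
proof -
  define Z where "Z = (\<lambda>i. pr X (Y i) - pr Y (X i))"
  have Z: "vct Z" unfolding Z_def vct_def using X Y by simp
  have *: "nul (pr X (pr Y f) - (\<Sum>i\<in>UNIV. pr X (Y i) * euler i f) - (\<Sum>i\<in>UNIV. Y i * pr X (euler i f)))"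
    if X: "vct X" and Y: "vct Y" for X Y
    using pr_nul[OF X euler_pr[OF Y f]] X Y f
    by (simp add: der_simps[OF der_pr[OF X]] sum.distrib algebra_simps)
  have "(pr X (pr Y f) - (\<Sum>i\<in>UNIV. pr X (Y i) * euler i f) - (\<Sum>i\<in>UNIV. Y i * pr X (euler i f)))
    - (pr Y (pr X f) - (\<Sum>i\<in>UNIV. pr Y (X i) * euler i f) - (\<Sum>i\<in>UNIV. X i * pr Y (euler i f)))
    - (pr Z f - (\<Sum>i\<in>UNIV. Z i * euler i f))
    = - ((\<Sum>i\<in>UNIV. Y i * pr X (euler i f)) - (\<Sum>i\<in>UNIV. X i * pr Y (euler i f)))"
    unfolding pr_commute[OF X Y f, folded Z_def, symmetric]
    by (simp add: Z_def algebra_simps sum_subtractf)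
  then show ?thesis
    using nul_uminus[OF nul_diff[OF nul_diff[OF *[OF X Y] *[OF Y X]] euler_pr[OF Z f]]]
    by (metis minus_minus)
qed

subsection \<open>Higher Euler operators and non-degeneracy\<close>

text \<open>Multiplying a null Lagrangian by powers of \<open>x\<close> brings in the higher Euler operators,
  the topmost of which is a single partial derivative.\<close>

definition heuler :: "nat \<Rightarrow> nat \<Rightarrow> 'n \<Rightarrow> 'r \<Rightarrow> 'r" where
  "heuler N j i f = (\<Sum>m\<le>N. (-1) ^ m * of_nat (m choose j) * (D ^^ (m - j)) (pd m i f))"

text \<open>Multiplication by x shifts to the next higher operator, by \<open>D_pow_x\<close> and
  the identity \<open>(m choose j) * (m - j) = Suc j * (m choose Suc j)\<close>.\<close>

lemma heuler_x: assumes "ordle N f"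
  shows "heuler N j i (xx * f) = xx * heuler N j i f + of_nat (Suc j) * heuler N (Suc j) i f"
proof -
  have "of_nat (m choose j) * of_nat (m - j) = (of_nat (Suc j) * of_nat (m choose Suc j) :: 'r)" for m
  proof -
    have "(m choose j) * (m - j) = Suc j * (m choose Suc j)"
      using binomial_absorb_comp[of m j] binomial_absorption[of j m]
      by (metis mult.commute)
    then show ?thesis by (metis of_nat_mult)
  qed
  then have *: "(-1) ^ m * of_nat (m choose j) * (of_nat (m - j) * g) =
     of_nat (Suc j) * ((-1) ^ m * of_nat (m choose Suc j) * g)" for m and g :: 'r
    by (metis (no_types, lifting) mult.assoc mult.left_commute)
  have "heuler N j i (xx * f) = (\<Sum>m\<le>N. (-1) ^ m * of_nat (m choose j) * (xx * (D ^^ (m - j)) (pd m i f)))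
     + (\<Sum>m\<le>N. (-1) ^ m * of_nat (m choose j) * (of_nat (m - j) * (D ^^ (m - j - 1)) (pd m i f)))"
    using assms by (simp add: heuler_def D_pow_x sum.distrib distrib_left)
  then show ?thesis
    unfolding * by (simp add: heuler_def sum_distrib_left mult.left_commute)
qed

text \<open>Induction on j for all k at once: in \<open>heuler_x\<close> the operators of index j
  vanish on both \<open>xx ^ k * f\<close> and \<open>xx ^ Suc k * f\<close>, which leaves
  \<open>Suc j\<close> times the next operator.\<close>

lemma heuler_null: assumes "f \<in> AA" "\<And>k. nul (xx ^ k * f)" "ordle N f"
  shows "heuler N j i (xx ^ k * f) = 0"
proof (induction j arbitrary: k)
  case 0
  have "ordle N (xx ^ k * f)"
    by (induction k) (auto simp: assms mult.assoc intro: ordle_mult ordle_x)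
  from euler_eq[OF this] euler_nul[OF assms(2)] show ?case by (simp add: heuler_def)
next
  case (Suc j)
  have o: "ordle N (xx ^ k * f)" for k
    by (induction k) (auto simp: assms mult.assoc intro: ordle_mult ordle_x)
  have h: "heuler N (Suc j) i (xx ^ k * f) \<in> AA" unfolding heuler_def using assms by (auto intro!: sum_in)
  have "of_nat (Suc j) * heuler N (Suc j) i (xx ^ k * f) = 0"
    using heuler_x[OF o, of j i k] Suc.IH[of k] Suc.IH[of "Suc k"] by (simp add: mult.assoc)
  with h show ?case by (rule torsion_free)
qed

text \<open>At j = N the higher Euler operator consists of the single term
  \<open>(-1) ^ N * pd N i f\<close>, so its vanishing lowers the order by one; repeating this
  exhausts all jet variables.\<close>

lemma nul_x_pow_imp_pd: assumes "f \<in> AA" "\<And>k. nul (xx ^ k * f)" shows "pd m i f = 0"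
proof -
  obtain N where N: "ordle N f" using ordle_ex assms by blast
  have red: "pd N i f = 0" if "ordle N f" for N i
  proof -
    have "heuler N N i f = 0" using heuler_null[OF assms that, of N i 0] by simp
    also have "heuler N N i f = (\<Sum>m\<le>N. if m = N then (-1) ^ N * pd N i f else 0)"
      unfolding heuler_def by (intro sum.cong refl) (auto simp: binomial_eq_0)
    finally have "(-1) ^ N * pd N i f = 0" by simp
    then have "(-1) ^ N * ((-1) ^ N * pd N i f) = 0" by simp
    then show ?thesis by (simp add: mult.assoc[symmetric] power_mult_distrib[symmetric])
  qed
  have "ordle (N - k) f" for k
  proof (induction k)
    case (Suc k)
    show ?case
    proof (cases "N - k")
      case (Suc l)
      then have "ordle l f" using \<open>ordle (N - k) f\<close> red ordle_lower by metis
      moreover have "N - Suc k = l" using Suc by simp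
      ultimately show ?thesis by simp
    qed (use Suc in simp)
  qed (use N in simp)
  from this[of N] have 0: "ordle 0 f" by simp
  with red[OF 0] show ?thesis by (cases "m = 0") (auto simp: ordleD)
qed

lemma euler_mult_const: assumes f: "f \<in> AA" and c: "c \<in> AA" "\<And>m i. pd m i c = 0"
  shows "euler i (c * z m j) = (if i = j then (-1) ^ m * (D ^^ m) c else 0)"
proof -
  have "ordle m (c * z m j)" using c by (auto simp: ordle_def pd_z)
  then have "euler i (c * z m j) = (\<Sum>k\<le>m. if k = m then (if i = j then (-1) ^ m * (D ^^ m) c else 0) else 0)"
    unfolding euler_eq[OF \<open>ordle m (c * z m j)\<close>] using c by (intro sum.cong) (auto simp: pd_z)
  then show ?thesis by simp
qed

lemma pd_x_pow: "pd m i (xx ^ k) = 0" by (induction k) auto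

lemma euler_square: "euler i (z m j * z m j) = (if i = j then (-1) ^ m * 2 * z (m + m) j else 0)"
proof -
  have o: "ordle m (z m j * z m j)" by (auto simp: ordle_def pd_z)
  have "euler i (z m j * z m j) = (\<Sum>k\<le>m. if k = m then (if i = j then (-1) ^ m * 2 * z (m + m) j else 0) else 0)"
    unfolding euler_eq[OF o]
  proof (intro sum.cong refl)
    fix k
    have "pd k i (z m j * z m j) = (if k = m \<and> i = j then of_nat 2 * z m j else 0)"
      by (simp add: pd_z)
    then show "(-1) ^ k * (D ^^ k) (pd k i (z m j * z m j))
      = (if k = m then (if i = j then (-1) ^ m * 2 * z (m + m) j else 0) else 0)"
      using D_pow_of_nat[of "z m j" m 2] by (cases "k = m \<and> i = j") auto
  qed
  then show ?thesis by simp
qed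

text \<open>The densities \<open>xx ^ k * z 0 j\<close> have variational derivative
  \<open>xx ^ k\<close> in slot j, so all \<open>xx ^ k * t j\<close> are null and
  \<open>t j\<close> depends on no jet variable. The square of \<open>z 0 j\<close> then makes
  \<open>2 * t j * z 0 j\<close> null, and its Euler derivative is \<open>2 * t j\<close>.\<close>

lemma euler_nondegenerate:
  assumes t: "vct t" and n: "\<And>F. F \<in> AA \<Longrightarrow> nul (\<Sum>i\<in>UNIV. euler i F * t i)"
  shows "t j = 0"
proof -
  have "nul (xx ^ k * t j)" for k
    using n[of "xx ^ k * z 0 j"] euler_mult_const[of 0 "xx ^ k" _ 0 j] t
    by (simp add: pd_x_pow if_distrib[of "\<lambda>x. x * _"] cong: if_cong)
  then have p: "pd m i (t j) = 0" for m i using nul_x_pow_imp_pd t by simp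
  have "(\<Sum>i\<in>UNIV. euler i (z 0 j * z 0 j) * t i) = 2 * t j * z 0 j"
    by (simp add: euler_square sum_delta_mult)
  with n[of "z 0 j * z 0 j"] have "nul (2 * t j * z 0 j)" by simp
  from euler_nul[OF this, of j] euler_mult_const[of 0 "2 * t j" j 0 j] t p
  have "of_nat (Suc 1) * t j = 0" by simp
  then show ?thesis using t torsion_free vctD by blast
qed

text \<open>With arbitrary multipliers, powers of x remove the jet dependence of \<open>t\<close>
  and the multiplier \<open>z 0 j\<close> gives \<open>t\<close> itself as an Euler
  derivative.\<close>

lemma mult_nondegenerate:
  assumes t: "t \<in> AA" and n: "\<And>f. f \<in> AA \<Longrightarrow> nul (f * t)"
  shows "t = 0"
proof -
  fix j :: 'n
  have p: "pd m i t = 0" for m i using nul_x_pow_imp_pd[OF t] n by simp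
  have "nul (t * z 0 j)" using n[of "z 0 j"] by (simp add: mult.commute)
  from euler_nul[OF this, of j] euler_mult_const[of 0 t j 0 j] t p show ?thesis by simp
qed

text \<open>The classical Helmholtz conditions for covectors depending on the zeroth and first jet
  variables. They are the coefficients of the integrated identity \<open>helmholtz\<close> for
  variations concentrated in the single components j and i.\<close>

lemma helmholtz_first_order:
  assumes f: "f \<in> AA" and o: "\<And>i. ordle 1 (euler i f)"
  shows "pd 1 j (euler i f) = - pd 1 i (euler j f)"
    and "pd 0 j (euler i f) - pd 0 i (euler j f) = D (pd 1 j (euler i f))"
proof -
  define w where "w i = euler i f" for i
  have w [simp]: "w i \<in> AA" for i using f by (simp add: w_def)
  \<comment> \<open>\<open>R \<eta>\<close> is the factor of \<xi> once the derivative has been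
    moved off \<xi>; it is a first-order operator in \<eta> whose coefficients are the conditions
    sought.\<close>
  define R where "R \<eta> = \<eta> * pd 0 j (w i) - D (\<eta> * pd 1 j (w i)) - \<eta> * pd 0 i (w j) - D \<eta> * pd 1 i (w j)" for \<eta>
  have R: "R \<eta> = 0" if \<eta>: "\<eta> \<in> AA" for \<eta>
  proof (rule mult_nondegenerate)
    show "R \<eta> \<in> AA" unfolding R_def using \<eta> by simp
    fix \<xi> assume \<xi>: "\<xi> \<in> AA"
    define X where "X = (\<lambda>k. if k = j then \<xi> else 0)"
    define Y where "Y = (\<lambda>k. if k = i then \<eta> else 0)"
    have XY: "vct X" "vct Y" using \<xi> \<eta> by (auto simp: vct_def X_def Y_def)
    have pX: "pr X (w k) = \<xi> * pd 0 j (w k) + D \<xi> * pd 1 j (w k)" for k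
      using pr_eq[OF o[folded w_def]] by (simp add: X_def if_distrib[of D] if_distrib[of "\<lambda>x. x * _"] cong: if_cong)
    have pY: "pr Y (w k) = \<eta> * pd 0 i (w k) + D \<eta> * pd 1 i (w k)" for k
      using pr_eq[OF o[folded w_def]] by (simp add: Y_def if_distrib[of D] if_distrib[of "\<lambda>x. x * _"] cong: if_cong)
    have "nul (\<eta> * pr X (w i) - \<xi> * pr Y (w j))"
      using helmholtz[OF XY f] by (simp add: w_def[symmetric] X_def Y_def if_distrib[of "\<lambda>x. x * _"] cong: if_cong)
    \<comment> \<open>This exact term carries the integration by parts that frees \<xi> of its
      derivative.\<close>
    then have "nul (\<eta> * pr X (w i) - \<xi> * pr Y (w j) - D (\<xi> * (\<eta> * pd 1 j (w i))))"
      by (rule nul_diff, intro nul_D) (use \<xi> \<eta> in simp)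
    also have "\<eta> * pr X (w i) - \<xi> * pr Y (w j) - D (\<xi> * (\<eta> * pd 1 j (w i))) = \<xi> * R \<eta>"
      unfolding pX pY R_def using \<xi> \<eta> by (simp add: algebra_simps)
    finally show "nul (\<xi> * R \<eta>)" .
  qed
  from R[of 1] show 1: "pd 0 j (euler i f) - pd 0 i (euler j f) = D (pd 1 j (euler i f))"
    by (simp add: R_def w_def algebra_simps f)
  \<comment> \<open>The value at 1 is the zeroth-order coefficient; \<open>R xx - xx * R 1\<close>
    isolates the coefficient of \<open>D \<eta>\<close>, since \<open>D xx = 1\<close>.\<close>
  from R[of xx] R[of 1] have "- pd 1 j (w i) - pd 1 i (w j) = R xx - xx * R 1"
    by (simp add: R_def algebra_simps)
  then show "pd 1 j (euler i f) = - pd 1 i (euler j f)"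
    using R[of xx] R[of 1] by (simp add: w_def eq_neg_iff_add_eq_0 algebra_simps)
      (metis add.commute add.left_inverse)
qed

end


section \<open>The Jacobi identity for third-order operators\<close>

lemma sum_rotate: "(\<Sum>i\<in>A. \<Sum>j\<in>B. \<Sum>k\<in>C. f i j k) = (\<Sum>k\<in>C. \<Sum>i\<in>A. \<Sum>j\<in>B. f i j k)"
proof -
  have "(\<Sum>j\<in>B. \<Sum>k\<in>C. f i j k) = (\<Sum>k\<in>C. \<Sum>j\<in>B. f i j k)" for i by (rule sum.swap)
  then show ?thesis by (simp only: sum.swap[of _ A C])
qed

context diff_algebra
begin

definition dot :: "('n \<Rightarrow> 'r) \<Rightarrow> ('n \<Rightarrow> 'r) \<Rightarrow> 'r" where
  "dot a v = (\<Sum>i\<in>UNIV. a i * v i)"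

lemma vec_closed [simp]: "vct a \<Longrightarrow> vct b \<Longrightarrow> vct (a + b)" "vct a \<Longrightarrow> vct b \<Longrightarrow> vct (a - b)"
  "vct a \<Longrightarrow> vct (- a)" "vct 0" "vct (z m)"
  by (auto simp: vct_def fun_Compl_def)

lemma vec_der: "der d \<Longrightarrow> vct a \<Longrightarrow> vct (d \<circ> a)"
  by (auto simp: vct_def der_in)

lemma vec_D [simp]: "vct a \<Longrightarrow> vct (D \<circ> a)" and vec_pd [simp]: "vct a \<Longrightarrow> vct (pd m i \<circ> a)"
  and vec_pr [simp]: "vct X \<Longrightarrow> vct a \<Longrightarrow> vct (pr X \<circ> a)"
  using vec_der der_D der_pd der_pr by blast+

lemma der_vec_simps:
  assumes "der d"
  shows "vct a \<Longrightarrow> vct b \<Longrightarrow> d \<circ> (a + b) = (d \<circ> a) + (d \<circ> b)"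
    "vct a \<Longrightarrow> vct b \<Longrightarrow> d \<circ> (a - b) = (d \<circ> a) - (d \<circ> b)"
    "vct a \<Longrightarrow> d \<circ> (- a) = - (d \<circ> a)" "d \<circ> 0 = 0"
  using assms by (auto simp: fun_eq_iff der_simps)

lemmas D_vec_simps [simp] = der_vec_simps[OF der_D]
lemmas pd_vec_simps [simp] = der_vec_simps[OF der_pd]

lemma pr_D_vec: "vct X \<Longrightarrow> vct a \<Longrightarrow> pr X \<circ> (D \<circ> a) = D \<circ> (pr X \<circ> a)"
  by (auto simp: fun_eq_iff pr_D)

lemma dot_in [simp]: "vct a \<Longrightarrow> vct b \<Longrightarrow> dot a b \<in> AA"
  by (auto simp: dot_def)

lemma dot_linear: "dot (a + b) v = dot a v + dot b v" "dot a (v + w) = dot a v + dot a w"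
  "dot (a - b) v = dot a v - dot b v" "dot a (v - w) = dot a v - dot a w"
  "dot (- a) v = - dot a v" "dot a (- v) = - dot a v" "dot 0 v = 0" "dot a 0 = 0"
  by (simp_all add: dot_def algebra_simps sum.distrib sum_subtractf sum_negf)

lemma der_dot: "der d \<Longrightarrow> vct a \<Longrightarrow> vct b \<Longrightarrow> d (dot a b) = dot (d \<circ> a) b + dot a (d \<circ> b)"
  by (simp add: dot_def der_simps sum.distrib)

lemma nul_dot_D: "vct a \<Longrightarrow> vct b \<Longrightarrow> nul (dot a (D \<circ> b) + dot (D \<circ> a) b)"
  using nul_D[of "dot a b"] by (simp add: der_dot[OF der_D] add.commute)

definition eul :: "'r \<Rightarrow> 'n \<Rightarrow> 'r" where "eul F = (\<lambda>i. euler i F)"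

lemma eul_vec [simp]: "F \<in> AA \<Longrightarrow> vct (eul F)" by (simp add: eul_def vct_def)

lemma euler_pr_dot: "vct X \<Longrightarrow> f \<in> AA \<Longrightarrow> nul (pr X f - dot (eul f) X)"
  using euler_pr by (simp add: dot_def eul_def mult.commute)

lemma helmholtz_dot: "vct X \<Longrightarrow> vct Y \<Longrightarrow> f \<in> AA
    \<Longrightarrow> nul (dot (pr X \<circ> eul f) Y - dot (pr Y \<circ> eul f) X)"
  using helmholtz by (simp add: dot_def eul_def mult.commute)

text \<open>Modulo total derivatives the outer bracket is a prolongation along
  \<open>P (eul H)\<close>. Where it falls on variational derivatives, skew-adjointness of
  \<open>P\<close> and the Helmholtz identity make the cyclic sum cancel; only the variation
  \<open>P'\<close> of the coefficients of \<open>P\<close> survives.\<close>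

lemma jacobi_reduce:
  fixes P :: "('n \<Rightarrow> 'r) \<Rightarrow> ('n \<Rightarrow> 'r)"
  defines "bk F G \<equiv> dot (eul F) (P (eul G))"
    and "P' X b \<equiv> (pr X \<circ> P b) - P (pr X \<circ> b)"
  assumes P: "\<And>a. vct a \<Longrightarrow> vct (P a)"
    and skew: "\<And>a b. vct a \<Longrightarrow> vct b \<Longrightarrow> nul (dot a (P b) + dot b (P a))"
    and F: "F \<in> AA" "G \<in> AA" "H \<in> AA"
  shows "nul (bk (bk F G) H + bk (bk G H) F + bk (bk H F) G
    - (dot (eul F) (P' (P (eul H)) (eul G)) + dot (eul G) (P' (P (eul F)) (eul H))
       + dot (eul H) (P' (P (eul G)) (eul F))))"
proof -
  have *: "nul (bk (bk F G) H - (dot (pr (P (eul H)) \<circ> eul F) (P (eul G))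
      + dot (eul F) (P' (P (eul H)) (eul G)) - dot (pr (P (eul H)) \<circ> eul G) (P (eul F))))"
    if F: "F \<in> AA" "G \<in> AA" "H \<in> AA" for F G H
  proof -
    define X where "X = P (eul H)"
    have X: "vct X" unfolding X_def using P F by simp
    have bk: "bk F G \<in> AA" unfolding bk_def using P F by simp
    have 1: "nul (pr X (bk F G) - bk (bk F G) H)"
      using euler_pr_dot[OF X bk] by (simp add: bk_def X_def)
    have 2: "pr X (bk F G) = dot (pr X \<circ> eul F) (P (eul G)) + dot (eul F) (P' X (eul G))
        + dot (eul F) (P (pr X \<circ> eul G))"
      unfolding bk_def P'_def using F P X by (simp add: der_dot[OF der_pr] dot_linear)
    have 3: "nul (dot (eul F) (P (pr X \<circ> eul G)) + dot (pr X \<circ> eul G) (P (eul F)))"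
      using skew F X by simp
    show ?thesis
      using nul_uminus[OF nul_diff[OF 1 3]] unfolding 2 X_def[symmetric] by (simp add: algebra_simps)
  qed
  have h: "nul (dot (pr (P (eul H)) \<circ> eul F) (P (eul G)) - dot (pr (P (eul G)) \<circ> eul F) (P (eul H)))"
    if F: "F \<in> AA" "G \<in> AA" "H \<in> AA" for F G H
    using helmholtz_dot F P by simp
  show ?thesis
    using nul_add[OF nul_add[OF nul_add[OF *[OF F(1) F(2) F(3)] *[OF F(2) F(3) F(1)]] *[OF F(3) F(1) F(2)]]
      nul_add[OF nul_add[OF h[OF F(1) F(2) F(3)] h[OF F(2) F(3) F(1)]] h[OF F(3) F(1) F(2)]]]
    by (simp add: algebra_simps)
qed

end

text \<open>\<open>gl\<close> is the inverse matrix of \<open>gu = g\<close>, \<open>Gam p i k\<close> stands for \<open>g\<^sub>i\<^sub>m c\<^sup>m\<^sup>p\<^sub>k\<close>, and the fields \<open>u\<close> are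
  the jet coordinates \<open>z s\<close>.\<close>

locale third_order = diff_algebra AA D pd z xx
  for AA :: "'r::comm_ring_1 set" and D and pd :: "nat \<Rightarrow> 'n::finite \<Rightarrow> 'r \<Rightarrow> 'r" and z xx +
  fixes s :: nat and gu gl :: "'n \<Rightarrow> 'n \<Rightarrow> 'r" and Gam :: "'n \<Rightarrow> 'n \<Rightarrow> 'n \<Rightarrow> 'r"
  assumes gu_in [simp]: "gu i j \<in> AA" and gl_in [simp]: "gl i j \<in> AA" and Gam_in [simp]: "Gam p i k \<in> AA"
    and gl_sym: "gl i j = gl j i"
    and gl_gu: "(\<Sum>j\<in>UNIV. gl i j * gu j k) = (if i = k then 1 else 0)"
    and gu_gl: "(\<Sum>j\<in>UNIV. gu i j * gl j k) = (if i = k then 1 else 0)"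
    and pd_coef: "m \<noteq> s \<Longrightarrow> pd m k (gu i j) = 0" "m \<noteq> s \<Longrightarrow> pd m k (gl i j) = 0"
      "m \<noteq> s \<Longrightarrow> pd m k (Gam p i j) = 0"
    and D_coef: "D (gl i j) = (\<Sum>k\<in>UNIV. pd s k (gl i j) * z (Suc s) k)"
      "D (Gam p i j) = (\<Sum>k\<in>UNIV. pd s k (Gam p i j) * z (Suc s) k)"
    and metric: "pd s k (gl i j) = - (\<Sum>p\<in>UNIV. gl i p * Gam p j k) - (\<Sum>p\<in>UNIV. gl j p * Gam p i k)"
begin

definition br :: "('n \<Rightarrow> 'r) \<Rightarrow> ('n \<Rightarrow> 'r) \<Rightarrow> 'n \<Rightarrow> 'r" where
  "br x y = (\<lambda>p. \<Sum>i\<in>UNIV. \<Sum>k\<in>UNIV. Gam p i k * x i * y k)"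

definition dbr :: "('n \<Rightarrow> 'r) \<Rightarrow> ('n \<Rightarrow> 'r) \<Rightarrow> ('n \<Rightarrow> 'r) \<Rightarrow> 'n \<Rightarrow> 'r" where
  "dbr v x y = (\<lambda>p. \<Sum>i\<in>UNIV. \<Sum>k\<in>UNIV. (\<Sum>m\<in>UNIV. pd s m (Gam p i k) * v m) * x i * y k)"

definition ip :: "('n \<Rightarrow> 'r) \<Rightarrow> ('n \<Rightarrow> 'r) \<Rightarrow> 'r" where
  "ip x y = (\<Sum>i\<in>UNIV. \<Sum>j\<in>UNIV. gl i j * x i * y j)"

definition sharp :: "('n \<Rightarrow> 'r) \<Rightarrow> 'n \<Rightarrow> 'r" where "sharp a = (\<lambda>i. \<Sum>j\<in>UNIV. gu i j * a j)"
definition flat :: "('n \<Rightarrow> 'r) \<Rightarrow> 'n \<Rightarrow> 'r" where "flat a = (\<lambda>i. \<Sum>j\<in>UNIV. gl i j * a j)"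
definition ee :: "'n \<Rightarrow> 'n \<Rightarrow> 'r" where "ee i = (\<lambda>j. if j = i then 1 else 0)"
abbreviation "ux \<equiv> z (Suc s)"
text \<open>Covariant derivative along \<open>ux\<close>; after raising an index it is the inner
  first-order operator of P, see \<open>QL_eq\<close>.\<close>

definition Q :: "('n \<Rightarrow> 'r) \<Rightarrow> 'n \<Rightarrow> 'r" where "Q x = (D \<circ> x) - br x ux"

lemma vec_ops [simp]: "vct x \<Longrightarrow> vct y \<Longrightarrow> vct (br x y)"
  "vct v \<Longrightarrow> vct x \<Longrightarrow> vct y \<Longrightarrow> vct (dbr v x y)" "vct x \<Longrightarrow> vct (sharp x)" "vct x \<Longrightarrow> vct (flat x)"
  "vct (ee i)"
proof -
  have "ee i j \<in> AA" for j by (simp add: ee_def)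
  then show "vct (ee i)" by (simp add: vct_def)
qed (auto simp: vct_def br_def dbr_def sharp_def flat_def)

lemma vec_Q [simp]: "vct x \<Longrightarrow> vct (Q x)" by (simp add: Q_def)

lemma ip_in [simp]: "vct x \<Longrightarrow> vct y \<Longrightarrow> ip x y \<in> AA"
  by (auto simp: ip_def)

lemma br_linear: "br (x + x') y = br x y + br x' y" "br (x - x') y = br x y - br x' y"
  "br x (y + y') = br x y + br x y'" "br x (y - y') = br x y - br x y'"
  "br (- x) y = - br x y" "br x (- y) = - br x y" "br 0 y = 0" "br x 0 = 0"
  by (auto simp: br_def fun_eq_iff algebra_simps sum.distrib sum_subtractf sum_negf)

lemma dbr_linear: "dbr v (x + x') y = dbr v x y + dbr v x' y" "dbr v (x - x') y = dbr v x y - dbr v x' y"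
  "dbr v x (y + y') = dbr v x y + dbr v x y'" "dbr v x (y - y') = dbr v x y - dbr v x y'"
  "dbr v (- x) y = - dbr v x y" "dbr v x (- y) = - dbr v x y" "dbr v 0 y = 0" "dbr v x 0 = 0"
  "dbr (v + v') x y = dbr v x y + dbr v' x y" "dbr (v - v') x y = dbr v x y - dbr v' x y"
  "dbr (- v) x y = - dbr v x y" "dbr 0 x y = 0"
  by (auto simp: dbr_def fun_eq_iff algebra_simps sum.distrib sum_subtractf sum_negf)

lemma ip_linear: "ip (x + x') y = ip x y + ip x' y" "ip (x - x') y = ip x y - ip x' y"
  "ip x (y + y') = ip x y + ip x y'" "ip x (y - y') = ip x y - ip x y'"
  "ip (- x) y = - ip x y" "ip x (- y) = - ip x y" "ip 0 y = 0" "ip x 0 = 0"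
  by (auto simp: ip_def algebra_simps sum.distrib sum_subtractf sum_negf)

lemma sharp_linear: "sharp (a + b) = sharp a + sharp b" "sharp (a - b) = sharp a - sharp b"
   "sharp (- a) = - sharp a" "sharp 0 = 0"
  by (auto simp: sharp_def fun_eq_iff algebra_simps sum.distrib sum_subtractf sum_negf)

lemmas linear_simps = br_linear dbr_linear ip_linear sharp_linear dot_linear

lemma ip_sym: "ip x y = ip y x"
  unfolding ip_def by (subst sum.swap) (simp add: gl_sym[symmetric] mult_ac gl_sym)

lemma dot_flat: "dot (flat x) y = ip x y"
  unfolding dot_def flat_def ip_def sum_distrib_right
  by (subst sum.swap) (simp add: gl_sym)

lemma flat_sharp [simp]: "flat (sharp a) = a"
proof
  fix i
  have "flat (sharp a) i = (\<Sum>k\<in>UNIV. (\<Sum>j\<in>UNIV. gl i j * gu j k) * a k)"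
    unfolding flat_def sharp_def sum_distrib_left sum_distrib_right
    by (subst sum.swap) (simp add: mult.assoc)
  then show "flat (sharp a) i = a i" by (simp add: gl_gu sum_delta_mult)
qed

lemma sharp_flat [simp]: "sharp (flat a) = a"
proof
  fix i
  have "sharp (flat a) i = (\<Sum>k\<in>UNIV. (\<Sum>j\<in>UNIV. gu i j * gl j k) * a k)"
    unfolding flat_def sharp_def sum_distrib_left sum_distrib_right
    by (subst sum.swap) (simp add: mult.assoc)
  then show "sharp (flat a) i = a i" by (simp add: gu_gl sum_delta_mult)
qed

lemma ip_sharp: "ip (sharp a) y = dot a y" "ip y (sharp a) = dot a y"
  using dot_flat[of "sharp a" y] ip_sym by auto

lemma dot_ee: "dot a (ee i) = a i" "dot (ee i) a = a i"
  by (simp_all add: dot_def ee_def sum_delta_mult)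

lemma ip_ee: "ip (ee i) x = flat x i"
  by (metis dot_ee(1) dot_flat ip_sym)

lemma ip_nondegenerate: "(\<And>i. ip (ee i) x = ip (ee i) y) \<Longrightarrow> x = y"
  by (metis ext ip_ee sharp_flat)

text \<open>A derivation that acts on the coefficients as the directional derivative along
  \<open>v\<close>. Total derivative, jet derivatives and prolongations are all of this kind, so
  each product rule below is proved once.\<close>

definition cder :: "('r \<Rightarrow> 'r) \<Rightarrow> ('n \<Rightarrow> 'r) \<Rightarrow> bool" where
  "cder d v \<longleftrightarrow> der d \<and> vct v \<and> (\<forall>i j. d (gl i j) = (\<Sum>k\<in>UNIV. pd s k (gl i j) * v k))
     \<and> (\<forall>p i j. d (Gam p i j) = (\<Sum>k\<in>UNIV. pd s k (Gam p i j) * v k))"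

lemma cder_D: "cder D ux"
  unfolding cder_def using der_D D_coef by simp

lemma cder_pd_s: "cder (pd s i) (ee i)"
  unfolding cder_def by (simp add: der_pd ee_def[THEN fun_cong] sum_delta_mult)

lemma cder_pd: "m \<noteq> s \<Longrightarrow> cder (pd m i) 0"
  unfolding cder_def by (simp add: der_pd pd_coef)

text \<open>A prolongation moves \<open>z s\<close> by \<open>(D ^^ s) (X i)\<close>, so the
  direction is \<open>X\<close> itself only for \<open>s = 0\<close>.\<close>

lemma cder_pr: assumes X: "vct X" and s: "s = 0" shows "cder (pr X) X"
proof -
  have "ordle 0 (gl i j)" "ordle 0 (Gam p i j)" for i j p
    using pd_coef s by (auto simp: ordle_def)
  from pr_eq[OF this(1)] pr_eq[OF this(2)] show ?thesis
    unfolding cder_def by (simp add: der_pr X s mult.commute)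
qed

lemma br_der: assumes d: "cder d v" and [simp]: "vct x" "vct y"
  shows "d \<circ> br x y = br (d \<circ> x) y + br x (d \<circ> y) + dbr v x y"
proof
  fix p
  note [simp] = der_simps[OF conjunct1[OF d[unfolded cder_def]]]
  show "(d \<circ> br x y) p = (br (d \<circ> x) y + br x (d \<circ> y) + dbr v x y) p"
    using d by (simp add: br_def dbr_def cder_def algebra_simps sum.distrib)
qed

lemma ip_br: "ip x (br y v) = (\<Sum>i\<in>UNIV. \<Sum>j\<in>UNIV. (\<Sum>k\<in>UNIV. (\<Sum>p\<in>UNIV. gl i p * Gam p j k) * v k) * x i * y j)"
proof -
  have "(\<Sum>p\<in>UNIV. gl i p * x i * br y v p) = (\<Sum>j\<in>UNIV. (\<Sum>k\<in>UNIV. (\<Sum>p\<in>UNIV. gl i p * Gam p j k) * v k) * x i * y j)" for i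
  proof -
    have "(\<Sum>p\<in>UNIV. gl i p * x i * br y v p) = (\<Sum>p\<in>UNIV. \<Sum>j\<in>UNIV. \<Sum>k\<in>UNIV. gl i p * x i * (Gam p j k * y j * v k))"
      by (simp add: br_def sum_distrib_left)
    also have "\<dots> = (\<Sum>j\<in>UNIV. \<Sum>k\<in>UNIV. \<Sum>p\<in>UNIV. gl i p * x i * (Gam p j k * y j * v k))"
      by (subst sum.swap, intro sum.cong refl sum.swap)
    finally show ?thesis
      by (simp add: sum_distrib_right sum_distrib_left mult_ac)
  qed
  then show ?thesis by (simp add: ip_def)
qed

text \<open>The derivative of the metric is eliminated through \<open>metric\<close>; from here on
  only brackets occur.\<close>

lemma ip_der: assumes d: "cder d v" and [simp]: "vct x" "vct y"
  shows "d (ip x y) = ip (d \<circ> x) y + ip x (d \<circ> y) - ip x (br y v) - ip y (br x v)"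
proof -
  note [simp] = der_simps[OF conjunct1[OF d[unfolded cder_def]]]
  have "d (gl i j) = - (\<Sum>k\<in>UNIV. (\<Sum>p\<in>UNIV. gl i p * Gam p j k) * v k)
      - (\<Sum>k\<in>UNIV. (\<Sum>p\<in>UNIV. gl j p * Gam p i k) * v k)" for i j
    using d by (simp add: cder_def metric left_diff_distrib sum_subtractf sum_negf)
  then have "d (ip x y) = ip (d \<circ> x) y + ip x (d \<circ> y) - ip x (br y v)
     - (\<Sum>i\<in>UNIV. \<Sum>j\<in>UNIV. (\<Sum>k\<in>UNIV. (\<Sum>p\<in>UNIV. gl j p * Gam p i k) * v k) * x i * y j)"
    unfolding ip_br by (simp add: ip_def distrib_right left_diff_distrib distrib_left sum.distrib
        sum_subtractf sum_negf mult.assoc)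
  also have "(\<Sum>i\<in>UNIV. \<Sum>j\<in>UNIV. (\<Sum>k\<in>UNIV. (\<Sum>p\<in>UNIV. gl j p * Gam p i k) * v k) * x i * y j) = ip y (br x v)"
    unfolding ip_br by (subst sum.swap) (simp add: mult_ac)
  finally show ?thesis .
qed

text \<open>The connection term of \<open>Q\<close> cancels the derivative of the metric. This
  skew-adjointness up to a total derivative is the source of the skew-symmetry of P.\<close>

lemma Q_skew: "vct x \<Longrightarrow> vct y \<Longrightarrow> ip x (Q y) + ip (Q x) y = D (ip x y)"
  by (simp add: ip_der[OF cder_D] Q_def linear_simps ip_sym[of "br x ux"])

lemma Q_linear: "vct x \<Longrightarrow> vct y \<Longrightarrow> Q (x + y) = Q x + Q y" "vct x \<Longrightarrow> vct y \<Longrightarrow> Q (x - y) = Q x - Q y"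
   "vct x \<Longrightarrow> Q (- x) = - Q x"
  by (simp_all add: Q_def linear_simps)

text \<open>The metric adjoint of the map \<open>\<lambda>w. br w y\<close> applied to
  \<open>x\<close>, as \<open>ip_adj\<close> shows; it enters when indices are raised under a
  derivation.\<close>

definition adj :: "('n \<Rightarrow> 'r) \<Rightarrow> ('n \<Rightarrow> 'r) \<Rightarrow> 'n \<Rightarrow> 'r" where
  "adj x y = sharp (\<lambda>i. ip x (br (ee i) y))"

lemma vec_adj [simp]: "vct x \<Longrightarrow> vct y \<Longrightarrow> vct (adj x y)"
proof -
  assume "vct x" "vct y"
  then have "vct (\<lambda>i. ip x (br (ee i) y))" unfolding vct_def[of "\<lambda>i. ip x (br (ee i) y)"] by simp
  then show ?thesis unfolding adj_def by simp
qed

lemma br_ee: "br (ee i) y p = (\<Sum>k\<in>UNIV. Gam p i k * y k)"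
proof -
  have "br (ee i) y p = (\<Sum>j\<in>UNIV. (if j = i then 1 else 0) * (\<Sum>k\<in>UNIV. Gam p j k * y k))"
    by (simp add: br_def ee_def sum_distrib_left mult_ac)
  then show ?thesis by (simp only: sum_delta_mult) simp
qed

lemma br_ee_sum: "br w y = (\<lambda>p. \<Sum>i\<in>UNIV. w i * br (ee i) y p)"
  unfolding br_ee by (simp add: br_def sum_distrib_left mult_ac)

lemma ip_adj: "ip w (adj x y) = ip x (br w y)"
proof -
  have "ip x (br w y) = (\<Sum>i\<in>UNIV. \<Sum>j\<in>UNIV. \<Sum>k\<in>UNIV. gl i j * x i * (w k * br (ee k) y j))"
    by (subst br_ee_sum) (simp add: ip_def sum_distrib_left)
  also have "\<dots> = (\<Sum>k\<in>UNIV. \<Sum>i\<in>UNIV. \<Sum>j\<in>UNIV. gl i j * x i * (w k * br (ee k) y j))"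
    by (rule sum_rotate)
  also have "\<dots> = dot (\<lambda>k. ip x (br (ee k) y)) w"
    by (simp add: dot_def ip_def sum_distrib_right sum_distrib_left mult_ac)
  finally show ?thesis by (simp add: adj_def ip_sharp)
qed

text \<open>Defect of the rule for differentiating the bracket; it vanishes identically exactly when
  \<open>parallel\<close> holds. \<open>EE\<close> is the combination of defects that the variation
  of \<open>Q\<close> produces.\<close>

definition BB :: "('n \<Rightarrow> 'r) \<Rightarrow> ('n \<Rightarrow> 'r) \<Rightarrow> ('n \<Rightarrow> 'r) \<Rightarrow> 'n \<Rightarrow> 'r" where
  "BB v x y = dbr v x y - br (br x y) v"

definition EE :: "('n \<Rightarrow> 'r) \<Rightarrow> ('n \<Rightarrow> 'r) \<Rightarrow> 'n \<Rightarrow> 'r" where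
  "EE x X = BB ux x X - BB X x ux"

lemma vec_BB [simp]: "vct v \<Longrightarrow> vct x \<Longrightarrow> vct y \<Longrightarrow> vct (BB v x y)" by (simp add: BB_def)
lemma vec_EE [simp]: "vct x \<Longrightarrow> vct y \<Longrightarrow> vct (EE x y)" by (simp add: EE_def)

text \<open>\<open>QL\<close> is the inner operator of P on covectors; \<open>dQL X\<close> is the
  variation of its coefficients alone, the quantity left over by
  \<open>jacobi_reduce\<close>.\<close>

definition QL :: "('n \<Rightarrow> 'r) \<Rightarrow> 'n \<Rightarrow> 'r" where "QL b = Q (sharp b)"
definition dQL :: "('n \<Rightarrow> 'r) \<Rightarrow> ('n \<Rightarrow> 'r) \<Rightarrow> 'n \<Rightarrow> 'r" where
  "dQL X b = (pr X \<circ> QL b) - QL (pr X \<circ> b)"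

lemma vec_QL [simp]: "vct b \<Longrightarrow> vct (QL b)" by (simp add: QL_def)

text \<open>The pairing of \<open>ee i\<close> with \<open>sharp b\<close> is the component
  \<open>b i\<close>; applying \<open>ip_der\<close> to it and using non-degeneracy of the metric
  gives the correction terms.\<close>

lemma sharp_der: assumes d: "cder d v" and b: "vct b"
  shows "sharp (d \<circ> b) = (d \<circ> sharp b) - br (sharp b) v - adj (sharp b) v"
proof (rule ip_nondegenerate)
  fix i
  define x where "x = sharp b"
  have x: "vct x" using b by (simp add: x_def)
  have v: "vct v" and dd: "der d" using d by (auto simp: cder_def)
  have e: "d \<circ> ee i = 0" by (auto simp: fun_eq_iff ee_def der_simps[OF dd])
  have "ip (ee i) (sharp (d \<circ> b)) = d (ip (ee i) x)" by (simp add: ip_ee x_def)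
  also have "d (ip (ee i) x) = ip (ee i) ((d \<circ> x) - br x v - adj x v)"
    by (simp add: ip_der[OF d] x v e linear_simps ip_adj)
  finally show "ip (ee i) (sharp (d \<circ> b)) = ip (ee i) ((d \<circ> sharp b) - br (sharp b) v - adj (sharp b) v)"
    by (simp add: x_def)
qed

text \<open>Links the covariant form to the given operator: the inner sum over p is the coefficient
  with indices i, j, k of the first-order term.\<close>

lemma QL_eq: assumes b: "vct b"
  shows "QL b i = (\<Sum>j\<in>UNIV. gu i j * D (b j))
    + (\<Sum>j\<in>UNIV. \<Sum>k\<in>UNIV. (\<Sum>p\<in>UNIV. gu i p * Gam j p k) * ux k * b j)"
proof -
  have "QL b = sharp (D \<circ> b) + adj (sharp b) ux"
    using sharp_der[OF cder_D b] by (simp add: QL_def Q_def)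
  then have "QL b i = (\<Sum>j\<in>UNIV. gu i j * D (b j)) + (\<Sum>p\<in>UNIV. gu i p * dot b (br (ee p) ux))"
    by (simp add: sharp_def adj_def ip_sharp[unfolded sharp_def])
  also have "(\<Sum>p\<in>UNIV. gu i p * dot b (br (ee p) ux))
    = (\<Sum>p\<in>UNIV. \<Sum>j\<in>UNIV. \<Sum>k\<in>UNIV. gu i p * (b j * (Gam j p k * ux k)))"
    by (simp add: dot_def br_ee sum_distrib_left)
  also have "\<dots> = (\<Sum>j\<in>UNIV. \<Sum>k\<in>UNIV. \<Sum>p\<in>UNIV. gu i p * (b j * (Gam j p k * ux k)))"
    by (subst sum.swap, intro sum.cong refl sum.swap)
  finally show ?thesis by (simp add: sum_distrib_right sum_distrib_left mult_ac)
qed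

lemma QL_skew: "vct a \<Longrightarrow> vct b \<Longrightarrow> dot a (QL b) + dot b (QL a) = D (ip (sharp a) (sharp b))"
  using Q_skew[of "sharp a" "sharp b"] by (simp add: QL_def ip_sharp)

text \<open>Varying \<open>ux\<close> produces \<open>br x (D \<circ> X)\<close>, which cancels
  against the same term in \<open>Q (br x X)\<close>. Thus no derivative of \<open>X\<close> is left
  outside \<open>Q (adj x X)\<close>.\<close>

lemma dQL_eq:
  assumes s: "s = 0" and X [simp]: "vct X" and x [simp]: "vct x"
  shows "dQL X (flat x) = br (Q x) X + EE x X + Q (adj x X)"
proof -
  note pX = cder_pr[OF X s]
  have ux: "pr X \<circ> ux = D \<circ> X"
    by (simp add: fun_eq_iff s pr_z)
  have 1: "dQL X (flat x) = (pr X \<circ> Q x) - Q ((pr X \<circ> x) - br x X - adj x X)"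
    using sharp_der[OF pX, of "flat x"] by (simp add: dQL_def QL_def)
  have 2: "pr X \<circ> Q x = Q (pr X \<circ> x) - br x (D \<circ> X) - dbr X x ux"
    by (simp add: Q_def der_vec_simps[OF der_pr] br_der[OF pX] pr_D_vec ux)
  have 3: "Q ((pr X \<circ> x) - br x X - adj x X) = Q (pr X \<circ> x) - Q (br x X) - Q (adj x X)"
    by (simp add: Q_linear)
  have 4: "Q (br x X) = br (Q x) X + br (br x ux) X + br x (D \<circ> X) + dbr ux x X - br (br x X) ux"
    by (simp add: Q_def br_der[OF cder_D] linear_simps)
  show ?thesis unfolding 1 2 3 4 EE_def BB_def by simp
qed

lemma T1:
  assumes s: "s = 0" and [simp]: "vct X" "vct x" "vct y"
  shows "ip x (dQL X (flat y)) = ip x (br (Q y) X) - ip y (br (Q x) X) + ip x (EE y X) + D (ip y (br x X))"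
proof -
  have "ip x (Q (adj y X)) = D (ip y (br x X)) - ip y (br (Q x) X)"
    using Q_skew[of x "adj y X"] by (simp add: ip_adj algebra_simps)
  then show ?thesis by (simp add: dQL_eq[OF s] linear_simps)
qed

end


section \<open>Multilinear calculus and the three structure conditions\<close>

context third_order
begin

definition sm :: "'r \<Rightarrow> ('n \<Rightarrow> 'r) \<Rightarrow> 'n \<Rightarrow> 'r" where "sm f x = (\<lambda>i. f * x i)"

lemma sm_linear: "br (sm f x) y = sm f (br x y)" "br x (sm f y) = sm f (br x y)"
  "dbr (sm f v) x y = sm f (dbr v x y)" "dbr v (sm f x) y = sm f (dbr v x y)"
  "dbr v x (sm f y) = sm f (dbr v x y)" "ip (sm f x) y = f * ip x y" "ip x (sm f y) = f * ip x y"
  "sharp (sm f a) = sm f (sharp a)" "dot (sm f x) y = f * dot x y"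
  by (auto simp: br_def dbr_def ip_def sm_def fun_eq_iff sharp_def dot_def sum_distrib_left sum_distrib_right mult_ac)

lemma sm_arith: "sm f (x + y) = sm f x + sm f y" "sm f (x - y) = sm f x - sm f y"
  by (auto simp: sm_def fun_eq_iff algebra_simps)

lemma BB_linear: "BB (sm f v) x y = sm f (BB v x y)" "BB v (sm f x) y = sm f (BB v x y)"
  "BB v x (sm f y) = sm f (BB v x y)" "EE (sm f x) y = sm f (EE x y)" "EE x (sm f y) = sm f (EE x y)"
  by (simp_all add: BB_def EE_def sm_linear sm_arith)

text \<open>Linearity over the ring is encoded as representability by a coefficient vector, so that
  the values on the vectors \<open>ee i\<close> determine the functional.\<close>

definition lin :: "(('n \<Rightarrow> 'r) \<Rightarrow> 'r) \<Rightarrow> bool" where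
  "lin L \<longleftrightarrow> (\<exists>c. \<forall>w. L w = dot c w)"

lemma linD: assumes "lin L" shows "L w = dot (\<lambda>i. L (ee i)) w"
proof -
  obtain c where c: "L w = dot c w" for w using assms lin_def by blast
  then have "(\<lambda>i. L (ee i)) = c" by (simp add: dot_ee)
  with c show ?thesis by simp
qed

lemma lin_zero: "lin L \<Longrightarrow> (\<And>i. L (ee i) = 0) \<Longrightarrow> L w = 0"
  by (subst linD) (simp_all add: dot_def)

lemma lin_mult: assumes "lin L" shows "lin (\<lambda>w. f * L w)"
proof -
  obtain c where "L w = dot c w" for w using assms lin_def by metis
  then have "f * L w = dot (sm f c) w" for w by (simp add: sm_linear)
  then show ?thesis unfolding lin_def by blast
qed

lemma lin_uminus: "lin L \<Longrightarrow> lin (\<lambda>w. - L w)"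
  using lin_mult[of L "- 1"] by simp

lemma lin_add: assumes "lin L" "lin M" shows "lin (\<lambda>w. L w + M w)"
proof -
  obtain c c' where "L w = dot c w" "M w = dot c' w" for w using assms lin_def by metis
  then have "L w + M w = dot (c + c') w" for w by (simp add: dot_linear)
  then show ?thesis unfolding lin_def by blast
qed

lemma lin_diff: "lin L \<Longrightarrow> lin M \<Longrightarrow> lin (\<lambda>w. L w - M w)"
  using lin_add[of L "\<lambda>w. - M w"] lin_uminus by simp

lemma lin_0: "lin (\<lambda>w. 0)"
  unfolding lin_def using dot_linear(7) by metis

lemma lin_sum: "(\<And>i. lin (L i)) \<Longrightarrow> lin (\<lambda>w. \<Sum>i\<in>I. L i w)"
  by (induction I rule: infinite_finite_induct) (auto intro: lin_add lin_0)

lemma lin_comp: assumes "lin L" "\<And>p. lin (\<lambda>w. M w p)" shows "lin (\<lambda>w. L (M w))"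
proof -
  have "lin (\<lambda>w. \<Sum>j\<in>UNIV. L (ee j) * M w j)"
    by (intro lin_sum lin_mult assms)
  moreover have "L (M w) = (\<Sum>j\<in>UNIV. L (ee j) * M w j)" for w
    using linD[OF assms(1), of "M w"] by (simp add: dot_def)
  ultimately show ?thesis by simp
qed

lemma lin_proj: "lin (\<lambda>w. w p)"
  unfolding lin_def using dot_ee(2) by metis

lemma lin_br: "lin (\<lambda>w. br w y p)" "lin (\<lambda>w. br x w p)"
proof -
  show "lin (\<lambda>w. br x w p)" unfolding br_def by (intro lin_sum lin_mult lin_proj)
  have "br w y p = (\<Sum>i\<in>UNIV. \<Sum>k\<in>UNIV. (Gam p i k * y k) * w i)" for w
    by (simp add: br_def mult_ac)
  then show "lin (\<lambda>w. br w y p)" by (simp only:) (intro lin_sum lin_mult lin_proj)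
qed

lemma lin_dbr: "lin (\<lambda>w. dbr w x y p)" "lin (\<lambda>w. dbr v w y p)" "lin (\<lambda>w. dbr v x w p)"
proof -
  have e: "dbr v x y p = (\<Sum>i\<in>UNIV. \<Sum>k\<in>UNIV. \<Sum>m\<in>UNIV. (pd s m (Gam p i k) * x i * y k) * v m)" for v x y
    by (simp add: dbr_def sum_distrib_left sum_distrib_right mult_ac)
  show "lin (\<lambda>w. dbr w x y p)" unfolding e by (intro lin_sum lin_mult lin_proj)
  have e: "dbr v x y p = (\<Sum>i\<in>UNIV. \<Sum>k\<in>UNIV. \<Sum>m\<in>UNIV. (pd s m (Gam p i k) * v m * y k) * x i)" for v x y
    by (simp add: dbr_def sum_distrib_left sum_distrib_right mult_ac)
  show "lin (\<lambda>w. dbr v w y p)" unfolding e by (intro lin_sum lin_mult lin_proj)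
  have e: "dbr v x y p = (\<Sum>i\<in>UNIV. \<Sum>k\<in>UNIV. \<Sum>m\<in>UNIV. (pd s m (Gam p i k) * v m * x i) * y k)" for v x y
    by (simp add: dbr_def sum_distrib_left sum_distrib_right mult_ac)
  show "lin (\<lambda>w. dbr v x w p)" unfolding e by (intro lin_sum lin_mult lin_proj)
qed

lemma lin_BB: "lin (\<lambda>w. BB w x y p)" "lin (\<lambda>w. BB v w y p)" "lin (\<lambda>w. BB v x w p)"
  unfolding BB_def by (auto intro!: lin_diff lin_dbr lin_br lin_comp[OF lin_br(1)])

lemma lin_EE: "lin (\<lambda>w. EE w y p)" "lin (\<lambda>w. EE x w p)"
  unfolding EE_def by (auto intro!: lin_diff lin_BB)

lemma lin_ip: "lin (\<lambda>w. ip w x)" "lin (\<lambda>w. ip x w)"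
proof -
  show "lin (\<lambda>w. ip x w)" unfolding ip_def by (intro lin_sum lin_mult lin_proj)
  then show "lin (\<lambda>w. ip w x)" by (simp add: ip_sym)
qed

lemma lin_sharp: "lin (\<lambda>w. sharp w p)"
  unfolding sharp_def by (intro lin_sum lin_mult lin_proj)

text \<open>Basis covectors are the available tests, so vectors are tested in the form
  \<open>sharp (ee q)\<close>; this is enough because \<open>sharp\<close> is onto.\<close>

lemma lin_sharp_zero: assumes "lin L" "\<And>q. L (sharp (ee q)) = 0" shows "L w = 0"
  using lin_zero[of "\<lambda>a. L (sharp a)" "flat w"] lin_comp[OF assms(1) lin_sharp] assms(2) by simp

definition CC :: "('n \<Rightarrow> 'r) \<Rightarrow> ('n \<Rightarrow> 'r) \<Rightarrow> ('n \<Rightarrow> 'r) \<Rightarrow> 'r" where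
  "CC x y w = ip x (br y w) + ip y (br w x) + ip w (br x y)"

lemma lin_CC: "lin (\<lambda>w. CC w x y)" "lin (\<lambda>w. CC x w y)" "lin (\<lambda>w. CC x y w)"
  unfolding CC_def by (intro lin_add lin_ip lin_comp[OF lin_ip(2) lin_br(1)] lin_comp[OF lin_ip(2) lin_br(2)])+

lemma CC_in [simp]: "vct x \<Longrightarrow> vct y \<Longrightarrow> vct w \<Longrightarrow> CC x y w \<in> AA"
  by (simp add: CC_def)

definition skew :: bool where "skew \<longleftrightarrow> (\<forall>p i k. Gam p i k = - Gam p k i)"
definition cyclic :: bool where
  "cyclic \<longleftrightarrow> (\<forall>i j k. CC (ee i) (ee j) (ee k) = 0)"
definition parallel :: bool where
  "parallel \<longleftrightarrow> (\<forall>p i k v. pd s v (Gam p i k) = (\<Sum>r\<in>UNIV. Gam r i k * Gam p r v))"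

lemma br_skew: assumes skew shows "br x y = - br y x"
proof
  fix p
  have "Gam p i k * x i * y k = - (Gam p k i * y k * x i)" for i k
    by (subst assms[unfolded skew_def, rule_format, of p i k]) (simp add: mult_ac)
  then have "br x y p = (\<Sum>i\<in>UNIV. \<Sum>k\<in>UNIV. - (Gam p k i * y k * x i))"
    unfolding br_def by (intro sum.cong refl)
  also have "\<dots> = (- br y x) p" unfolding br_def by (subst sum.swap) (simp add: sum_negf)
  finally show "br x y p = (- br y x) p" .
qed

lemma CC_zero: assumes cyclic shows "CC x y w = 0"
proof -
  have "CC x (ee j) (ee k) = 0" for x j k
    by (rule lin_zero[OF lin_CC(1)]) (use assms in \<open>simp add: cyclic_def\<close>)
  then have "CC x y (ee k) = 0" for x y k by (rule lin_zero[OF lin_CC(2)])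
  then show ?thesis by (rule lin_zero[OF lin_CC(3)])
qed

lemma br_ee_ee: "br (ee i) (ee k) p = Gam p i k"
  by (simp add: br_ee ee_def[THEN fun_cong] sum_delta_mult)

lemma BB_ee: "BB (ee v) (ee i) (ee k) p = pd s v (Gam p i k) - (\<Sum>r\<in>UNIV. Gam r i k * Gam p r v)"
proof -
  have "dbr (ee v) (ee i) (ee k) p = pd s v (Gam p i k)"
    by (simp add: dbr_def ee_def[THEN fun_cong] sum_delta_mult)
  moreover have "br (br (ee i) (ee k)) (ee v) p = (\<Sum>r\<in>UNIV. Gam r i k * Gam p r v)"
    by (subst br_ee_sum) (simp add: br_ee_ee)
  ultimately show ?thesis by (simp add: BB_def)
qed

lemma BB_zero: assumes parallel shows "BB v x y = 0"
proof
  fix p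
  have "BB v (ee j) (ee k) p = 0" for v j k
    by (rule lin_zero[OF lin_BB(1)]) (use assms in \<open>simp add: parallel_def BB_ee\<close>)
  then have "BB v x (ee k) p = 0" for v x k by (rule lin_zero[OF lin_BB(2)])
  then show "BB v x y p = 0 p" by (simp add: lin_zero[OF lin_BB(3)])
qed

lemma parallel_if_BB: "(\<And>v i k. BB (ee v) (ee i) (ee k) = 0) \<Longrightarrow> parallel"
  unfolding parallel_def using BB_ee by (metis eq_iff_diff_eq_0 zero_fun_apply)

definition bb :: "'n \<Rightarrow> 'n \<Rightarrow> 'n \<Rightarrow> 'n \<Rightarrow> 'r" where
  "bb i j k v = ip (ee i) (BB (ee v) (ee j) (ee k))"

lemma bb_in [simp]: "bb i j k v \<in> AA" by (simp add: bb_def)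

lemma der_ee: "der d \<Longrightarrow> d \<circ> ee i = 0"
  by (auto simp: fun_eq_iff ee_def der_simps)

text \<open>Equality of the mixed second derivatives of the metric; the terms quadratic in the
  bracket are symmetric in the two directions and drop out.\<close>

lemma bb_metric: "bb i j k v + bb j i k v = bb i j v k + bb j i v k"
proof -
  have 1: "pd s k (gl i j) = - ip (ee i) (br (ee j) (ee k)) - ip (ee j) (br (ee i) (ee k))" for i j k
    by (simp add: metric ip_ee flat_def br_ee_ee)
  have 2: "pd s v (ip (ee i) (br (ee j) (ee k))) = bb i j k v - ip (br (ee j) (ee k)) (br (ee i) (ee v))" for i j k v
    by (simp add: ip_der[OF cder_pd_s] br_der[OF cder_pd_s] der_ee[OF der_pd] linear_simps bb_def BB_def)
  have "pd s v (pd s k (gl i j)) = pd s k (pd s v (gl i j))"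
    by (rule pd_commute) simp
  then show ?thesis
    unfolding 1 by (simp add: 2 ip_sym[of "br (ee i) (ee v)"] ip_sym[of "br (ee j) (ee v)"])
      (simp add: algebra_simps)
qed

end

section \<open>The Jacobi sum as a trilinear Lagrangian\<close>

locale third_order_u = third_order AA D pd z xx 0 gu gl Gam
  for AA :: "'r::comm_ring_1 set" and D and pd :: "nat \<Rightarrow> 'n::finite \<Rightarrow> 'r \<Rightarrow> 'r" and z xx gu gl Gam
begin

text \<open>Minus the Jacobi sum modulo total derivatives, with x, y, w the raised covectors
  \<open>D \<circ> eul F\<close>, \<open>D \<circ> eul G\<close>, \<open>D \<circ> eul H\<close>;
  then \<open>D \<circ> Q w\<close> is the Hamiltonian flow of the third functional.\<close>

definition Tt :: "('n \<Rightarrow> 'r) \<Rightarrow> ('n \<Rightarrow> 'r) \<Rightarrow> ('n \<Rightarrow> 'r) \<Rightarrow> 'r" where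
  "Tt x y w = ip x (dQL (D \<circ> Q w) (flat y)) + ip y (dQL (D \<circ> Q x) (flat w)) + ip w (dQL (D \<circ> Q y) (flat x))"

lemma Tt_raw: assumes [simp]: "vct x" "vct y" "vct w"
  shows "nul (Tt x y w -
   (ip x (br (Q y) (D \<circ> Q w)) - ip y (br (Q x) (D \<circ> Q w)) + ip x (EE y (D \<circ> Q w))
  + (ip y (br (Q w) (D \<circ> Q x)) - ip w (br (Q y) (D \<circ> Q x)) + ip y (EE w (D \<circ> Q x)))
  + (ip w (br (Q x) (D \<circ> Q y)) - ip x (br (Q w) (D \<circ> Q y)) + ip w (EE x (D \<circ> Q y)))))"
proof -
  have "nul (D (ip y (br x (D \<circ> Q w))) + D (ip w (br y (D \<circ> Q x))) + D (ip x (br w (D \<circ> Q y))))"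
    by (intro nul_add nul_D) auto
  then show ?thesis unfolding Tt_def by (simp add: T1 algebra_simps)
qed

text \<open>For a skew bracket the two terms pairing x with \<open>D \<circ> Q w\<close> and
  \<open>D \<circ> Q y\<close> combine to a derivative of \<open>br (Q y) (Q w)\<close>. Integrating
  it by parts with \<open>Q_skew\<close> lowers the order and leaves the cubic expression
  \<open>CC\<close> and the defects \<open>BB\<close>.\<close>

lemma Tt_skew: assumes skew and [simp]: "vct x" "vct y" "vct w"
  shows "nul (Tt x y w -
   (ip x (EE y (D \<circ> Q w)) + ip y (EE w (D \<circ> Q x)) + ip w (EE x (D \<circ> Q y))
    - CC (Q x) (Q y) (Q w) - ip x (BB ux (Q y) (Q w)) - ip y (BB ux (Q w) (Q x)) - ip w (BB ux (Q x) (Q y))))"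
proof -
  have *: "D (ip x (br (Q y) (Q w))) = ip x (br (Q y) (D \<circ> Q w)) - ip x (br (Q w) (D \<circ> Q y))
      + ip (Q x) (br (Q y) (Q w)) + ip x (BB ux (Q y) (Q w))"
    if [simp]: "vct x" "vct y" "vct w" for x y w
  proof -
    define v where "v = br (Q y) (Q w)"
    have [simp]: "vct v" by (simp add: v_def)
    have "br (Q y) (D \<circ> Q w) - br (Q w) (D \<circ> Q y) = (D \<circ> v) - dbr ux (Q y) (Q w)"
      using br_skew[OF assms(1), of "Q w" "D \<circ> Q y"] by (simp add: v_def br_der[OF cder_D])
    also have "(D \<circ> v) = Q v + br v ux" by (simp add: Q_def)
    finally have "ip x (br (Q y) (D \<circ> Q w)) - ip x (br (Q w) (D \<circ> Q y))
      = ip x (Q v) + ip x (br v ux) - ip x (dbr ux (Q y) (Q w))"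
      by (metis ip_linear(3,4))
    also have "\<dots> = D (ip x v) - ip (Q x) v - ip x (BB ux (Q y) (Q w))"
      using Q_skew[of x v] by (simp add: BB_def linear_simps v_def algebra_simps)
    finally show ?thesis by (simp add: v_def)
  qed
  have "nul (D (ip x (br (Q y) (Q w))) + D (ip y (br (Q w) (Q x))) + D (ip w (br (Q x) (Q y))))"
    by (intro nul_add nul_D) auto
  from nul_add[OF Tt_raw[OF assms(2-4)] this] show ?thesis
    unfolding *[OF assms(2-4)] *[OF assms(3,4,2)] *[OF assms(4,2,3)] by (simp add: CC_def algebra_simps)
qed

lemma nul_Tt: assumes skew cyclic parallel "vct x" "vct y" "vct w" shows "nul (Tt x y w)"
  using Tt_skew[OF assms(1,4-6)] by (simp add: CC_zero[OF assms(2)] EE_def BB_zero[OF assms(3)] linear_simps)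

definition PP :: "('n \<Rightarrow> 'r) \<Rightarrow> 'n \<Rightarrow> 'r" where "PP a = D \<circ> QL (D \<circ> a)"

definition bk :: "'r \<Rightarrow> 'r \<Rightarrow> 'r" where "bk F G = dot (eul F) (PP (eul G))"

lemma vct_PP [simp]: "vct a \<Longrightarrow> vct (PP a)" by (simp add: PP_def)

lemma PP_skew: assumes [simp]: "vct a" "vct b" shows "nul (dot a (PP b) + dot b (PP a))"
proof -
  have 1: "nul (dot a (PP b) + dot (D \<circ> a) (QL (D \<circ> b)))" "nul (dot b (PP a) + dot (D \<circ> b) (QL (D \<circ> a)))"
    unfolding PP_def by (intro nul_dot_D; simp)+
  have 2: "nul (dot (D \<circ> a) (QL (D \<circ> b)) + dot (D \<circ> b) (QL (D \<circ> a)))"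
    by (subst QL_skew) auto
  show ?thesis using nul_diff[OF nul_add[OF 1] 2] by (simp add: algebra_simps)
qed

lemma bk_skew: "F \<in> AA \<Longrightarrow> G \<in> AA \<Longrightarrow> nul (bk F G + bk G F)"
  unfolding bk_def by (rule PP_skew) auto

text \<open>\<open>jacobi_reduce\<close> applied to \<open>PP\<close>, whose only variable
  coefficients sit in \<open>QL\<close>; the outer \<open>D\<close> is moved by parts onto the other
  covector, which accounts for the sign of \<open>Tt\<close>.\<close>

lemma bk_jacobi: assumes [simp]: "F \<in> AA" "G \<in> AA" "H \<in> AA"
  shows "nul (bk (bk F G) H + bk (bk G H) F + bk (bk H F) G
     + Tt (sharp (D \<circ> eul F)) (sharp (D \<circ> eul G)) (sharp (D \<circ> eul H)))"
proof -
  have *: "nul (dot a ((pr X \<circ> PP b) - PP (pr X \<circ> b)) + ip (sharp (D \<circ> a)) (dQL X (D \<circ> b)))"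
    if [simp]: "vct a" "vct b" "vct X" for a b X
  proof -
    have "(pr X \<circ> PP b) - PP (pr X \<circ> b) = D \<circ> dQL X (D \<circ> b)"
      by (simp add: PP_def pr_D_vec dQL_def)
    then show ?thesis using nul_dot_D[of a "dQL X (D \<circ> b)"] by (simp add: ip_sharp dQL_def)
  qed
  show ?thesis
    using nul_add[OF jacobi_reduce[where P=PP, folded bk_def, OF _ PP_skew assms]
        nul_add[OF nul_add[OF *[of "eul F" "eul G" "PP (eul H)"] *[of "eul G" "eul H" "PP (eul F)"]]
           *[of "eul H" "eul F" "PP (eul G)"]]]
    by (simp add: Tt_def PP_def QL_def algebra_simps)
qed

end


section \<open>Necessity of the structure conditions by extraction of top derivatives\<close>

context third_order_u
begin

definition vord :: "nat \<Rightarrow> ('n \<Rightarrow> 'r) \<Rightarrow> bool" where "vord n x \<longleftrightarrow> (\<forall>i. ordle n (x i))"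

lemma vord_vct [simp, dest]: "vord n x \<Longrightarrow> vct x" by (auto simp: vord_def vct_def)

lemma vord_mono: "vord n x \<Longrightarrow> n \<le> m \<Longrightarrow> vord m x"
  unfolding vord_def using ordle_mono by blast

lemma ordle_coef: "ordle n (gu i j)" "ordle n (gl i j)" "ordle n (Gam p i j)"
  "ordle n (pd 0 m (Gam p i j))"
  unfolding ordle_def using pd_coef pd_commute[of "Gam p i j" _ _ 0 m] by auto

lemma vord_sharp: "vord n a \<Longrightarrow> vord n (sharp a)"
  unfolding vord_def sharp_def by (auto intro!: ordle_sum ordle_mult ordle_coef)

lemma vord_br: "vord n x \<Longrightarrow> vord n y \<Longrightarrow> vord n (br x y)"
  unfolding vord_def br_def by (auto intro!: ordle_sum ordle_mult ordle_coef)

lemma vord_dbr: "vord n v \<Longrightarrow> vord n x \<Longrightarrow> vord n y \<Longrightarrow> vord n (dbr v x y)"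
  unfolding vord_def dbr_def by (auto intro!: ordle_sum ordle_mult ordle_coef)

lemma vord_arith: "vord n x \<Longrightarrow> vord n y \<Longrightarrow> vord n (x + y)" "vord n x \<Longrightarrow> vord n y \<Longrightarrow> vord n (x - y)"
  unfolding vord_def by (auto intro: ordle_add ordle_diff)

lemma vord_ux: "1 \<le> n \<Longrightarrow> vord n ux"
  unfolding vord_def by (auto intro: ordle_z)

lemma vord_ee: "vord n (ee i)"
  unfolding vord_def by (auto simp: ee_def)

lemma vord_BB: "vord n v \<Longrightarrow> vord n x \<Longrightarrow> vord n y \<Longrightarrow> vord n (BB v x y)"
  unfolding BB_def by (intro vord_arith vord_br vord_dbr)

lemma vord_EE: "1 \<le> n \<Longrightarrow> vord n x \<Longrightarrow> vord n y \<Longrightarrow> vord n (EE x y)"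
  unfolding EE_def by (intro vord_arith vord_BB vord_ux)

lemma vord_D: "vord n x \<Longrightarrow> vord (Suc n) (D \<circ> x)"
  unfolding vord_def by (auto intro: ordle_D)

lemma vord_Q: "vord n x \<Longrightarrow> vord (Suc n) (Q x)"
  unfolding Q_def by (intro vord_arith vord_br vord_D vord_ux) (auto intro: vord_mono)

lemma ordle_ip: "vord n x \<Longrightarrow> vord n y \<Longrightarrow> ordle n (ip x y)"
  unfolding vord_def ip_def by (auto intro!: ordle_sum ordle_mult ordle_coef)

lemma ordle_CC: "vord n x \<Longrightarrow> vord n y \<Longrightarrow> vord n w \<Longrightarrow> ordle n (CC x y w)"
  unfolding CC_def by (intro ordle_add ordle_ip vord_br)

lemmas vord_intros = vord_sharp vord_br vord_dbr vord_arith vord_ux vord_ee vord_BB vord_EE vord_D vord_Q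

lemma pd_vord: "vord n x \<Longrightarrow> n < m \<Longrightarrow> pd m q \<circ> x = 0"
  unfolding vord_def by (auto simp: fun_eq_iff intro: ordleD)

context
  fixes n :: nat and q :: 'n assumes n: "0 < n"
begin

lemma pd_br: "vct x \<Longrightarrow> vct y \<Longrightarrow> pd n q \<circ> br x y = br (pd n q \<circ> x) y + br x (pd n q \<circ> y)"
  using br_der[OF cder_pd, of n x y q] n by (simp add: linear_simps)

lemma pd_ip: "vct x \<Longrightarrow> vct y \<Longrightarrow> pd n q (ip x y) = ip (pd n q \<circ> x) y + ip x (pd n q \<circ> y)"
  using ip_der[OF cder_pd, of n x y q] n by (simp add: linear_simps)

lemma pd_sharp: "vct a \<Longrightarrow> pd n q \<circ> sharp a = sharp (pd n q \<circ> a)"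
  using n by (auto simp: fun_eq_iff sharp_def pd_coef)

lemma pd_dbr: "vct v \<Longrightarrow> vct x \<Longrightarrow> vct y \<Longrightarrow>
    pd n q \<circ> dbr v x y = dbr (pd n q \<circ> v) x y + dbr v (pd n q \<circ> x) y + dbr v x (pd n q \<circ> y)"
  using ordleD[OF ordle_coef(4)[of 0] n]
  by (auto simp: fun_eq_iff dbr_def algebra_simps sum.distrib)

lemma pd_BB: "vct v \<Longrightarrow> vct x \<Longrightarrow> vct y \<Longrightarrow>
    pd n q \<circ> BB v x y = BB (pd n q \<circ> v) x y + BB v (pd n q \<circ> x) y + BB v x (pd n q \<circ> y)"
  by (simp add: BB_def pd_br pd_dbr linear_simps)

lemma pd_ux: "n \<noteq> 1 \<Longrightarrow> pd n q \<circ> ux = 0"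
  by (auto simp: fun_eq_iff pd_z)

lemma pd_EE: "n \<noteq> 1 \<Longrightarrow> vct x \<Longrightarrow> vct y \<Longrightarrow> pd n q \<circ> EE x y = EE (pd n q \<circ> x) y + EE x (pd n q \<circ> y)"
proof -
  have *: "BB 0 a b = 0" "BB a b 0 = 0" for a b by (auto simp: BB_def linear_simps)
  assume "n \<noteq> 1" "vct x" "vct y"
  then show ?thesis by (simp add: EE_def pd_BB pd_ux * linear_simps)
qed

lemma pd_CC: "vct x \<Longrightarrow> vct y \<Longrightarrow> vct w \<Longrightarrow>
    pd n q (CC x y w) = CC (pd n q \<circ> x) y w + CC x (pd n q \<circ> y) w + CC x y (pd n q \<circ> w)"
  by (simp add: CC_def pd_ip pd_br linear_simps)

end

lemma pd_top_D_vec: "vord n x \<Longrightarrow> pd (Suc n) q \<circ> (D \<circ> x) = pd n q \<circ> x"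
  unfolding vord_def by (auto simp: fun_eq_iff pd_top_D)

lemma pd_top_Q: "vord n x \<Longrightarrow> 0 < n \<Longrightarrow> pd (Suc n) q \<circ> Q x = pd n q \<circ> x"
  by (simp add: Q_def pd_br pd_top_D_vec pd_vord pd_ux linear_simps)

lemma BB_0: "BB 0 x y = 0" "BB v 0 y = 0" "BB v x 0 = 0" "EE 0 x = 0" "EE x 0 = 0"
  by (auto simp: BB_def EE_def linear_simps)

lemma CC_0: "CC 0 x y = 0" "CC x 0 y = 0" "CC x y 0 = 0"
  by (auto simp: CC_def linear_simps)

text \<open>A trilinear Lagrangian that is null for all variational \<open>a = D (\<delta>F)\<close> has vanishing
  coefficient of \<open>a\<close> after integration by parts; here its topmost derivative is extracted.\<close>

lemma extract_top:
  assumes \<tau>: "vord (Suc (Suc k)) \<tau>" and \<rho>: "vord (Suc k) \<rho>" and \<sigma>: "vord k \<sigma>"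
    and nul: "\<And>F. F \<in> AA \<Longrightarrow> nul (dot (D \<circ> eul F) \<tau> + dot \<rho> (Q (sharp (D \<circ> eul F)))
       + dot \<sigma> (D \<circ> Q (sharp (D \<circ> eul F))))"
  shows "pd (Suc (Suc k)) q \<circ> \<tau> = sharp ((pd (Suc k) q \<circ> \<rho>) - (pd k q \<circ> \<sigma>))"
proof -
  \<comment> \<open>Integration by parts moves \<open>D\<close> onto \<open>\<sigma>\<close> and
    then, by \<open>Q_skew\<close>, moves \<open>Q\<close> onto \<open>sharp \<kappa>\<close>;
    \<open>t\<close> is the resulting coefficient of the test covector.\<close>
  define \<kappa> where "\<kappa> = \<rho> - (D \<circ> \<sigma>)"
  define t where "t = \<tau> - Q (sharp \<kappa>)"
  note [simp] = vord_vct[OF \<tau>] vord_vct[OF \<rho>] vord_vct[OF \<sigma>]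
  have [simp]: "vct \<kappa>" by (simp add: \<kappa>_def)
  have t [simp]: "vct t" by (simp add: t_def)
  have "nul (dot a t)" if nul: "nul (dot a \<tau> + dot \<rho> (Q (sharp a)) + dot \<sigma> (D \<circ> Q (sharp a)))"
    and [simp]: "vct a" for a
  proof -
    have "nul (dot \<sigma> (D \<circ> Q (sharp a)) + dot (D \<circ> \<sigma>) (Q (sharp a)))"
      by (rule nul_dot_D) auto
    moreover have "nul (D (ip (sharp a) (sharp \<kappa>)))" by (intro nul_D) simp
    ultimately have "nul (dot a \<tau> + dot \<rho> (Q (sharp a)) + dot \<sigma> (D \<circ> Q (sharp a))
       - (dot \<sigma> (D \<circ> Q (sharp a)) + dot (D \<circ> \<sigma>) (Q (sharp a))) - D (ip (sharp a) (sharp \<kappa>)))"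
      using nul by (intro nul_diff) auto
    then show ?thesis
      using Q_skew[of "sharp a" "sharp \<kappa>", symmetric]
      by (simp add: t_def \<kappa>_def linear_simps ip_sharp)
  qed
  then have "nul (dot (D \<circ> eul F) t)" if "F \<in> AA" for F
    using that nul by simp
  then have "nul (dot (eul F) (D \<circ> t))" if "F \<in> AA" for F
    using nul_diff[OF nul_dot_D[of "eul F" t], of "dot (D \<circ> eul F) t"] that by simp
  \<comment> \<open>Only covectors \<open>D \<circ> eul F\<close> are available as tests, so
    non-degeneracy yields \<open>D \<circ> t = 0\<close> rather than \<open>t = 0\<close>. Elements
    of the kernel of \<open>D\<close> have no jet derivatives, which is enough for the topmost
    one.\<close>
  then have "(D \<circ> t) j = 0" for j
    using euler_nondegenerate[of "D \<circ> t" j] vec_D[OF t] by (simp only: dot_def eul_def)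
  then have "pd m q (t j) = 0" for m j
    using D_eq_0_pd[of "t j"] by simp
  then have "pd (Suc (Suc k)) q \<circ> t = 0" by (auto simp: fun_eq_iff)
  moreover have \<kappa>: "vord (Suc k) \<kappa>" unfolding \<kappa>_def by (intro vord_intros \<rho> \<sigma>)
  ultimately have "pd (Suc (Suc k)) q \<circ> \<tau> = pd (Suc k) q \<circ> sharp \<kappa>"
    using pd_top_Q[of "Suc k" "sharp \<kappa>" q] vord_sharp by (simp add: t_def)
  also have "\<dots> = sharp ((pd (Suc k) q \<circ> \<rho>) - (pd k q \<circ> \<sigma>))"
    by (simp add: pd_sharp \<kappa>_def pd_top_D_vec[OF \<sigma>])
  finally show ?thesis .
qed

text \<open>The high-order test covector: its order 9 lies well above the orders 2, 3, 4 of the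
  other factor and of its first two images under \<open>Q\<close> and \<open>D \<circ> Q\<close>, so
  orders 9, 10, 11 can be attributed unambiguously.\<close>

lemma eul_square_4: "D \<circ> eul (z 4 q * z 4 q) = sm (2 * z 9 q) (ee q)"
proof
  fix p
  show "(D \<circ> eul (z 4 q * z 4 q)) p = sm (2 * z 9 q) (ee q) p"
    by (cases "p = q") (simp_all add: eul_def euler_square sm_def ee_def)
qed

lemma ordle_numeral: "ordle n (numeral k)" by (auto simp: ordle_def)

lemma pd_sharp_9: "pd 9 q (sharp (ee j) i) = 0"
  using fun_cong[OF pd_sharp[of 9 "ee j" q], of i] by (simp add: der_ee[OF der_pd] linear_simps)

text \<open>The factor \<open>xx\<close> is essential: the variational derivative of
  \<open>z 0 j\<close> alone is constant and \<open>D\<close> would kill it.\<close>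

lemma eul_linear_1: "D \<circ> eul (xx * z 0 j) = ee j"
  by (auto simp: fun_eq_iff eul_def euler_mult_const[of 0] ee_def)

lemma eul_linear_2: "D \<circ> eul (xx * xx * z 0 j) = sm (2 * xx) (ee j)"
  by (auto simp: fun_eq_iff eul_def euler_mult_const[of 0] ee_def sm_def)

lemma dot_rep: assumes "lin L" "\<And>i. c i = L (ee i)" shows "dot c w = L w"
proof -
  have "c = (\<lambda>i. L (ee i))" using assms(2) by auto
  then show ?thesis by (simp only: linD[OF assms(1), of w])
qed

context
  assumes J: "\<And>F G H. F \<in> AA \<Longrightarrow> G \<in> AA \<Longrightarrow> H \<in> AA \<Longrightarrow>
    nul (Tt (sharp (D \<circ> eul F)) (sharp (D \<circ> eul G)) (sharp (D \<circ> eul H)))"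
begin

text \<open>No symmetry of the bracket is known yet, so the unreduced form \<open>Tt_raw\<close> is
  used. The factor 2 in \<epsilon> comes from differentiating the square in the test
  density.\<close>

lemma extract_1:
  fixes q
  assumes G: "G \<in> AA" and b: "D \<circ> eul G = b" "vord 2 b"
  defines "\<epsilon> \<equiv> sm 2 (sharp (ee q))"
  shows "ip (sharp b) (br (ee i) \<epsilon>) + ip (sharp b) (br \<epsilon> (ee i)) = 0"
proof -
  define d where "d = sm (2 * z 9 q) (ee q)"
  define \<beta> \<delta> where "\<beta> = sharp b" and "\<delta> = sharp d"
  have d: "vord 9 d" unfolding d_def vord_def
    by (auto simp: sm_def ee_def intro!: ordle_mult ordle_numeral ordle_z)
  have \<beta>: "vord 2 \<beta>" and Y\<beta>: "vord 3 (Q \<beta>)" and X\<beta>: "vord 4 (D \<circ> Q \<beta>)"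
    using vord_sharp[OF b(2)] vord_Q[of 2 \<beta>] vord_D[of 3 "Q \<beta>"] by (auto simp: \<beta>_def numeral_eq_Suc)
  have \<delta>: "vord 9 \<delta>" and Y\<delta>: "vord 10 (Q \<delta>)" and X\<delta>: "vord 11 (D \<circ> Q \<delta>)"
    using vord_sharp[OF d] vord_Q[of 9 \<delta>] vord_D[of 10 "Q \<delta>"] by (auto simp: \<delta>_def)
  note v [simp] = vord_vct[OF \<beta>] vord_vct[OF \<delta>]
  have p9: "pd 9 q \<circ> \<delta> = \<epsilon>"
    unfolding \<delta>_def \<epsilon>_def d_def
    by (auto simp: sm_linear fun_eq_iff sm_def[THEN fun_cong] pd_z pd_sharp_9)
  have p10: "pd 10 q \<circ> Q \<delta> = \<epsilon>" using pd_top_Q[OF \<delta>, of q] p9 by simp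
  have p11: "pd 11 q \<circ> (D \<circ> Q \<delta>) = \<epsilon>" using pd_top_D_vec[OF Y\<delta>, of q] p10 by simp
  \<comment> \<open>The coefficients of \<open>x\<close>, \<open>Q x\<close> and
    \<open>D \<circ> Q x\<close> in the trilinear Lagrangian, as \<open>extract_top\<close> expects
    them.\<close>
  define \<tau> where "\<tau> = br (Q \<beta>) (D \<circ> Q \<delta>) - br (Q \<delta>) (D \<circ> Q \<beta>) + EE \<beta> (D \<circ> Q \<delta>)
     + sharp (\<lambda>i. ip \<delta> (EE (ee i) (D \<circ> Q \<beta>)))"
  define \<rho> where "\<rho> = (\<lambda>i. ip \<delta> (br (ee i) (D \<circ> Q \<beta>)) - ip \<beta> (br (ee i) (D \<circ> Q \<delta>)))"
  define \<sigma> where "\<sigma> = (\<lambda>i. ip \<beta> (br (Q \<delta>) (ee i)) - ip \<delta> (br (Q \<beta>) (ee i)) + ip \<beta> (EE \<delta> (ee i)))"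
  note vo = \<beta> Y\<beta> X\<beta> \<delta> Y\<delta> X\<delta>
  have up: "vord m \<beta>" "vord m (Q \<beta>)" "vord m (D \<circ> Q \<beta>)" if "4 \<le> m" for m
    using that \<beta> Y\<beta> X\<beta> by (auto intro: vord_mono)
  have ud: "9 \<le> m \<Longrightarrow> vord m \<delta>" "10 \<le> m \<Longrightarrow> vord m (Q \<delta>)" "11 \<le> m \<Longrightarrow> vord m (D \<circ> Q \<delta>)" for m
    using \<delta> Y\<delta> X\<delta> by (auto intro: vord_mono)
  have \<tau>o: "vord 11 \<tau>" unfolding \<tau>_def
    by (intro vord_intros up ud) (auto simp: vord_def intro!: ordle_ip vord_intros up ud)
  have \<rho>o: "vord 11 \<rho>" unfolding \<rho>_def vord_def
    by (auto intro!: ordle_diff ordle_ip vord_intros up ud)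
  have \<sigma>o: "vord 10 \<sigma>" unfolding \<sigma>_def vord_def
    by (auto intro!: ordle_add ordle_diff ordle_ip vord_intros up ud)
  have "pd 12 q \<circ> \<tau> = sharp ((pd 11 q \<circ> \<rho>) - (pd 10 q \<circ> \<sigma>))"
  proof -
    have "vord (Suc (Suc 10)) \<tau>" "vord (Suc 10) \<rho>" using \<tau>o \<rho>o by (auto intro: vord_mono)
    moreover have "nul (dot (D \<circ> eul F) \<tau> + dot \<rho> (Q (sharp (D \<circ> eul F)))
       + dot \<sigma> (D \<circ> Q (sharp (D \<circ> eul F))))" if F: "F \<in> AA" for F
    proof -
      define x where "x = sharp (D \<circ> eul F)"
      have x [simp]: "vct x" using F by (simp add: x_def)
      have "nul (Tt x \<beta> \<delta>)"
        using J[OF F G, of "z 4 q * z 4 q"] by (simp add: x_def \<beta>_def \<delta>_def b(1) d_def eul_square_4)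
      from nul_trans[OF this Tt_raw[of x \<beta> \<delta>]] have "nul (
         (ip x (br (Q \<beta>) (D \<circ> Q \<delta>)) - ip \<beta> (br (Q x) (D \<circ> Q \<delta>)) + ip x (EE \<beta> (D \<circ> Q \<delta>))
        + (ip \<beta> (br (Q \<delta>) (D \<circ> Q x)) - ip \<delta> (br (Q \<beta>) (D \<circ> Q x)) + ip \<beta> (EE \<delta> (D \<circ> Q x)))
        + (ip \<delta> (br (Q x) (D \<circ> Q \<beta>)) - ip x (br (Q \<delta>) (D \<circ> Q \<beta>)) + ip \<delta> (EE x (D \<circ> Q \<beta>)))))"
        by simp
      moreover have e1: "dot \<rho> (Q x) = ip \<delta> (br (Q x) (D \<circ> Q \<beta>)) - ip \<beta> (br (Q x) (D \<circ> Q \<delta>))"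
        by (rule dot_rep[where L="\<lambda>w. ip \<delta> (br w (D \<circ> Q \<beta>)) - ip \<beta> (br w (D \<circ> Q \<delta>))"])
         (intro lin_diff lin_comp[OF lin_ip(2)] lin_br, simp add: \<rho>_def)
      moreover have e2: "dot \<sigma> (D \<circ> Q x) = ip \<beta> (br (Q \<delta>) (D \<circ> Q x)) - ip \<delta> (br (Q \<beta>) (D \<circ> Q x)) + ip \<beta> (EE \<delta> (D \<circ> Q x))"
        by (rule dot_rep[where L="\<lambda>w. ip \<beta> (br (Q \<delta>) w) - ip \<delta> (br (Q \<beta>) w) + ip \<beta> (EE \<delta> w)"])
         (intro lin_add lin_diff lin_comp[OF lin_ip(2)] lin_br lin_EE, simp add: \<sigma>_def)
      moreover have e3: "dot (\<lambda>i. ip \<delta> (EE (ee i) (D \<circ> Q \<beta>))) x = ip \<delta> (EE x (D \<circ> Q \<beta>))"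
        by (rule dot_rep[where L="\<lambda>w. ip \<delta> (EE w (D \<circ> Q \<beta>))"])
         (intro lin_comp[OF lin_ip(2)] lin_EE, simp)
      moreover have e4: "dot (D \<circ> eul F) \<tau> = ip x (br (Q \<beta>) (D \<circ> Q \<delta>)) - ip x (br (Q \<delta>) (D \<circ> Q \<beta>)) + ip x (EE \<beta> (D \<circ> Q \<delta>))
          + ip \<delta> (EE x (D \<circ> Q \<beta>))"
      proof -
        have "dot (D \<circ> eul F) \<tau> = ip x \<tau>" by (simp add: x_def ip_sharp)
        also have "\<dots> = ip x (br (Q \<beta>) (D \<circ> Q \<delta>)) - ip x (br (Q \<delta>) (D \<circ> Q \<beta>)) + ip x (EE \<beta> (D \<circ> Q \<delta>))
          + ip \<delta> (EE x (D \<circ> Q \<beta>))"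
          by (simp only: \<tau>_def linear_simps ip_sharp e3)
        finally show ?thesis .
      qed
      ultimately show ?thesis unfolding x_def[symmetric] e1 e2 e4 by (simp add: algebra_simps)
    qed
    ultimately show ?thesis using extract_top[of 10 \<tau> \<rho> \<sigma> q] \<sigma>o by simp
  qed
  \<comment> \<open>Since \<tau> has order at most 11, comparison at order 12 relates the top parts
    of \<rho> and \<sigma> alone.\<close>
  then have "sharp ((pd 11 q \<circ> \<rho>) - (pd 10 q \<circ> \<sigma>)) = 0" using pd_vord[OF \<tau>o, of 12 q] by simp
  from arg_cong[OF this, of "\<lambda>v. flat v i"] have "pd 11 q (\<rho> i) = pd 10 q (\<sigma> i)"
    by (simp add: flat_def[of 0])
  also have "pd 11 q (\<rho> i) = - ip \<beta> (br (ee i) \<epsilon>)"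
    by (simp add: \<rho>_def pd_ip pd_br p11 pd_vord[OF \<delta>] pd_vord[OF \<beta>] der_ee[OF der_pd] pd_vord[OF X\<beta>] linear_simps)
  also have "pd 10 q (\<sigma> i) = ip \<beta> (br \<epsilon> (ee i))"
    by (simp add: \<sigma>_def pd_ip pd_br p10 pd_vord[OF \<delta>] pd_vord[OF \<beta>] der_ee[OF der_pd] pd_vord[OF Y\<beta>]
        pd_EE BB_0 linear_simps)
  finally have "ip \<beta> (br \<epsilon> (ee i)) = - ip \<beta> (br (ee i) \<epsilon>)" by (rule sym)
  then show ?thesis unfolding \<beta>_def[symmetric] by simp
qed

lemma J_imp_skew: "skew"
proof -
  have 1: "ip (sharp (ee j)) (br (ee i) (sharp (ee q))) + ip (sharp (ee j)) (br (sharp (ee q)) (ee i)) = 0" for i j q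
  proof -
    have "of_nat (Suc 1) * (ip (sharp (ee j)) (br (ee i) (sharp (ee q))) + ip (sharp (ee j)) (br (sharp (ee q)) (ee i))) = 0"
      using extract_1[of "xx * z 0 j" "ee j" i q] by (simp add: eul_linear_1 vord_ee sm_linear algebra_simps)
    then show ?thesis by (rule torsion_free[rotated]) simp
  qed
  have "ip (sharp (ee j)) (br (ee i) w) + ip (sharp (ee j)) (br w (ee i)) = 0" for i j w
    by (rule lin_sharp_zero[where L="\<lambda>w. ip (sharp (ee j)) (br (ee i) w) + ip (sharp (ee j)) (br w (ee i))"])
      (intro lin_add lin_comp[OF lin_ip(2)] lin_br 1)+
  then have "br (ee i) w j + br w (ee i) j = 0" for i j w
    by (simp add: ip_sharp dot_ee)
  then show ?thesis
    unfolding skew_def by (metis br_ee_ee eq_neg_iff_add_eq_0)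
qed

text \<open>With skew-symmetry available, \<open>Tt_skew\<close> lowers the orders of \<rho> and
  \<sigma> by one, so the comparison takes place at order 11, where \<tau> contributes through
  \<open>D \<circ> Q \<delta>\<close>.\<close>

lemma extract_2:
  fixes q
  assumes G: "G \<in> AA" and b: "D \<circ> eul G = b" "vord 2 b"
  defines "\<epsilon> \<equiv> sm 2 (sharp (ee q))"
  shows "ip (ee i) (EE (sharp b) \<epsilon>) + CC (ee i) (Q (sharp b)) \<epsilon> + ip (sharp b) (BB ux \<epsilon> (ee i))
     + ip (sharp b) (EE \<epsilon> (ee i)) = 0"
proof -
  define d where "d = sm (2 * z 9 q) (ee q)"
  define \<beta> \<delta> where "\<beta> = sharp b" and "\<delta> = sharp d"
  have d: "vord 9 d" unfolding d_def vord_def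
    by (auto simp: sm_def ee_def intro!: ordle_mult ordle_numeral ordle_z)
  have \<beta>: "vord 2 \<beta>" and Y\<beta>: "vord 3 (Q \<beta>)" and X\<beta>: "vord 4 (D \<circ> Q \<beta>)"
    using vord_sharp[OF b(2)] vord_Q[of 2 \<beta>] vord_D[of 3 "Q \<beta>"] by (auto simp: \<beta>_def numeral_eq_Suc)
  have \<delta>: "vord 9 \<delta>" and Y\<delta>: "vord 10 (Q \<delta>)" and X\<delta>: "vord 11 (D \<circ> Q \<delta>)"
    using vord_sharp[OF d] vord_Q[of 9 \<delta>] vord_D[of 10 "Q \<delta>"] by (auto simp: \<delta>_def)
  note v [simp] = vord_vct[OF \<beta>] vord_vct[OF \<delta>]
  have p9: "pd 9 q \<circ> \<delta> = \<epsilon>"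
    unfolding \<delta>_def \<epsilon>_def d_def
    by (auto simp: sm_linear fun_eq_iff sm_def[THEN fun_cong] pd_z pd_sharp_9)
  have p10: "pd 10 q \<circ> Q \<delta> = \<epsilon>" using pd_top_Q[OF \<delta>, of q] p9 by simp
  have p11: "pd 11 q \<circ> (D \<circ> Q \<delta>) = \<epsilon>" using pd_top_D_vec[OF Y\<delta>, of q] p10 by simp
  define \<tau> where "\<tau> = EE \<beta> (D \<circ> Q \<delta>) - BB ux (Q \<beta>) (Q \<delta>)
     + sharp (\<lambda>i. ip \<delta> (EE (ee i) (D \<circ> Q \<beta>)))"
  define \<rho> where "\<rho> = (\<lambda>i. - CC (ee i) (Q \<beta>) (Q \<delta>) - ip \<beta> (BB ux (Q \<delta>) (ee i)) - ip \<delta> (BB ux (ee i) (Q \<beta>)))"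
  define \<sigma> where "\<sigma> = (\<lambda>i. ip \<beta> (EE \<delta> (ee i)))"
  have up: "vord m \<beta>" "vord m (Q \<beta>)" "vord m (D \<circ> Q \<beta>)" if "4 \<le> m" for m
    using that \<beta> Y\<beta> X\<beta> by (auto intro: vord_mono)
  have ud: "9 \<le> m \<Longrightarrow> vord m \<delta>" "10 \<le> m \<Longrightarrow> vord m (Q \<delta>)" "11 \<le> m \<Longrightarrow> vord m (D \<circ> Q \<delta>)" for m
    using \<delta> Y\<delta> X\<delta> by (auto intro: vord_mono)
  have \<tau>o: "vord 11 \<tau>" unfolding \<tau>_def
    by (intro vord_intros up ud) (auto simp: vord_def intro!: ordle_ip vord_intros up ud)
  have \<rho>o: "vord 10 \<rho>" unfolding \<rho>_def vord_def
    by (auto intro!: ordle_diff ordle_uminus ordle_CC ordle_ip vord_intros up ud)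
  have \<sigma>o: "vord 9 \<sigma>" unfolding \<sigma>_def vord_def
    by (auto intro!: ordle_ip vord_intros up ud)
  have "pd 11 q \<circ> \<tau> = sharp ((pd 10 q \<circ> \<rho>) - (pd 9 q \<circ> \<sigma>))"
  proof -
    have "nul (dot (D \<circ> eul F) \<tau> + dot \<rho> (Q (sharp (D \<circ> eul F)))
       + dot \<sigma> (D \<circ> Q (sharp (D \<circ> eul F))))" if F: "F \<in> AA" for F
    proof -
      define x where "x = sharp (D \<circ> eul F)"
      have x [simp]: "vct x" using F by (simp add: x_def)
      have "nul (Tt x \<beta> \<delta>)"
        using J[OF F G, of "z 4 q * z 4 q"] by (simp add: x_def \<beta>_def \<delta>_def b(1) d_def eul_square_4)
      from nul_trans[OF this Tt_skew[OF J_imp_skew, of x \<beta> \<delta>]] have "nul (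
         ip x (EE \<beta> (D \<circ> Q \<delta>)) + ip \<beta> (EE \<delta> (D \<circ> Q x)) + ip \<delta> (EE x (D \<circ> Q \<beta>))
         - CC (Q x) (Q \<beta>) (Q \<delta>) - ip x (BB ux (Q \<beta>) (Q \<delta>)) - ip \<beta> (BB ux (Q \<delta>) (Q x)) - ip \<delta> (BB ux (Q x) (Q \<beta>)))"
        by simp
      moreover have e1: "dot \<rho> (Q x) = - CC (Q x) (Q \<beta>) (Q \<delta>) - ip \<beta> (BB ux (Q \<delta>) (Q x)) - ip \<delta> (BB ux (Q x) (Q \<beta>))"
        by (rule dot_rep[where L="\<lambda>w. - CC w (Q \<beta>) (Q \<delta>) - ip \<beta> (BB ux (Q \<delta>) w) - ip \<delta> (BB ux w (Q \<beta>))"])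
         (intro lin_diff lin_uminus lin_CC lin_comp[OF lin_ip(2)] lin_BB, simp add: \<rho>_def)
      moreover have e2: "dot \<sigma> (D \<circ> Q x) = ip \<beta> (EE \<delta> (D \<circ> Q x))"
        by (rule dot_rep[where L="\<lambda>w. ip \<beta> (EE \<delta> w)"])
         (intro lin_comp[OF lin_ip(2)] lin_EE, simp add: \<sigma>_def)
      moreover have e3: "dot (\<lambda>i. ip \<delta> (EE (ee i) (D \<circ> Q \<beta>))) x = ip \<delta> (EE x (D \<circ> Q \<beta>))"
        by (rule dot_rep[where L="\<lambda>w. ip \<delta> (EE w (D \<circ> Q \<beta>))"])
         (intro lin_comp[OF lin_ip(2)] lin_EE, simp)
      moreover have e4: "dot (D \<circ> eul F) \<tau> = ip x (EE \<beta> (D \<circ> Q \<delta>)) - ip x (BB ux (Q \<beta>) (Q \<delta>)) + ip \<delta> (EE x (D \<circ> Q \<beta>))"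
      proof -
        have "dot (D \<circ> eul F) \<tau> = ip x \<tau>" by (simp add: x_def ip_sharp)
        also have "\<dots> = ip x (EE \<beta> (D \<circ> Q \<delta>)) - ip x (BB ux (Q \<beta>) (Q \<delta>)) + ip \<delta> (EE x (D \<circ> Q \<beta>))"
          by (simp only: \<tau>_def linear_simps ip_sharp e3)
        finally show ?thesis .
      qed
      ultimately show ?thesis unfolding x_def[symmetric] e1 e2 e4 by (simp add: algebra_simps)
    qed
    then show ?thesis using extract_top[of 9 \<tau> \<rho> \<sigma> q] \<sigma>o \<rho>o \<tau>o by simp
  qed
  then have "flat (pd 11 q \<circ> \<tau>) i = pd 10 q (\<rho> i) - pd 9 q (\<sigma> i)" by simp
  also have "pd 11 q \<circ> \<tau> = EE \<beta> \<epsilon>"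
  proof -
    have "vord 9 (\<lambda>i. ip \<delta> (EE (ee i) (D \<circ> Q \<beta>)))"
      by (auto simp: vord_def intro!: ordle_ip vord_intros up ud)
    note this [simp] = vord_vct[OF this] pd_vord[OF this]
    show ?thesis unfolding \<tau>_def
      by (simp add: pd_EE pd_BB pd_sharp p11 pd_vord[OF \<beta>] pd_vord[OF Y\<beta>] pd_vord[OF Y\<delta>] pd_ux BB_0 sharp_linear)
  qed
  also have "pd 10 q (\<rho> i) = - CC (ee i) (Q \<beta>) \<epsilon> - ip \<beta> (BB ux \<epsilon> (ee i))"
    by (simp add: \<rho>_def pd_ip pd_BB pd_CC p10 pd_vord[OF \<delta>] pd_vord[OF \<beta>] der_ee[OF der_pd] pd_vord[OF Y\<beta>]
        pd_ux BB_0 CC_0 linear_simps)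
  also have "pd 9 q (\<sigma> i) = ip \<beta> (EE \<epsilon> (ee i))"
    by (simp add: \<sigma>_def pd_ip pd_EE p9 pd_vord[OF \<beta>] der_ee[OF der_pd] BB_0 linear_simps)
  finally have h: "flat (EE \<beta> \<epsilon>) i
    = - CC (ee i) (Q \<beta>) \<epsilon> - ip \<beta> (BB ux \<epsilon> (ee i)) - ip \<beta> (EE \<epsilon> (ee i))" .
  show ?thesis unfolding \<beta>_def[symmetric] ip_ee h by simp
qed

text \<open>\<open>extract_2\<close> is compared for the covectors \<open>ee j\<close> and
  \<open>2 * xx\<close> times \<open>ee j\<close>. All terms scale by \<open>2 * xx\<close> except
  the one with \<open>Q\<close>, which by Leibniz gains \<open>2\<close> times \<beta>; hence
  \<open>CC\<close> itself vanishes.\<close>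

lemma J_imp_cyclic: "cyclic"
proof -
  have 1: "CC (ee i) (sharp (ee j)) (sharp (ee q)) = 0" for i j q
  proof -
    define \<epsilon> \<beta> where "\<epsilon> = sm 2 (sharp (ee q))" and "\<beta> = sharp (ee j)"
    define \<beta>2 where "\<beta>2 = sm (2 * xx) \<beta>"
    have "vord 2 (sm (2 * xx) (ee j))"
      unfolding vord_def by (auto simp: sm_def ee_def intro!: ordle_mult ordle_numeral ordle_x)
    from extract_2[of "xx * xx * z 0 j" _ i q, OF _ eul_linear_2 this]
    have "ip (ee i) (EE \<beta>2 \<epsilon>) + CC (ee i) (Q \<beta>2) \<epsilon> + ip \<beta>2 (BB ux \<epsilon> (ee i)) + ip \<beta>2 (EE \<epsilon> (ee i)) = 0"
      by (simp add: \<epsilon>_def \<beta>2_def \<beta>_def linear_simps sm_linear)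
    moreover have "Q \<beta>2 = sm (2 * xx) (Q \<beta>) + sm 2 \<beta>"
      unfolding Q_def \<beta>2_def sm_linear by (auto simp: sm_def fun_eq_iff algebra_simps \<beta>_def)
    ultimately have 2: "of_nat 2 * xx * (ip (ee i) (EE \<beta> \<epsilon>) + CC (ee i) (Q \<beta>) \<epsilon> + ip \<beta> (BB ux \<epsilon> (ee i)) + ip \<beta> (EE \<epsilon> (ee i)))
        + of_nat 2 * CC (ee i) \<beta> \<epsilon> = 0"
      by (simp add: \<beta>2_def CC_def linear_simps sm_linear BB_linear algebra_simps)
    from extract_2[of "xx * z 0 j" _ i q, OF _ eul_linear_1 vord_ee]
    have "ip (ee i) (EE \<beta> \<epsilon>) + CC (ee i) (Q \<beta>) \<epsilon> + ip \<beta> (BB ux \<epsilon> (ee i)) + ip \<beta> (EE \<epsilon> (ee i)) = 0"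
      by (simp add: \<epsilon>_def \<beta>_def)
    \<comment> \<open>The factor 4 is the Leibniz factor 2 times the 2 contained in
      \<epsilon>.\<close>
    from 2[unfolded this] have "of_nat (Suc 3) * CC (ee i) \<beta> (sharp (ee q)) = 0"
      by (simp add: \<epsilon>_def CC_def sm_linear algebra_simps)
    then show ?thesis unfolding \<beta>_def by (rule torsion_free[rotated]) simp
  qed
  have "CC (ee i) (sharp (ee j)) w = 0" for i j w
    by (rule lin_sharp_zero[OF lin_CC(3) 1])
  then have "CC (ee i) v w = 0" for i v w
    using lin_sharp_zero[OF lin_CC(2)] by blast
  then show ?thesis by (simp add: cyclic_def)
qed

text \<open>With \<open>CC\<close> gone, \<open>extract_2\<close> is linear in \<open>ux\<close>;
  the jet derivative with respect to the component v of \<open>ux\<close> turns it into a relation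
  between the components of the defect.\<close>

lemma J_imp_bb: "bb i j k v - bb i j v k + 2 * bb j k i v - bb j k v i = 0"
proof -
  have 1: "ip (ee i) (EE (sharp (ee j)) (sharp (ee q))) + ip (sharp (ee j)) (BB ux (sharp (ee q)) (ee i))
     + ip (sharp (ee j)) (EE (sharp (ee q)) (ee i)) = 0" for i j q
  proof -
    have "of_nat (Suc 1) * (ip (ee i) (EE (sharp (ee j)) (sharp (ee q))) + ip (sharp (ee j)) (BB ux (sharp (ee q)) (ee i))
     + ip (sharp (ee j)) (EE (sharp (ee q)) (ee i))) = 0"
      using extract_2[of "xx * z 0 j" _ i q, OF _ eul_linear_1 vord_ee]
      by (simp add: CC_zero[OF J_imp_cyclic] BB_linear sm_linear algebra_simps)
    then show ?thesis by (rule torsion_free[rotated]) simp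
  qed
  have l: "lin (\<lambda>w. ip (ee i) (EE b w) + ip b (BB ux w (ee i)) + ip b (EE w (ee i)))"
    "lin (\<lambda>b. ip (ee i) (EE b w) + ip b (BB ux w (ee i)) + ip b (EE w (ee i)))" for i b w
    by (intro lin_add lin_ip(1) lin_comp[OF lin_ip(2)] lin_BB lin_EE)+
  have "ip (ee i) (EE (sharp (ee j)) w) + ip (sharp (ee j)) (BB ux w (ee i)) + ip (sharp (ee j)) (EE w (ee i)) = 0" for i j w
    by (rule lin_sharp_zero[OF l(1)]) (rule 1)
  from lin_sharp_zero[OF l(2) this] have 2: "ip (ee i) (EE b w) + ip b (BB ux w (ee i)) + ip b (EE w (ee i)) = 0" for i b w .
  have e: "pd 1 v \<circ> ux = ee v" by (auto simp: fun_eq_iff pd_z ee_def)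
  have "pd 1 v (ip (ee i) (EE (ee j) (ee k)) + ip (ee j) (BB ux (ee k) (ee i)) + ip (ee j) (EE (ee k) (ee i))) = 0"
    by (simp only: 2 pd_simps)
  moreover have "pd 1 v (ip (ee i) (BB ux (ee j) (ee k))) = bb i j k v"
    and "pd 1 v (ip (ee i) (BB (ee j) (ee k) ux)) = bb i k v j" for i j k
    by (simp_all only: pd_ip pd_BB zero_less_one vec_ops vec_BB vec_closed e der_ee[OF der_pd] BB_0 linear_simps
        add_0_left add_0_right bb_def)
  moreover have "ip (ee i) (BB ux (ee j) (ee k)) \<in> AA" "ip (ee i) (BB (ee j) (ee k) ux) \<in> AA" for i j k
    by simp_all
  ultimately have "bb i j k v - bb i j v k + bb j k i v + (bb j k i v - bb j k v i) = 0"
    unfolding EE_def ip_linear by (simp only: pd_simps add_in diff_in)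
  then show ?thesis unfolding mult_2 by (simp only: add_diff_eq add.assoc)
qed

text \<open>Skew-symmetry, \<open>bb_metric\<close> and \<open>J_imp_bb\<close> combine to
  \<open>3 a + b + c = 0\<close> for the three cyclic permutations of the last indices. Adding the
  three relations gives five times the sum, so the sum vanishes and \<open>2 a = 0\<close>
  follows.\<close>

lemma J_imp_parallel: "parallel"
proof -
  have sk: "bb i j k v = - bb i k j v" for i j k v
  proof -
    have "BB (ee v) (ee j) (ee k) p = - BB (ee v) (ee k) (ee j) p" for p
    proof -
      have g: "Gam p j k = - Gam p k j" for p using J_imp_skew[unfolded skew_def] by blast
      have "pd 0 v (Gam p j k) = - pd 0 v (Gam p k j)" by (subst g) simp
      moreover have "Gam r j k * Gam p r v = - (Gam r k j * Gam p r v)" for r by (subst g) simp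
      ultimately show ?thesis unfolding BB_ee by (simp add: sum_negf)
    qed
    then have "BB (ee v) (ee j) (ee k) = - BB (ee v) (ee k) (ee j)" by (auto simp: fun_eq_iff)
    then show ?thesis by (simp add: bb_def linear_simps)
  qed
  have "bb j i k v = 0" for j i k v
  proof -
    have r: "3 * bb j i k v + bb j v i k + bb j k v i = 0" for i k v
    proof -
      have "bb i j k v - bb i j v k = bb j i v k - bb j i k v"
        using bb_metric[of i j k v] by (simp add: algebra_simps)
      also have "bb j i v k = - bb j v i k" by (rule sk)
      finally have "(- bb j v i k - bb j i k v) + 2 * (- bb j i k v) - bb j k v i = 0"
        using J_imp_bb[of i j k v] by (simp only: sk[of j k i v])
      then have "- (3 * bb j i k v + bb j v i k + bb j k v i) = 0" by (simp add: algebra_simps)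
      then show ?thesis by (simp only: neg_equal_0_iff_equal)
    qed
    have "of_nat (Suc 4) * (bb j i k v + bb j v i k + bb j k v i) = 0"
    proof -
      have "(3 * bb j i k v + bb j v i k + bb j k v i) + (3 * bb j v i k + bb j k v i + bb j i k v)
        + (3 * bb j k v i + bb j i k v + bb j v i k) = 0"
        by (simp only: r add_0_left)
      then show ?thesis by (simp add: algebra_simps)
    qed
    then have "bb j i k v + bb j v i k + bb j k v i = 0" by (rule torsion_free[rotated]) simp
    moreover have "of_nat (Suc 1) * bb j i k v = (3 * bb j i k v + bb j v i k + bb j k v i)
        - (bb j i k v + bb j v i k + bb j k v i)" by (simp add: algebra_simps)
    ultimately have "of_nat (Suc 1) * bb j i k v = 0" by (simp only: r diff_0_right)
    then show ?thesis by (rule torsion_free[rotated]) simp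
  qed
  then have "BB (ee v) (ee i) (ee k) = 0" for v i k
    by (intro ip_nondegenerate) (simp add: bb_def linear_simps)
  then show ?thesis by (rule parallel_if_BB)
qed

end

end


section \<open>Consequences of a Hamiltonian in the potentials\<close>

locale third_order_b = third_order AA D pd z xx "Suc 0" gu gl Gam
  for AA :: "'r::comm_ring_1 set" and D and pd :: "nat \<Rightarrow> 'n::finite \<Rightarrow> 'r \<Rightarrow> 'r" and z xx gu gl Gam
begin

text \<open>That \<open>W\<close> depends on u alone restricts \<omega> strongly, since
  \<open>Q\<close> raises the order: \<omega> depends only on x, b and u, and its dependence on u is
  governed by the bracket. The b-derivatives \<open>w0\<close> remain, and the Helmholtz condition
  controls their skew part.\<close>

lemma velocity_relations:
  fixes h :: 'r
  defines "\<omega> \<equiv> sharp (- eul h)"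
  assumes str: skew cyclic parallel and h: "h \<in> AA"
    and W: "W = Q \<omega>" and W_ord: "\<And>m j i. m \<noteq> Suc 0 \<Longrightarrow> pd m j (W i) = 0"
  shows velocity_sym: "ip (ee i) (pd (Suc 0) l \<circ> W) = ip (ee l) (pd (Suc 0) i \<circ> W)"
    and velocity_deriv: "pd (Suc 0) r \<circ> (pd (Suc 0) l \<circ> W) = br (pd (Suc 0) r \<circ> W) (ee l) + br (pd (Suc 0) l \<circ> W) (ee r)"
    and velocity_cyclic: "ip (pd (Suc 0) j \<circ> W) (br (ee k) (ee i)) + ip (pd (Suc 0) i \<circ> W) (br (ee j) (ee k))
        + ip (pd (Suc 0) k \<circ> W) (br (ee i) (ee j)) = 0"
proof -
  have [simp]: "vct \<omega>" using h by (simp add: \<omega>_def)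
  have [simp]: "vct W" by (simp add: W)
  have par: "dbr v x y = br (br x y) v" for v x y
    using BB_zero[OF str(3), of v x y] by (simp add: BB_def)
  have W_ord': "pd m j \<circ> W = 0" if "m \<noteq> Suc 0" for m j using W_ord that by (auto simp: fun_eq_iff)
  have e: "pd 2 q \<circ> ux = ee q" "m \<noteq> 2 \<Longrightarrow> pd m q \<circ> ux = 0" for m q
    by (auto simp: fun_eq_iff pd_z ee_def numeral_2_eq_2)
  have "\<exists>N. \<forall>i. ordle N (\<omega> i)"
  proof -
    have "\<exists>N. ordle N (\<omega> i)" for i by (intro ordle_ex) simp
    then obtain N where N: "\<And>i. ordle (N i) (\<omega> i)" by metis
    have "ordle (Max (range N)) (\<omega> i)" for i using N ordle_mono by (metis Max_ge finite rangeI finite_imageI)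
    then show ?thesis by blast
  qed
  then obtain N where N: "\<And>i. ordle N (\<omega> i)" by blast
  \<comment> \<open>The top jet derivative of \<open>W\<close> equals that of \<omega> one index
    lower, so the order of \<omega> descends; the outer \<open>Suc\<close> lets the descent end at
    order 1, where the term with \<open>ux\<close> interferes.\<close>
  have "ordle (Suc (N - k)) (\<omega> i)" for k i
  proof (induction k arbitrary: i)
    case 0 then show ?case using N ordle_mono by (metis diff_zero le_add2 plus_1_eq_Suc)
  next
    case (Suc k)
    show ?case
    proof (cases "N - k")
      case 0 then show ?thesis using Suc.IH[of i] by simp
    next
      case (Suc n)
      have o: "ordle (Suc (Suc n)) (\<omega> i)" for i using Suc.IH[of i] Suc by simp
      have "pd (Suc (Suc n)) q \<circ> \<omega> = 0" for q
      proof -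
        have a: "pd (Suc (Suc (Suc n))) q \<circ> \<omega> = 0" using ordleD[OF o] by (auto simp: fun_eq_iff)
        have b: "pd (Suc (Suc (Suc n))) q \<circ> (D \<circ> \<omega>) = pd (Suc (Suc n)) q \<circ> \<omega>"
          using pd_top_D[OF o] by (auto simp: fun_eq_iff)
        have c: "pd (Suc (Suc (Suc n))) q \<circ> br \<omega> ux = 0"
          using br_der[OF cder_pd, of "Suc (Suc (Suc n))" \<omega> ux q] by (simp add: a e linear_simps)
        have "pd (Suc (Suc (Suc n))) q \<circ> W = 0" using W_ord' by simp
        moreover have "pd (Suc (Suc (Suc n))) q \<circ> W = pd (Suc (Suc n)) q \<circ> \<omega>" by (simp add: W Q_def b c)
        ultimately show ?thesis by metis
      qed
      then have "ordle (Suc n) (\<omega> i)" by (intro ordle_lower[OF o]) (metis comp_apply zero_fun_apply)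
      moreover have "Suc (N - Suc k) = Suc n" using Suc by simp
      ultimately show ?thesis by simp
    qed
  qed
  from this[of N] have o1: "ordle (Suc 0) (\<omega> i)" for i by simp
  have p2\<omega>: "pd 2 q \<circ> \<omega> = 0" for q using ordleD[OF o1] by (auto simp: fun_eq_iff)
  have p2D: "pd 2 q \<circ> (D \<circ> \<omega>) = pd (Suc 0) q \<circ> \<omega>" for q
    using pd_top_D[OF o1] by (auto simp: fun_eq_iff numeral_2_eq_2)
  \<comment> \<open>At index 2 the derivative of \<open>D \<circ> \<omega>\<close> must balance that
    of \<open>br \<omega> ux\<close>.\<close>
  have p1\<omega>: "pd (Suc 0) q \<circ> \<omega> = br \<omega> (ee q)" for q
  proof -
    have "pd 2 q \<circ> br \<omega> ux = br \<omega> (ee q)"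
      using br_der[OF cder_pd, of 2 \<omega> ux q] by (simp add: p2\<omega> e linear_simps)
    moreover have "pd 2 q \<circ> W = 0" using W_ord' by simp
    moreover have "pd 2 q \<circ> W = (pd (Suc 0) q \<circ> \<omega>) - (pd 2 q \<circ> br \<omega> ux)" by (simp add: W Q_def p2D)
    ultimately show ?thesis by (metis eq_iff_diff_eq_0)
  qed
  define w0 where "w0 l = pd 0 l \<circ> \<omega>" for l
  have [simp]: "vct (w0 l)" for l by (simp add: w0_def)
  have D\<omega>: "D \<circ> \<omega> = W + br \<omega> ux" by (simp add: W Q_def)
  have p1D: "pd (Suc 0) q \<circ> (D \<circ> x) = (D \<circ> (pd (Suc 0) q \<circ> x)) + (pd 0 q \<circ> x)" if "vct x" for x q
    using that by (auto simp: fun_eq_iff pd_Suc_D)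
  \<comment> \<open>The Jacobian of the velocity splits into a bracket part and the b-derivative of
    \<omega>; all three claims are read off from this splitting.\<close>
  have J: "pd (Suc 0) l \<circ> W = br W (ee l) + w0 l" for l
  proof -
    have 1: "pd (Suc 0) l \<circ> W = (D \<circ> br \<omega> (ee l)) + w0 l - (pd (Suc 0) l \<circ> br \<omega> ux)"
      by (simp only: W Q_def pd_vec_simps vec_D vec_ops vec_closed \<open>vct \<omega>\<close> p1D p1\<omega> w0_def)
    have 2: "pd (Suc 0) l \<circ> br \<omega> ux = br (br \<omega> (ee l)) ux + br (br \<omega> ux) (ee l)"
      using br_der[OF cder_pd_s, of \<omega> ux l] by (simp add: p1\<omega> e par linear_simps)
    have 3: "D \<circ> br \<omega> (ee l) = br (W + br \<omega> ux) (ee l) + br (br \<omega> (ee l)) ux"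
      by (simp add: br_der[OF cder_D] der_ee[OF der_D] D\<omega> par linear_simps)
    show ?thesis unfolding 1 2 3 by (simp add: linear_simps)
  qed
  have w0': "pd (Suc 0) r \<circ> w0 l = br (w0 l) (ee r)" for l r
  proof -
    have "pd (Suc 0) r \<circ> w0 l = pd 0 l \<circ> (pd (Suc 0) r \<circ> \<omega>)"
      by (auto simp: w0_def fun_eq_iff intro!: pd_commute)
    also have "\<dots> = br (w0 l) (ee r)"
      unfolding p1\<omega> using br_der[OF cder_pd, of 0 \<omega> "ee r" l] by (simp add: der_ee[OF der_pd] w0_def linear_simps)
    finally show ?thesis .
  qed
  show "pd (Suc 0) r \<circ> (pd (Suc 0) l \<circ> W) = br (pd (Suc 0) r \<circ> W) (ee l) + br (pd (Suc 0) l \<circ> W) (ee r)" for r l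
  proof -
    have 1: "pd (Suc 0) r \<circ> (pd (Suc 0) l \<circ> W) = (pd (Suc 0) r \<circ> br W (ee l)) + (pd (Suc 0) r \<circ> w0 l)"
      unfolding J[of l] by simp
    have 2: "pd (Suc 0) r \<circ> br W (ee l) = br (pd (Suc 0) r \<circ> W) (ee l) + br (br W (ee l)) (ee r)"
      using br_der[OF cder_pd_s, of W "ee l" r] by (simp add: der_ee[OF der_pd] par linear_simps)
    show ?thesis unfolding 1 2 w0' by (simp add: J[of l] linear_simps)
  qed
  have w: "- euler i h = ip (ee i) \<omega>" for i
    by (simp add: \<omega>_def ip_sharp dot_ee eul_def)
  have oe: "ordle (Suc 0) (euler i h)" for i
  proof -
    have "ordle (Suc 0) (gl i j)" for i j unfolding ordle_def using pd_coef(2) by auto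
    then have "ordle (Suc 0) (- ip (ee i) \<omega>)"
      unfolding ip_ee flat_def by (intro ordle_uminus ordle_sum ordle_mult o1)
    then show ?thesis by (simp add: w[symmetric])
  qed
  have p1w: "pd (Suc 0) j (euler i h) = ip \<omega> (br (ee i) (ee j))" for i j
  proof -
    have "pd (Suc 0) j (- euler i h) = - ip \<omega> (br (ee i) (ee j))"
      unfolding w by (simp only: ip_der[OF cder_pd_s] \<open>vct \<omega>\<close> vec_ops der_ee[OF der_pd] p1\<omega> linear_simps) simp
    then show ?thesis using h by simp
  qed
  have p0w: "pd 0 j (euler i h) = - ip (ee i) (w0 j)" for i j
  proof -
    have "pd 0 j (- euler i h) = ip (ee i) (w0 j)"
      unfolding w by (simp add: ip_der[OF cder_pd] der_ee[OF der_pd] w0_def linear_simps)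
    then show ?thesis using h by (metis euler_in minus_equation_iff pd_simps(6))
  qed
  have Dw: "D (ip \<omega> (br (ee i) (ee j))) = ip W (br (ee i) (ee j))" for i j
    by (simp add: ip_der[OF cder_D] br_der[OF cder_D] D\<omega> der_ee[OF der_D] par linear_simps
        ip_sym[of "br (ee i) (ee j)"])
  \<comment> \<open>The Helmholtz condition equates the skew part of the b-derivatives with the
    total derivative of \<open>ip \<omega> (br (ee i) (ee j))\<close>. There the metric rule and
    \<open>par\<close> cancel everything but \<open>W\<close>.\<close>
  have helm: "ip (ee j) (w0 i) - ip (ee i) (w0 j) = ip W (br (ee i) (ee j))" for i j
    using helmholtz_first_order(2)[OF h oe[folded One_nat_def], of j i] by (simp add: p0w p1w Dw)
  show "ip (ee i) (pd (Suc 0) l \<circ> W) = ip (ee l) (pd (Suc 0) i \<circ> W)" for i l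
  proof -
    have 1: "ip (ee i) (br W (ee l)) + ip (ee i) (br (ee l) W) = 0"
      using br_skew[OF str(1), of W "ee l"] by (simp add: linear_simps)
    have 2: "CC (ee i) (ee l) W = 0" by (rule CC_zero[OF str(2)])
    have "ip (ee i) (pd (Suc 0) l \<circ> W) - ip (ee l) (pd (Suc 0) i \<circ> W)
       = (ip (ee i) (br W (ee l)) + ip (ee i) (br (ee l) W)) - CC (ee i) (ee l) W
         + (ip W (br (ee i) (ee l)) - (ip (ee l) (w0 i) - ip (ee i) (w0 l)))"
      by (simp add: J linear_simps CC_def algebra_simps)
    then show ?thesis by (simp only: 1 2 helm) simp
  qed
  show "ip (pd (Suc 0) j \<circ> W) (br (ee k) (ee i)) + ip (pd (Suc 0) i \<circ> W) (br (ee j) (ee k))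
        + ip (pd (Suc 0) k \<circ> W) (br (ee i) (ee j)) = 0" for i j k
  proof -
    have d: "pd (Suc 0) k (ip x (br (ee i) (ee j))) = ip (pd (Suc 0) k \<circ> x) (br (ee i) (ee j)) - ip (br x (ee k)) (br (ee i) (ee j))"
      if "vct x" for x i j k
      using that by (simp add: ip_der[OF cder_pd_s] br_der[OF cder_pd_s] der_ee[OF der_pd] par linear_simps
        ip_sym[of "br (ee i) (ee j)"])
    have e1: "pd (Suc 0) k (ip W (br (ee i) (ee j))) = ip (w0 k) (br (ee i) (ee j))"
      using d[of W k i j] by (simp add: J linear_simps)
    have e2: "pd (Suc 0) k (ip (ee j) (w0 i)) = - ip (w0 i) (br (ee j) (ee k))" for i j
      using w0'[of k i] by (simp add: ip_der[OF cder_pd_s] der_ee[OF der_pd] linear_simps)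
    \<comment> \<open>The derivative of \<open>helm\<close> with respect to the component k of
      u.\<close>
    have c1: "ip (w0 k) (br (ee i) (ee j)) + ip (w0 i) (br (ee j) (ee k)) - ip (w0 j) (br (ee i) (ee k)) = 0"
    proof -
      have "pd (Suc 0) k (ip (ee j) (w0 i) - ip (ee i) (w0 j)) = pd (Suc 0) k (ip W (br (ee i) (ee j)))"
        by (simp only: helm)
      then have "- ip (w0 i) (br (ee j) (ee k)) + ip (w0 j) (br (ee i) (ee k)) = ip (w0 k) (br (ee i) (ee j))"
        by (simp only: e1 pd_simps ip_in vec_ops \<open>\<And>l. vct (w0 l)\<close> e2 diff_minus_eq_add)
      from this[symmetric] show ?thesis by simp
    qed
    \<comment> \<open>Differentiating the cyclic identity in u gives this for v a basis vector;
      linearity extends it to \<open>W\<close>.\<close>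
    have quad: "ip (br x v) (br y w) + ip (br y v) (br w x) + ip (br w v) (br x y) = 0"
      if [simp]: "vct v" and x: "x = ee i'" and y: "y = ee j'" and w: "w = ee k'" and v: "v = W" for v x y w i' j' k'
    proof -
      have "pd (Suc 0) q (CC x y w) = 0" for q using CC_zero[OF str(2)] by simp
      then have "- (ip (br x (ee q)) (br y w) + ip (br y (ee q)) (br w x) + ip (br w (ee q)) (br x y)) = 0" for q
        by (simp add: CC_def x y w d der_ee[OF der_pd] linear_simps)
      then have q: "ip (br x (ee q)) (br y w) + ip (br y (ee q)) (br w x) + ip (br w (ee q)) (br x y) = 0" for q
        by (simp only: neg_equal_0_iff_equal)
      show ?thesis
        by (rule lin_zero[where L="\<lambda>v. ip (br x v) (br y w) + ip (br y v) (br w x) + ip (br w v) (br x y)"])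
          (intro lin_add lin_comp[OF lin_ip(1)] lin_br q)+
    qed
    have sk: "br W (ee i) = - br (ee i) W" "br (ee i) (ee k) = - br (ee k) (ee i)" for i k
      by (rule br_skew[OF str(1)])+
    have "ip (pd (Suc 0) j \<circ> W) (br (ee k) (ee i)) + ip (pd (Suc 0) i \<circ> W) (br (ee j) (ee k))
        + ip (pd (Suc 0) k \<circ> W) (br (ee i) (ee j))
      = (ip (w0 k) (br (ee i) (ee j)) + ip (w0 i) (br (ee j) (ee k)) - ip (w0 j) (br (ee i) (ee k)))
        - (ip (br (ee i) W) (br (ee j) (ee k)) + ip (br (ee j) W) (br (ee k) (ee i)) + ip (br (ee k) W) (br (ee i) (ee j)))"
      unfolding J by (simp add: sk(1) sk(2)[of i k] linear_simps)
    then show ?thesis by (simp only: c1 quad[of W "ee i" i "ee j" j "ee k" k, OF \<open>vct W\<close> refl refl refl refl]) simp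
  qed
qed

end


section \<open>Differential functions on jet spaces\<close>

text \<open>The second difference over a small square is evaluated by the mean value theorem in both
  orders. Only separate partial derivatives near the origin and continuity of the mixed ones at the
  origin enter.\<close>

lemma mixed_derivatives_eq:
  fixes G G1 G2 G12 G21 :: "real \<Rightarrow> real \<Rightarrow> real"
  assumes r: "0 < r"
    and G1: "\<And>a b. \<bar>a\<bar> < r \<Longrightarrow> \<bar>b\<bar> < r \<Longrightarrow> ((\<lambda>a. G a b) has_real_derivative G1 a b) (at a)"
    and G2: "\<And>a b. \<bar>a\<bar> < r \<Longrightarrow> \<bar>b\<bar> < r \<Longrightarrow> ((\<lambda>b. G a b) has_real_derivative G2 a b) (at b)"
    and G12: "\<And>a b. \<bar>a\<bar> < r \<Longrightarrow> \<bar>b\<bar> < r \<Longrightarrow> ((\<lambda>b. G1 a b) has_real_derivative G12 a b) (at b)"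
    and G21: "\<And>a b. \<bar>a\<bar> < r \<Longrightarrow> \<bar>b\<bar> < r \<Longrightarrow> ((\<lambda>a. G2 a b) has_real_derivative G21 a b) (at a)"
    and c12: "isCont (\<lambda>(a, b). G12 a b) (0, 0)" and c21: "isCont (\<lambda>(a, b). G21 a b) (0, 0)"
  shows "G12 0 0 = G21 0 0"
proof -
  have "\<bar>G12 0 0 - G21 0 0\<bar> \<le> e" if e: "0 < e" for e
  proof -
    obtain d1 where d1: "0 < d1" "\<And>a b. dist (a, b) (0, 0) < d1 \<Longrightarrow> dist (G12 a b) (G12 0 0) < e / 2"
      using c12[unfolded continuous_at_eps_delta, rule_format, of "e / 2"] e by auto
    obtain d2 where d2: "0 < d2" "\<And>a b. dist (a, b) (0, 0) < d2 \<Longrightarrow> dist (G21 a b) (G21 0 0) < e / 2"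
      using c21[unfolded continuous_at_eps_delta, rule_format, of "e / 2"] e by auto
    \<comment> \<open>One third of the minimum, so that points of the square, at distance below
      \<open>2 * h\<close>, stay within both continuity radii.\<close>
    define h where "h = Min {r, d1, d2} / 3"
    have h: "0 < h" "h < r" "2 * h < d1" "2 * h < d2" using r d1(1) d2(1) by (auto simp: h_def min_def)
    have small: "dist (a, b) (0, 0 :: real) < d1 \<and> dist (a, b) (0, 0 :: real) < d2" if "0 < a" "a < h" "0 < b" "b < h" for a b
    proof -
      have "dist (a, b) (0, 0 :: real) \<le> \<bar>a\<bar> + \<bar>b\<bar>"
        using real_sqrt_sum_squares_triangle_ineq[of a 0 0 b] by (simp add: dist_Pair_Pair dist_real_def)
      then show ?thesis using that h by auto
    qed
    define \<Delta> where "\<Delta> = G h h - G h 0 - G 0 h + G 0 0"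
    have "\<exists>\<xi>>0. \<xi> < h \<and> (G h h - G h 0) - (G 0 h - G 0 0) = (h - 0) * (G1 \<xi> h - G1 \<xi> 0)"
      by (rule MVT2[of 0 h "\<lambda>a. G a h - G a 0" "\<lambda>a. G1 a h - G1 a 0"])
        (use h in \<open>auto intro!: derivative_eq_intros G1\<close>)
    then obtain \<xi> where \<xi>: "0 < \<xi>" "\<xi> < h" "\<Delta> = h * (G1 \<xi> h - G1 \<xi> 0)" by (auto simp: \<Delta>_def algebra_simps)
    have "\<exists>\<eta>>0. \<eta> < h \<and> G1 \<xi> h - G1 \<xi> 0 = (h - 0) * G12 \<xi> \<eta>"
      by (rule MVT2[of 0 h "\<lambda>b. G1 \<xi> b" "\<lambda>b. G12 \<xi> b"]) (use h \<xi> in \<open>auto intro!: G12\<close>)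
    then obtain \<eta> where \<eta>: "0 < \<eta>" "\<eta> < h" "\<Delta> = h * (h * G12 \<xi> \<eta>)" using \<xi> by auto
    have "\<exists>\<xi>>0. \<xi> < h \<and> (G h h - G 0 h) - (G h 0 - G 0 0) = (h - 0) * (G2 h \<xi> - G2 0 \<xi>)"
      by (rule MVT2[of 0 h "\<lambda>b. G h b - G 0 b" "\<lambda>b. G2 h b - G2 0 b"])
        (use h in \<open>auto intro!: derivative_eq_intros G2\<close>)
    then obtain \<xi>' where \<xi>': "0 < \<xi>'" "\<xi>' < h" "\<Delta> = h * (G2 h \<xi>' - G2 0 \<xi>')" by (auto simp: \<Delta>_def algebra_simps)
    have "\<exists>\<eta>>0. \<eta> < h \<and> G2 h \<xi>' - G2 0 \<xi>' = (h - 0) * G21 \<eta> \<xi>'"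
      by (rule MVT2[of 0 h "\<lambda>a. G2 a \<xi>'" "\<lambda>a. G21 a \<xi>'"]) (use h \<xi>' in \<open>auto intro!: G21\<close>)
    then obtain \<eta>' where \<eta>': "0 < \<eta>'" "\<eta>' < h" "\<Delta> = h * (h * G21 \<eta>' \<xi>')" using \<xi>' by auto
    have "G12 \<xi> \<eta> = G21 \<eta>' \<xi>'" using \<eta>(3) \<eta>'(3) h by simp
    moreover have "\<bar>G12 \<xi> \<eta> - G12 0 0\<bar> < e / 2" using d1(2) small \<xi> \<eta> by (auto simp: dist_real_def)
    moreover have "\<bar>G21 \<eta>' \<xi>' - G21 0 0\<bar> < e / 2" using d2(2) small \<xi>' \<eta>' by (auto simp: dist_real_def)
    ultimately show ?thesis by linarith
  qed
  then show ?thesis using field_le_epsilon[of "\<bar>G12 0 0 - G21 0 0\<bar>" 0] by auto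
qed

section \<open>Directional derivatives and smoothness on jets\<close>

datatype 'n dir = DX | DZ nat 'n

text \<open>Treating x as one more direction gives x-derivatives and jet derivatives a single proof
  each, including the symmetry of second derivatives.\<close>

primrec sh :: "'n::finite dir \<Rightarrow> real \<Rightarrow> 'n jet \<Rightarrow> 'n jet" where
  "sh DX t p = (fst p + t, snd p)"
| "sh (DZ m i) t p = (fst p, (snd p)(m := snd p m + t *\<^sub>R axis i 1))"

definition jd :: "'n::finite dir \<Rightarrow> ('n jet \<Rightarrow> real) \<Rightarrow> 'n jet \<Rightarrow> real" where
  "jd d f p = deriv (\<lambda>t. f (sh d t p)) 0"

lemma sh_0 [simp]: "sh d 0 p = p" by (cases d) auto

lemma sh_add: "sh d (a + b) p = sh d a (sh d b p)"
  by (cases d) (auto simp: algebra_simps)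

lemma sh_commute: "sh d a (sh e b p) = sh e b (sh d a p)"
  by (cases d; cases e) (auto simp: algebra_simps fun_upd_def fun_eq_iff)

lemma deriv_shift0: "deriv f x = deriv (\<lambda>t. f (x + t)) (0::real)"
  unfolding deriv_def using DERIV_shift[of f _ 0 x] by (simp add: add.commute)

lemma jet_dx_jd: "jet_dx f = jd DX f"
  unfolding jet_dx_def jd_def fun_eq_iff by (auto intro: deriv_shift0)

lemma jet_dz_jd: "jet_dz m i f = jd (DZ m i) f"
  unfolding jet_dz_def jd_def fun_eq_iff by auto

lemma continuous_on_sh2: "continuous_on UNIV (\<lambda>(a, b). sh d a (sh e b p))"
proof -
  have *: "continuous_on UNIV (\<lambda>q :: real \<times> real. sh d (fst q) (sh e (snd q) p))"
  proof -
    have *: "continuous_on UNIV (\<lambda>q :: real \<times> real. if P then f q else g q)"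
      if "continuous_on UNIV f" "continuous_on UNIV g" for P and f g :: "real \<times> real \<Rightarrow> real^'n"
      using that by (cases P) simp_all
    show ?thesis
      by (cases d; cases e) (auto intro!: continuous_on_Pair continuous_on_coordinatewise_then_product *
        continuous_on_add continuous_on_scaleR continuous_on_fst continuous_on_snd continuous_on_id
        continuous_on_const simp: fun_upd_def)
  qed
  then show ?thesis by (simp add: case_prod_unfold)
qed

lemma continuous_on_sh: "continuous_on UNIV (\<lambda>t. sh d t p)"
proof -
  have "continuous_on UNIV ((\<lambda>(a, b). sh d a (sh DX b p)) \<circ> (\<lambda>t. (t, 0)))"
    by (intro continuous_on_compose continuous_on_Pair continuous_on_id continuous_on_const
        continuous_on_subset[OF continuous_on_sh2]) simp
  then show ?thesis by (simp add: o_def)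
qed

locale jets =
  fixes s :: nat and U :: "(real^'n::finite) set" and u0 :: "real^'n"
  assumes open_U: "open U" and u0: "u0 \<in> U"
begin

abbreviation \<Omega> :: "'n jet set" where "\<Omega> \<equiv> jets_over s U"

lemma continuous_on_coord: "continuous_on S (\<lambda>p :: 'n jet. snd p m)"
proof -
  have "continuous_on UNIV (\<lambda>z :: nat \<Rightarrow> real^'n. z m)" by (rule continuous_on_product_coordinates)
  then have "continuous_on S ((\<lambda>z :: nat \<Rightarrow> real^'n. z m) \<circ> snd)"
    by (intro continuous_on_compose continuous_on_snd continuous_on_id) (rule continuous_on_subset, auto)
  then show ?thesis by (simp add: o_def)
qed

lemma \<Omega>_iff: "p \<in> \<Omega> \<longleftrightarrow> snd p s \<in> U" by (auto simp: jets_over_def case_prod_unfold)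

lemma open_\<Omega>: "open \<Omega>"
proof -
  have "\<Omega> = (\<lambda>p. snd p s) -` U" using \<Omega>_iff by auto
  then show ?thesis using continuous_on_coord[of UNIV s] open_U open_vimage by metis
qed

lemma eventually_sh: assumes "p \<in> \<Omega>" shows "eventually (\<lambda>t. sh d t p \<in> \<Omega>) (nhds 0)"
proof -
  have "open ((\<lambda>t. sh d t p) -` \<Omega>)" using continuous_on_sh open_\<Omega> open_vimage by metis
  then show ?thesis using assms by (auto simp: eventually_nhds intro!: exI[of _ "(\<lambda>t. sh d t p) -` \<Omega>"])
qed

definition dble :: "'n dir \<Rightarrow> ('n jet \<Rightarrow> real) \<Rightarrow> bool" where
  "dble d f \<longleftrightarrow> (\<forall>p\<in>\<Omega>. (\<lambda>t. f (sh d t p)) field_differentiable (at 0))"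

lemma dbleD: "dble d f \<Longrightarrow> p \<in> \<Omega> \<Longrightarrow> ((\<lambda>t. f (sh d t p)) has_real_derivative jd d f p) (at 0)"
  by (simp add: dble_def jd_def field_differentiable_derivI)

lemma jd_unique: "((\<lambda>t. f (sh d t p)) has_real_derivative c) (at 0) \<Longrightarrow> jd d f p = c"
  by (simp add: jd_def DERIV_imp_deriv)

lemma dbleI: "(\<And>p. p \<in> \<Omega> \<Longrightarrow> ((\<lambda>t. f (sh d t p)) has_real_derivative c p) (at 0)) \<Longrightarrow> dble d f"
  unfolding dble_def field_differentiable_def by blast

lemma jd_cong: assumes "\<And>p. p \<in> \<Omega> \<Longrightarrow> f p = g p" "p \<in> \<Omega>" shows "jd d f p = jd d g p"
  unfolding jd_def by (rule deriv_cong_ev) (rule eventually_mono[OF eventually_sh[OF assms(2), of d]], simp_all add: assms(1))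

lemma dble_cong: assumes "\<And>p. p \<in> \<Omega> \<Longrightarrow> f p = g p" "dble d f" shows "dble d g"
proof (rule dbleI)
  fix p assume p: "p \<in> \<Omega>"
  have "eventually (\<lambda>t. f (sh d t p) = g (sh d t p)) (nhds 0)"
    by (rule eventually_mono[OF eventually_sh[OF p, of d]]) (simp add: assms(1))
  from iffD1[OF DERIV_cong_ev[OF refl this refl] dbleD[OF assms(2) p]]
  show "((\<lambda>t. g (sh d t p)) has_real_derivative jd d f p) (at 0)" .
qed

lemma jet_Ck_Suc: "jet_Ck (Suc k) \<Omega> f \<longleftrightarrow> continuous_on \<Omega> f \<and> (\<forall>d. dble d f \<and> jet_Ck k \<Omega> (jd d f))"
proof -
  have 1: "(\<lambda>t. f (t, z)) field_differentiable (at x) \<longleftrightarrow> (\<lambda>t. f (sh DX t (x, z))) field_differentiable (at 0)" for x z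
    unfolding field_differentiable_def using DERIV_shift[of "\<lambda>t. f (t, z)" _ 0 x] by (simp add: add.commute)
  have all: "(\<forall>d. P d) \<longleftrightarrow> P DX \<and> (\<forall>m i. P (DZ m i))" for P :: "'n dir \<Rightarrow> bool"
    by (metis dir.exhaust)
  show ?thesis
    unfolding all jet_Ck.simps jet_dx_jd jet_dz_jd dble_def
    by (simp only: case_prod_unfold prod.collapse 1 sh.simps fst_conv snd_conv Ball_def split_paired_All) blast
qed

declare jet_Ck.simps(2) [simp del]

lemma jet_Ck_cong: "(\<And>p. p \<in> \<Omega> \<Longrightarrow> f p = g p) \<Longrightarrow> jet_Ck k \<Omega> f \<Longrightarrow> jet_Ck k \<Omega> g"
proof (induction k arbitrary: f g)
  case 0 then show ?case using continuous_on_cong by (metis jet_Ck.simps(1))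
next
  case (Suc k)
  show ?case unfolding jet_Ck_Suc
  proof (intro conjI allI)
    show "continuous_on \<Omega> g" using Suc.prems continuous_on_cong unfolding jet_Ck_Suc by metis
    fix d
    show "dble d g" using Suc.prems dble_cong unfolding jet_Ck_Suc by blast
    have "jet_Ck k \<Omega> (jd d f)" using Suc.prems unfolding jet_Ck_Suc by blast
    then show "jet_Ck k \<Omega> (jd d g)" using Suc.IH[of "jd d f" "jd d g"] jd_cong Suc.prems(1) by blast
  qed
qed

lemma jet_Ck_dec: "jet_Ck (Suc k) \<Omega> f \<Longrightarrow> jet_Ck k \<Omega> f"
proof (induction k arbitrary: f)
  case 0 then show ?case by (simp add: jet_Ck_Suc)
next
  case (Suc k) then show ?case by (subst jet_Ck_Suc) (auto simp: jet_Ck_Suc[of "Suc k"])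
qed

lemma jet_Ck_const: "jet_Ck k \<Omega> (\<lambda>p. c)"
proof (induction k arbitrary: c)
  case (Suc k)
  have 0: "jd d (\<lambda>p. c) = (\<lambda>p. 0)" for d by (auto intro!: jd_unique)
  have 1: "dble d (\<lambda>p. c)" for d by (rule dbleI[of _ _ "\<lambda>p. 0"]) simp
  have 2: "jet_Ck k \<Omega> (jd d (\<lambda>p. c))" for d unfolding 0 by (rule Suc)
  show ?case unfolding jet_Ck_Suc by (intro conjI allI continuous_on_const 1 2)
qed simp

lemma jd_add: "dble d f \<Longrightarrow> dble d g \<Longrightarrow> p \<in> \<Omega> \<Longrightarrow> jd d (\<lambda>p. f p + g p) p = jd d f p + jd d g p"
  by (intro jd_unique DERIV_add dbleD)

lemma dble_add: "dble d f \<Longrightarrow> dble d g \<Longrightarrow> dble d (\<lambda>p. f p + g p)"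
  by (rule dbleI[of _ _ "\<lambda>p. jd d f p + jd d g p"]) (intro DERIV_add dbleD)

lemma der_mult_0:
  "dble d f \<Longrightarrow> dble d g \<Longrightarrow> p \<in> \<Omega> \<Longrightarrow>
    ((\<lambda>t. f (sh d t p) * g (sh d t p)) has_real_derivative jd d f p * g p + f p * jd d g p) (at 0)"
  using DERIV_mult[OF dbleD dbleD, of d f p d g] by (simp add: algebra_simps)

lemma jd_mult: "dble d f \<Longrightarrow> dble d g \<Longrightarrow> p \<in> \<Omega> \<Longrightarrow> jd d (\<lambda>p. f p * g p) p = jd d f p * g p + f p * jd d g p"
  by (intro jd_unique der_mult_0)

lemma dble_mult: "dble d f \<Longrightarrow> dble d g \<Longrightarrow> dble d (\<lambda>p. f p * g p)"
  by (rule dbleI, rule der_mult_0)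

lemma jet_Ck_cont: "jet_Ck k \<Omega> f \<Longrightarrow> continuous_on \<Omega> f"
  by (cases k) (auto simp: jet_Ck_Suc)

lemma jet_Ck_add: "jet_Ck k \<Omega> f \<Longrightarrow> jet_Ck k \<Omega> g \<Longrightarrow> jet_Ck k \<Omega> (\<lambda>p. f p + g p)"
proof (induction k arbitrary: f g)
  case (Suc k)
  have "jet_Ck k \<Omega> (jd d (\<lambda>p. f p + g p))" for d
    by (rule jet_Ck_cong[of "\<lambda>p. jd d f p + jd d g p"]) (use Suc jd_add in \<open>auto simp: jet_Ck_Suc\<close>)
  then show ?case using Suc.prems by (auto simp: jet_Ck_Suc intro: continuous_on_add dble_add)
qed (auto intro: continuous_on_add)

lemma jet_Ck_mult: "jet_Ck k \<Omega> f \<Longrightarrow> jet_Ck k \<Omega> g \<Longrightarrow> jet_Ck k \<Omega> (\<lambda>p. f p * g p)"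
proof (induction k arbitrary: f g)
  case (Suc k)
  have fg: "jet_Ck k \<Omega> f" "jet_Ck k \<Omega> g" using Suc.prems jet_Ck_dec by auto
  have "jet_Ck k \<Omega> (jd d (\<lambda>p. f p * g p))" for d
    by (rule jet_Ck_cong[of "\<lambda>p. jd d f p * g p + f p * jd d g p"])
      (use Suc fg jd_mult in \<open>auto simp: jet_Ck_Suc intro!: jet_Ck_add\<close>)
  then show ?case using Suc.prems by (auto simp: jet_Ck_Suc intro: continuous_on_mult dble_mult)
qed (auto intro: continuous_on_mult)

definition smooth :: "('n jet \<Rightarrow> real) \<Rightarrow> bool" where "smooth f \<longleftrightarrow> (\<forall>k. jet_Ck k \<Omega> f)"

lemma smooth_dble: "smooth f \<Longrightarrow> dble d f" and smooth_jd: "smooth f \<Longrightarrow> smooth (jd d f)"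
  and smooth_cont: "smooth f \<Longrightarrow> continuous_on \<Omega> f"
  unfolding smooth_def using jet_Ck_Suc jet_Ck_cont by blast+

text \<open>Restriction to the two-parameter family of shifts reduces the claim to
  \<open>mixed_derivatives_eq\<close>; no total differentiability on the infinite-dimensional jet
  space is involved.\<close>

lemma jd_commute: assumes f: "smooth f" and p: "p \<in> \<Omega>"
  shows "jd d (jd e f) p = jd e (jd d f) p"
proof -
  have "open ((\<lambda>(a, b). sh d a (sh e b p)) -` \<Omega>)" using continuous_on_sh2 open_\<Omega> open_vimage by metis
  moreover have "(0, 0) \<in> (\<lambda>(a, b). sh d a (sh e b p)) -` \<Omega>" using p by simp
  ultimately obtain r where r: "0 < r" "ball (0, 0) r \<subseteq> (\<lambda>(a, b). sh d a (sh e b p)) -` \<Omega>"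
    using open_contains_ball by metis
  have in\<Omega>: "sh d a (sh e b p) \<in> \<Omega>" if "\<bar>a\<bar> < r / 2" "\<bar>b\<bar> < r / 2" for a b
  proof -
    have "dist (0, 0) (a, b) \<le> \<bar>a\<bar> + \<bar>b\<bar>"
      using real_sqrt_sum_squares_triangle_ineq[of a 0 0 b] by (simp add: dist_Pair_Pair dist_real_def)
    then have "(a, b) \<in> ball (0, 0) r" using that by simp
    then show ?thesis using r by auto
  qed
  have der: "((\<lambda>a. g (sh d a q)) has_real_derivative jd d g (sh d a q)) (at a)"
    if "smooth g" "sh d a q \<in> \<Omega>" for g d a q
  proof -
    have "((\<lambda>t. g (sh d t (sh d a q))) has_real_derivative jd d g (sh d a q)) (at 0)"
      using dbleD smooth_dble that by blast
    then show ?thesis using DERIV_shift[of "\<lambda>a. g (sh d a q)" _ 0 a] by (simp add: sh_add)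
  qed
  have cont: "isCont (\<lambda>(a, b). g (sh d a (sh e b p))) (0, 0)" if "smooth g" for g
  proof -
    have "isCont g p" using smooth_cont[OF that] open_\<Omega> p continuous_on_eq_continuous_at by blast
    moreover have "isCont (\<lambda>(a, b). sh d a (sh e b p)) (0, 0)"
      using continuous_on_sh2 continuous_on_eq_continuous_at open_UNIV by blast
    ultimately have "isCont (g \<circ> (\<lambda>(a, b). sh d a (sh e b p))) (0, 0)"
      by (intro continuous_at_compose) auto
    then show ?thesis by (simp add: o_def case_prod_unfold)
  qed
  have "jd e (jd d f) (sh d 0 (sh e 0 p)) = jd d (jd e f) (sh d 0 (sh e 0 p))"
  proof (rule mixed_derivatives_eq[of "r / 2" "\<lambda>a b. f (sh d a (sh e b p))" "\<lambda>a b. jd d f (sh d a (sh e b p))"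
        "\<lambda>a b. jd e f (sh d a (sh e b p))" "\<lambda>a b. jd e (jd d f) (sh d a (sh e b p))" "\<lambda>a b. jd d (jd e f) (sh d a (sh e b p))"])
    fix a b :: real assume ab: "\<bar>a\<bar> < r / 2" "\<bar>b\<bar> < r / 2"
    show "((\<lambda>b. f (sh d a (sh e b p))) has_real_derivative jd e f (sh d a (sh e b p))) (at b)"
      using der[OF f, of e b "sh d a p"] in\<Omega>[OF ab] by (simp add: sh_commute[of d a])
    show "((\<lambda>b. jd d f (sh d a (sh e b p))) has_real_derivative jd e (jd d f) (sh d a (sh e b p))) (at b)"
      using der[OF smooth_jd[OF f], of e b "sh d a p"] in\<Omega>[OF ab] by (simp add: sh_commute[of d a])
  qed (use r f in \<open>auto intro!: der in\<Omega> cont smooth_jd\<close>)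
  then show ?thesis by simp
qed

definition dep :: "nat \<Rightarrow> ('n jet \<Rightarrow> real) \<Rightarrow> bool" where
  "dep N f \<longleftrightarrow> (\<forall>x z z'. (x, z) \<in> \<Omega> \<and> (x, z') \<in> \<Omega> \<and> (\<forall>m\<le>N. z m = z' m) \<longrightarrow> f (x, z) = f (x, z'))"

lemma diff_fun_iff: "diff_fun s U f \<longleftrightarrow> (\<exists>N. dep N f) \<and> smooth f"
  by (simp add: diff_fun_def dep_def smooth_def)

lemma dep_mono: "dep N f \<Longrightarrow> N \<le> M \<Longrightarrow> dep M f"
  unfolding dep_def by (meson le_trans)

lemma dep_cong: "(\<And>p. p \<in> \<Omega> \<Longrightarrow> f p = g p) \<Longrightarrow> dep N f \<Longrightarrow> dep N g"
  unfolding dep_def by metis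

lemma dep_jd: assumes "dep N f" shows "dep N (jd d f)"
  unfolding dep_def
proof (intro allI impI, elim conjE)
  fix x z z' assume a: "(x, z) \<in> \<Omega>" "(x, z') \<in> \<Omega>" and eq: "\<forall>m\<le>N. z m = z' m"
  have "eventually (\<lambda>t. sh d t (x, z) \<in> \<Omega> \<and> sh d t (x, z') \<in> \<Omega>) (nhds 0)"
    using a by (intro eventually_conj eventually_sh)
  then have "eventually (\<lambda>t. f (sh d t (x, z)) = f (sh d t (x, z'))) (nhds 0)"
    by eventually_elim (use assms eq in \<open>cases d; auto simp: dep_def\<close>)
  then show "jd d f (x, z) = jd d f (x, z')" unfolding jd_def by (intro deriv_cong_ev) auto
qed

text \<open>The hypothesis \<open>s < m\<close> keeps the shifted jet inside \<Omega>, where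
  \<open>dep\<close> can be applied.\<close>

lemma dep_jd_zero: assumes "dep N f" "N < m" "s < m" "p \<in> \<Omega>" shows "jd (DZ m i) f p = 0"
proof (rule jd_unique)
  have "f (sh (DZ m i) t p) = f p" for t
    using assms by (cases p) (auto simp: dep_def jets_over_def)
  then show "((\<lambda>t. f (sh (DZ m i) t p)) has_real_derivative 0) (at 0)" by simp
qed

lemma diff_fun_add: assumes "diff_fun s U f" "diff_fun s U g" shows "diff_fun s U (\<lambda>p. f p + g p)"
  and diff_fun_mult: "diff_fun s U (\<lambda>p. f p * g p)"
proof -
  obtain N M where "dep N f" "dep M g" using assms by (auto simp: diff_fun_iff)
  then have "dep (max N M) f" "dep (max N M) g" by (auto intro: dep_mono)
  then have "dep (max N M) (\<lambda>p. f p + g p)" "dep (max N M) (\<lambda>p. f p * g p)"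
    unfolding dep_def by metis+
  then show "diff_fun s U (\<lambda>p. f p + g p)" "diff_fun s U (\<lambda>p. f p * g p)"
    using assms jet_Ck_add jet_Ck_mult by (auto simp: diff_fun_iff smooth_def)
qed

lemma diff_fun_const: "diff_fun s U (\<lambda>p. c)"
  using jet_Ck_const by (auto simp: diff_fun_iff smooth_def dep_def)

lemma diff_fun_jd: "diff_fun s U f \<Longrightarrow> diff_fun s U (jd d f)"
  using dep_jd smooth_jd by (auto simp: diff_fun_iff)

lemma diff_fun_cong: "(\<And>p. p \<in> \<Omega> \<Longrightarrow> f p = g p) \<Longrightarrow> diff_fun s U f \<Longrightarrow> diff_fun s U g"
  unfolding diff_fun_iff smooth_def using jet_Ck_cong dep_cong by blast

lemma diff_fun_sum: "(\<And>i. i \<in> I \<Longrightarrow> diff_fun s U (f i)) \<Longrightarrow> diff_fun s U (\<lambda>p. \<Sum>i\<in>I. f i p)"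
  by (induction I rule: infinite_finite_induct) (auto intro: diff_fun_add diff_fun_const)

lemma diff_fun_dble: "diff_fun s U f \<Longrightarrow> dble d f"
  by (simp add: diff_fun_iff smooth_dble)

lemma smooth_of_jd_const:
  assumes "continuous_on \<Omega> f" "\<And>d p. p \<in> \<Omega> \<Longrightarrow> ((\<lambda>t. f (sh d t p)) has_real_derivative c d) (at 0)"
  shows "smooth f"
  unfolding smooth_def
proof
  fix k
  have "jet_Ck k \<Omega> (jd d f)" for d k
    by (rule jet_Ck_cong[of "\<lambda>p. c d"]) (simp_all only: jd_unique[OF assms(2)] jet_Ck_const)
  then show "jet_Ck k \<Omega> f" by (cases k) (auto simp: jet_Ck_Suc assms(1) intro!: dbleI assms(2))
qed

lemma der_coord: "((\<lambda>t. snd (sh d t p) l $ j) has_real_derivative (if d = DZ l j then 1 else 0)) (at 0)"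
proof (cases d)
  case (DZ m i)
  have e: "(\<lambda>t. snd (sh d t p) l $ j) = (\<lambda>t. snd p l $ j + t * (if d = DZ l j then 1 else 0))"
    using DZ by (auto simp: fun_eq_iff axis_def)
  show ?thesis unfolding e by (auto intro!: derivative_eq_intros)
qed auto

lemma diff_fun_coord: "diff_fun s U (\<lambda>p. snd p l $ j)"
proof -
  have "dep l (\<lambda>p. snd p l $ j)" by (auto simp: dep_def)
  moreover have "smooth (\<lambda>p. snd p l $ j)"
    by (rule smooth_of_jd_const[OF _ der_coord]) (intro continuous_intros continuous_on_coord)
  ultimately show ?thesis by (auto simp: diff_fun_iff)
qed

lemma jd_coord: "jd d (\<lambda>p. snd p l $ j) p = (if d = DZ l j then 1 else 0)"
  by (rule jd_unique[OF der_coord])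

lemma der_fst: "((\<lambda>t. fst (sh d t p)) has_real_derivative (if d = DX then 1 else 0)) (at 0)"
  by (cases d) (auto intro!: derivative_eq_intros)

lemma diff_fun_fst: "diff_fun s U fst"
proof -
  have "dep l fst" for l by (auto simp: dep_def)
  moreover have "smooth fst"
    by (rule smooth_of_jd_const[OF _ der_fst]) (intro continuous_intros)
  ultimately show ?thesis by (auto simp: diff_fun_iff)
qed

lemma jd_fst: "jd d fst p = (if d = DX then 1 else 0)"
  by (rule jd_unique[OF der_fst])

lemma der_lift:
  assumes "(\<lambda>t. F (snd p s + t *\<^sub>R axis i 1)) field_differentiable (at 0)"
  shows "((\<lambda>t. F (snd (sh (DZ m i) t p) s)) has_real_derivative (if m = s then partial_deriv i F (snd p s) else 0)) (at 0)"
  using assms by (auto simp: partial_deriv_def field_differentiable_derivI)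

lemma jet_Ck_lift: "Ck_on k U F \<Longrightarrow> jet_Ck k \<Omega> (\<lambda>p. F (snd p s))"
proof (induction k arbitrary: F)
  case 0
  have "continuous_on \<Omega> (F \<circ> (\<lambda>p. snd p s))"
    using 0 by (intro continuous_on_compose continuous_on_coord) (auto simp: \<Omega>_iff intro: continuous_on_subset)
  then show ?case by (simp add: o_def)
next
  case (Suc k)
  have "continuous_on \<Omega> (F \<circ> (\<lambda>p. snd p s))"
    using Suc.prems by (intro continuous_on_compose continuous_on_coord) (auto simp: \<Omega>_iff intro: continuous_on_subset)
  moreover have dz: "((\<lambda>t. F (snd (sh (DZ m i) t p) s)) has_real_derivative (if m = s then partial_deriv i F (snd p s) else 0)) (at 0)"
    if "p \<in> \<Omega>" for m i p by (rule der_lift) (use Suc.prems that \<Omega>_iff in simp)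
  moreover have dx: "((\<lambda>t. F (snd (sh DX t p) s)) has_real_derivative 0) (at 0)" for p by simp
  moreover have "jet_Ck k \<Omega> (jd (DZ m i) (\<lambda>p. F (snd p s)))" for m i
    by (rule jet_Ck_cong[of "\<lambda>p. if m = s then partial_deriv i F (snd p s) else 0"])
      (simp add: jd_unique[OF dz], cases "m = s", use Suc jet_Ck_const in simp_all)
  moreover have "jet_Ck k \<Omega> (jd DX (\<lambda>p. F (snd p s)))"
    by (rule jet_Ck_cong[OF _ jet_Ck_const[of k 0]]) (rule jd_unique[OF dx, symmetric])
  ultimately have "dble d (\<lambda>p. F (snd p s)) \<and> jet_Ck k \<Omega> (jd d (\<lambda>p. F (snd p s)))" for d
    by (cases d) (auto intro!: dbleI simp del: sh.simps)
  with \<open>continuous_on \<Omega> (F \<circ> (\<lambda>p. snd p s))\<close> show ?case by (simp add: jet_Ck_Suc o_def)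
qed

lemma diff_fun_lift: "smooth_on U F \<Longrightarrow> diff_fun s U (\<lambda>p. F (snd p s))"
proof -
  have "dep s (\<lambda>p. F (snd p s))" by (auto simp: dep_def)
  then show "smooth_on U F \<Longrightarrow> ?thesis" using jet_Ck_lift by (auto simp: diff_fun_iff smooth_def smooth_on_def)
qed

lemma jd_lift: assumes F: "smooth_on U F" and p: "p \<in> \<Omega>"
  shows "jd (DZ m i) (\<lambda>p. F (snd p s)) p = (if m = s then partial_deriv i F (snd p s) else 0)"
    and "jd DX (\<lambda>p. F (snd p s)) p = 0"
proof -
  have "Ck_on (Suc 0) U F" using F by (simp only: smooth_on_def)
  then show "jd (DZ m i) (\<lambda>p. F (snd p s)) p = (if m = s then partial_deriv i F (snd p s) else 0)"
    using p by (intro jd_unique[OF der_lift]) (auto simp: \<Omega>_iff)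
  show "jd DX (\<lambda>p. F (snd p s)) p = 0" by (rule jd_unique) simp
qed

end


section \<open>Total derivative and the differential algebra of jets\<close>

context jets
begin

lemma total_deriv_eq:
  assumes "dep N f" "s \<le> N" "p \<in> \<Omega>"
  shows "total_deriv f p = jd DX f p + (\<Sum>m\<le>N. \<Sum>i\<in>UNIV. snd p (Suc m) $ i * jd (DZ m i) f p)"
proof -
  have "(\<Sum>m. \<Sum>i\<in>UNIV. snd p (Suc m) $ i * jd (DZ m i) f p) = (\<Sum>m\<le>N. \<Sum>i\<in>UNIV. snd p (Suc m) $ i * jd (DZ m i) f p)"
    by (rule suminf_finite) (use assms in \<open>auto simp: dep_jd_zero\<close>)
  then show ?thesis by (simp add: total_deriv_def case_prod_unfold jet_dx_jd jet_dz_jd)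
qed

lemma obtain_dep: assumes "diff_fun s U f" "diff_fun s U g"
  obtains N where "dep N f" "dep N g" "s \<le> N"
proof -
  obtain N M where "dep N f" "dep M g" using assms by (auto simp: diff_fun_iff)
  then have "dep (max s (max N M)) f" "dep (max s (max N M)) g" by (auto intro: dep_mono)
  then show ?thesis using that by (metis max.cobounded1)
qed

lemma total_deriv_cong:
  assumes "\<And>p. p \<in> \<Omega> \<Longrightarrow> f p = g p" "p \<in> \<Omega>" shows "total_deriv f p = total_deriv g p"
  using jd_cong[OF assms] by (simp add: total_deriv_def case_prod_unfold jet_dx_jd jet_dz_jd)

lemma diff_fun_total_deriv: assumes f: "diff_fun s U f" shows "diff_fun s U (total_deriv f)"
proof -
  obtain N where N: "dep N f" "s \<le> N" using obtain_dep[OF f f] .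
  show ?thesis
    by (rule diff_fun_cong[of "\<lambda>p. jd DX f p + (\<Sum>m\<le>N. \<Sum>i\<in>UNIV. snd p (Suc m) $ i * jd (DZ m i) f p)"])
      (use total_deriv_eq[OF N] f in \<open>auto intro!: diff_fun_add diff_fun_sum diff_fun_mult diff_fun_coord diff_fun_jd\<close>)
qed

lemma total_deriv_add: assumes f: "diff_fun s U f" and g: "diff_fun s U g" and p: "p \<in> \<Omega>"
  shows "total_deriv (\<lambda>p. f p + g p) p = total_deriv f p + total_deriv g p"
proof -
  obtain N where N: "dep N f" "dep N g" "s \<le> N" using obtain_dep[OF f g] .
  have "dep N (\<lambda>p. f p + g p)" using N unfolding dep_def by metis
  from total_deriv_eq[OF this N(3) p] show ?thesis
    unfolding total_deriv_eq[OF N(1) N(3) p] total_deriv_eq[OF N(2) N(3) p]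
    using f g p by (simp add: jd_add diff_fun_dble algebra_simps sum.distrib)
qed

lemma total_deriv_mult: assumes f: "diff_fun s U f" and g: "diff_fun s U g" and p: "p \<in> \<Omega>"
  shows "total_deriv (\<lambda>p. f p * g p) p = total_deriv f p * g p + f p * total_deriv g p"
proof -
  obtain N where N: "dep N f" "dep N g" "s \<le> N" using obtain_dep[OF f g] .
  have "dep N (\<lambda>p. f p * g p)" using N unfolding dep_def by metis
  from total_deriv_eq[OF this N(3) p] show ?thesis
    unfolding total_deriv_eq[OF N(1) N(3) p] total_deriv_eq[OF N(2) N(3) p]
    using f g p by (simp add: jd_mult diff_fun_dble algebra_simps sum.distrib sum_distrib_left)
qed

lemma jd_sum: "(\<And>i. i \<in> I \<Longrightarrow> diff_fun s U (f i)) \<Longrightarrow> p \<in> \<Omega> \<Longrightarrow> jd d (\<lambda>p. \<Sum>i\<in>I. f i p) p = (\<Sum>i\<in>I. jd d (f i) p)"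
proof (induction I rule: infinite_finite_induct)
  case (insert i I)
  then show ?case using jd_add[of d "f i" "\<lambda>p. \<Sum>i\<in>I. f i p" p] by (simp add: diff_fun_dble diff_fun_sum)
qed (auto intro: jd_unique)

text \<open>The second term arises where the derivative hits the coefficient
  \<open>snd p (Suc l) $ i\<close> of the total derivative; the rest is symmetry of second
  derivatives.\<close>

lemma jd_total_deriv: assumes f: "diff_fun s U f" and p: "p \<in> \<Omega>"
  shows "jd (DZ m i) (total_deriv f) p = total_deriv (jd (DZ m i) f) p
    + (if m = 0 then 0 else jd (DZ (m - 1) i) f p)"
proof -
  obtain N0 where N0: "dep N0 f" "s \<le> N0" using obtain_dep[OF f f] .
  \<comment> \<open>The bound also exceeds m, so that the index \<open>m - 1\<close> belongs to the
    finite sum.\<close>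
  define N where "N = max N0 m"
  have N: "dep N f" "s \<le> N" "m \<le> N" using N0 by (auto simp: N_def intro: dep_mono)
  have sf: "smooth f" using f by (simp add: diff_fun_iff)
  note df = diff_fun_add diff_fun_sum diff_fun_mult diff_fun_coord diff_fun_jd
  have "jd (DZ m i) (total_deriv f) p
     = jd (DZ m i) (\<lambda>p. jd DX f p + (\<Sum>l\<le>N. \<Sum>j\<in>UNIV. snd p (Suc l) $ j * jd (DZ l j) f p)) p"
    by (rule jd_cong[OF _ p]) (rule total_deriv_eq[OF N(1,2)])
  also have "\<dots> = jd (DZ m i) (jd DX f) p + (\<Sum>l\<le>N. \<Sum>j\<in>UNIV. jd (DZ m i) (\<lambda>p. snd p (Suc l) $ j * jd (DZ l j) f p) p)"
    using f p by (simp add: jd_add jd_sum diff_fun_dble df)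
  also have "\<dots> = jd DX (jd (DZ m i) f) p + (\<Sum>l\<le>N. \<Sum>j\<in>UNIV. snd p (Suc l) $ j * jd (DZ l j) (jd (DZ m i) f) p)
     + (\<Sum>l\<le>N. \<Sum>j\<in>UNIV. (if DZ m i = DZ (Suc l) j then 1 else 0) * jd (DZ l j) f p)"
    using f p by (simp add: jd_mult diff_fun_dble df jd_coord jd_commute[OF sf p, of "DZ m i"] sum.distrib)
  also have "(\<Sum>l\<le>N. \<Sum>j\<in>UNIV. (if DZ m i = DZ (Suc l) j then 1 else 0) * jd (DZ l j) f p)
     = (\<Sum>l\<le>N. if m = Suc l then jd (DZ l i) f p else 0)"
    by (intro sum.cong refl) (simp add: if_distrib[of "\<lambda>x. x * _"] cong: if_cong)
  also have "\<dots> = (if m = 0 then 0 else jd (DZ (m - 1) i) f p)"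
  proof (cases m)
    case (Suc k)
    then have "(\<Sum>l\<le>N. if m = Suc l then jd (DZ l i) f p else 0) = (\<Sum>l\<le>N. if l = k then jd (DZ k i) f p else 0)"
      by (intro sum.cong) auto
    also have "\<dots> = jd (DZ k i) f p" using Suc N(3) by simp
    finally show ?thesis using Suc by simp
  qed simp
  finally show ?thesis unfolding total_deriv_eq[OF dep_jd[OF N(1)] N(2) p] by simp
qed

definition \<rho> :: "'n jet \<Rightarrow> 'n jet" where "\<rho> p = (if p \<in> \<Omega> then p else (0, \<lambda>_. u0))"

text \<open>Outside \<open>\<Omega>\<close> the functions carry junk values; composing with the retraction \<open>\<rho>\<close> makes equality
  on \<open>\<Omega>\<close> an honest equality of functions while keeping constants, so that the unit is \<open>1\<close>.\<close>

definition R :: "('n jet \<Rightarrow> real) \<Rightarrow> 'n jet \<Rightarrow> real" where "R f = (\<lambda>p. f (\<rho> p))"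

definition AA :: "('n jet \<Rightarrow> real) set" where "AA = {f. diff_fun s U f \<and> R f = f}"
definition DD :: "('n jet \<Rightarrow> real) \<Rightarrow> 'n jet \<Rightarrow> real" where "DD f = R (total_deriv f)"
definition pdd :: "nat \<Rightarrow> 'n \<Rightarrow> ('n jet \<Rightarrow> real) \<Rightarrow> 'n jet \<Rightarrow> real" where "pdd m i f = R (jd (DZ m i) f)"
definition zz :: "nat \<Rightarrow> 'n \<Rightarrow> 'n jet \<Rightarrow> real" where "zz m i = R (\<lambda>p. snd p m $ i)"
definition x1 :: "'n jet \<Rightarrow> real" where "x1 = R fst"

lemma \<rho>_in: "\<rho> p \<in> \<Omega>" using u0 by (auto simp: \<rho>_def jets_over_def)

lemma R_apply [simp]: "p \<in> \<Omega> \<Longrightarrow> R f p = f p" by (simp add: R_def \<rho>_def)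

lemma R_R [simp]: "R (R f) = R f" by (simp add: R_def fun_eq_iff \<rho>_in \<rho>_def u0 jets_over_def)

lemma R_eq: "(\<And>p. p \<in> \<Omega> \<Longrightarrow> f p = g p) \<Longrightarrow> R f = R g"
  using \<rho>_in by (auto simp: R_def)

lemma diff_fun_R: "diff_fun s U f \<Longrightarrow> diff_fun s U (R f)"
  by (rule diff_fun_cong[of f]) simp_all

lemma R_in: "diff_fun s U f \<Longrightarrow> R f \<in> AA" by (simp add: AA_def diff_fun_R)

lemma AA_diff_fun: "f \<in> AA \<Longrightarrow> diff_fun s U f" by (simp add: AA_def)
lemma AA_R: "f \<in> AA \<Longrightarrow> R f = f" by (simp add: AA_def)

lemma AA_eqI: "f \<in> AA \<Longrightarrow> g \<in> AA \<Longrightarrow> (\<And>p. p \<in> \<Omega> \<Longrightarrow> f p = g p) \<Longrightarrow> f = g"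
  using R_eq AA_R by metis

lemma R_ring: "R (f + g) = R f + R g" "R (f * g) = R f * R g" "R (- f) = - R f" "R 1 = 1"
  by (auto simp: R_def fun_eq_iff)

lemma fun_ring: "f + g = (\<lambda>p. f p + g p)" "f * g = (\<lambda>p. f p * g p)"
  for f g :: "'n jet \<Rightarrow> real"
  by (auto simp: fun_eq_iff)

lemma AA_add: "f \<in> AA \<Longrightarrow> g \<in> AA \<Longrightarrow> f + g \<in> AA" and AA_mult: "f \<in> AA \<Longrightarrow> g \<in> AA \<Longrightarrow> f * g \<in> AA"
  and AA_1: "1 \<in> AA"
  using diff_fun_add[of f g] diff_fun_mult[of f g] diff_fun_const[of 1]
  by (auto simp: AA_def R_ring fun_ring[symmetric] one_fun_def[symmetric])

lemma DD_in: "f \<in> AA \<Longrightarrow> DD f \<in> AA" and pdd_in: "f \<in> AA \<Longrightarrow> pdd m i f \<in> AA"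
  unfolding DD_def pdd_def using R_in diff_fun_total_deriv diff_fun_jd AA_diff_fun by blast+

lemma DD_apply: "p \<in> \<Omega> \<Longrightarrow> DD f p = total_deriv f p" and pdd_apply: "p \<in> \<Omega> \<Longrightarrow> pdd m i f p = jd (DZ m i) f p"
  by (auto simp: DD_def pdd_def)

lemma derivation_DD: "derivation_on AA DD"
  unfolding derivation_on_def
proof (intro conjI ballI)
  fix f g assume "f \<in> AA" "g \<in> AA"
  then show "DD (f + g) = DD f + DD g" "DD (f * g) = DD f * g + f * DD g"
    by (intro AA_eqI DD_in AA_add AA_mult;
        simp add: DD_apply fun_ring(1)[of f g] fun_ring(2)[of f g] total_deriv_add total_deriv_mult AA_diff_fun)+
qed (rule DD_in)

lemma derivation_pdd: "derivation_on AA (pdd m i)"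
  unfolding derivation_on_def
proof (intro conjI ballI)
  fix f g assume "f \<in> AA" "g \<in> AA"
  then show "pdd m i (f + g) = pdd m i f + pdd m i g" "pdd m i (f * g) = pdd m i f * g + f * pdd m i g"
    by (intro AA_eqI pdd_in AA_add AA_mult;
        simp add: pdd_apply fun_ring(1)[of f g] fun_ring(2)[of f g] jd_add jd_mult diff_fun_dble AA_diff_fun)+
qed (rule pdd_in)

lemma jd_R: "p \<in> \<Omega> \<Longrightarrow> jd d (R f) p = jd d f p"
  by (rule jd_cong) auto

lemma total_deriv_R: "p \<in> \<Omega> \<Longrightarrow> total_deriv (R f) p = total_deriv f p"
  by (rule total_deriv_cong) auto

lemma DD_R: "DD (R f) = R (total_deriv f)" and pdd_R: "pdd m i (R f) = R (jd (DZ m i) f)"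
  unfolding DD_def pdd_def by (rule R_eq, simp add: jd_R total_deriv_R)+

lemma total_deriv_coord: "p \<in> \<Omega> \<Longrightarrow> total_deriv (\<lambda>p. snd p m $ i) p = snd p (Suc m) $ i"
proof -
  assume p: "p \<in> \<Omega>"
  have "dep (max s m) (\<lambda>p. snd p m $ i)" by (auto simp: dep_def)
  from total_deriv_eq[OF this _ p] have "total_deriv (\<lambda>p. snd p m $ i) p
     = (\<Sum>l\<le>max s m. \<Sum>j\<in>UNIV. if l = m then (if j = i then snd p (Suc m) $ i else 0) else 0)"
    by (auto simp: jd_coord intro!: sum.cong)
  also have "\<dots> = (\<Sum>l\<le>max s m. if l = m then snd p (Suc m) $ i else 0)"
    by (intro sum.cong refl) auto
  finally show ?thesis by simp
qed

lemma total_deriv_fst: "p \<in> \<Omega> \<Longrightarrow> total_deriv fst p = 1"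
  using total_deriv_eq[of s fst p] by (simp add: dep_def jd_fst)

text \<open>Equality in \<open>AA\<close> is equality of functions thanks to the retraction, so the
  ring-theoretic results above apply verbatim to differential functions.\<close>

sublocale diff_algebra AA DD pdd zz x1
proof
  show "1 \<in> AA" by (rule AA_1)
  show "f + g \<in> AA" "f * g \<in> AA" if "f \<in> AA" "g \<in> AA" for f g using that AA_add AA_mult by auto
  show "- f \<in> AA" if "f \<in> AA" for f
  proof -
    have "(\<lambda>p. -1) * f \<in> AA"
      using that R_in[OF diff_fun_const[of "-1"]] by (intro AA_mult) (simp_all add: R_def)
    moreover have "(\<lambda>p. -1) * f = - f" by (auto simp: fun_eq_iff)
    ultimately show ?thesis by simp
  qed
  show "zz m i \<in> AA" "x1 \<in> AA" for m i
    unfolding zz_def x1_def by (intro R_in diff_fun_coord diff_fun_fst)+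
  show "derivation_on AA DD" "derivation_on AA (pdd m i)" for m i by (rule derivation_DD derivation_pdd)+
  show "pdd m i (pdd l j f) = pdd l j (pdd m i f)" if "f \<in> AA" for f m i l j
    using AA_diff_fun[OF that] unfolding pdd_def
    by (intro R_eq) (simp add: jd_R jd_commute diff_fun_iff)
  show "pdd 0 i (DD f) = DD (pdd 0 i f)" if "f \<in> AA" for f i
    using AA_diff_fun[OF that] unfolding pdd_def DD_def
    by (intro R_eq) (simp add: jd_R total_deriv_R jd_total_deriv)
  show "pdd (Suc m) i (DD f) = DD (pdd (Suc m) i f) + pdd m i f" if "f \<in> AA" for f m i
    using AA_diff_fun[OF that] unfolding pdd_def DD_def R_ring[symmetric]
    by (intro R_eq) (simp add: jd_R total_deriv_R jd_total_deriv)
  show "\<exists>N. \<forall>m>N. \<forall>i. pdd m i f = 0" if "f \<in> AA" for f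
  proof -
    obtain N where N: "dep N f" "s \<le> N" by (rule obtain_dep[OF AA_diff_fun[OF \<open>f \<in> AA\<close>] AA_diff_fun[OF \<open>f \<in> AA\<close>]])
    have "pdd m i f = 0" if "N < m" for m i
    proof -
      have "R (jd (DZ m i) f) = R (\<lambda>p. 0)"
        by (rule R_eq) (use N that in \<open>auto simp: dep_jd_zero\<close>)
      then show ?thesis by (simp add: pdd_def R_def fun_eq_iff)
    qed
    then show ?thesis by blast
  qed
  show "DD (zz m i) = zz (Suc m) i" for m i
    unfolding zz_def DD_R by (rule R_eq) (rule total_deriv_coord)
  show "DD x1 = 1"
    using R_eq[of "total_deriv fst" 1] by (simp add: x1_def DD_R total_deriv_fst R_ring)
  show "pdd m i (zz l j) = (if m = l \<and> i = j then 1 else 0)" for m i l j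
    unfolding zz_def pdd_R by (auto simp: R_def jd_coord fun_eq_iff)
  show "pdd m i x1 = 0" for m i
    unfolding x1_def pdd_R by (auto simp: R_def jd_fst fun_eq_iff)
  show "f = 0" if "f \<in> AA" "of_nat (Suc k) * f = 0" for f k
  proof
    fix p
    have "(of_nat (Suc k) * f) p = 0" using that by simp
    then show "f p = 0 p" by (simp add: of_nat_fun_apply del: of_nat_Suc)
  qed
qed

subsection \<open>Comparison with the concrete operators\<close>

lemma DD_pow_R: "(DD ^^ m) (R f) = R ((total_deriv ^^ m) f)"
  by (induction m) (auto simp: DD_R)

text \<open>Beyond the order of h all terms of the defining series vanish on \<Omega>, so the series
  and the finite Euler sum agree there.\<close>

lemma euler_R: assumes h: "diff_fun s U h" shows "euler i (R h) = R (variational_deriv i h)"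
proof (rule R_eq[of "euler i (R h)" "variational_deriv i h", unfolded AA_R[OF euler_in[OF R_in[OF h]]]])
  fix p assume p: "p \<in> \<Omega>"
  obtain N where N: "dep N h" "s \<le> N" using obtain_dep h by metis
  have o: "ordle N (R h)"
    unfolding ordle_def
  proof (intro conjI allI impI R_in h)
    fix m i assume "N < m"
    then have "R (jd (DZ m i) h) = R (\<lambda>p. 0)"
      by (intro R_eq) (use N in \<open>auto simp: dep_jd_zero\<close>)
    then show "pdd m i (R h) = 0" unfolding pdd_R by (simp add: R_def fun_eq_iff)
  qed
  have pw: "(g ^ m) p = (g p) ^ m" "((\<Sum>i\<in>I. F i) p) = (\<Sum>i\<in>I. F i p)"
    for g :: "'n jet \<Rightarrow> real" and m and F :: "nat \<Rightarrow> 'n jet \<Rightarrow> real" and I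
    by (induction m, auto) (induction I rule: infinite_finite_induct, auto)
  have "euler i (R h) p = (\<Sum>m\<le>N. (-1) ^ m * (total_deriv ^^ m) (jd (DZ m i) h) p)"
    unfolding euler_eq[OF o] pw by (simp add: pw pdd_R DD_pow_R p)
  also have "\<dots> = (\<Sum>m. (-1) ^ m * (total_deriv ^^ m) (jd (DZ m i) h) p)"
  proof (rule suminf_finite[symmetric])
    fix m assume m: "m \<notin> {..N}"
    have z: "R (jd (DZ m i) h) = 0" using ordleD[OF o, of m i] m by (simp only: pdd_R atMost_iff not_le)
    have "R ((total_deriv ^^ m) (jd (DZ m i) h)) = 0"
      unfolding DD_pow_R[symmetric] z by (rule D_pow_0)
    then have "R ((total_deriv ^^ m) (jd (DZ m i) h)) p = 0" by simp
    then show "(-1) ^ m * (total_deriv ^^ m) (jd (DZ m i) h) p = 0" using p by simp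
  qed simp
  finally show "euler i (R h) p = variational_deriv i h p"
    by (simp add: variational_deriv_def jet_dz_jd)
qed

definition lift :: "(real^'n \<Rightarrow> real) \<Rightarrow> 'n jet \<Rightarrow> real" where "lift F = R (\<lambda>p. F (snd p s))"

lemma lift_in: "smooth_on U F \<Longrightarrow> lift F \<in> AA"
  unfolding lift_def by (intro R_in diff_fun_lift)

lemma smooth_on_partial_deriv: "smooth_on U F \<Longrightarrow> smooth_on U (partial_deriv i F)"
  unfolding smooth_on_def by (metis Ck_on.simps(2))

lemma pdd_lift: "smooth_on U F \<Longrightarrow> pdd m i (lift F) = (if m = s then lift (partial_deriv i F) else 0)"
  unfolding lift_def pdd_R using R_eq[of "jd (DZ m i) (\<lambda>p. F (snd p s))"]
  by (auto simp: R_def fun_eq_iff jd_lift \<rho>_in)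

lemma DD_lift: assumes F: "smooth_on U F"
  shows "DD (lift F) = (\<Sum>k\<in>UNIV. pdd s k (lift F) * zz (Suc s) k)"
proof (rule AA_eqI)
  fix p assume p: "p \<in> \<Omega>"
  have sum: "((\<Sum>i\<in>I. F i) p) = (\<Sum>i\<in>I. F i p)" for F :: "'n \<Rightarrow> 'n jet \<Rightarrow> real" and I
    by (induction I rule: infinite_finite_induct) auto
  have "dep s (\<lambda>p. F (snd p s))" by (auto simp: dep_def)
  moreover have "(\<Sum>m\<le>s. \<Sum>i\<in>UNIV. snd p (Suc m) $ i * jd (DZ m i) (\<lambda>p. F (snd p s)) p)
     = (\<Sum>m\<le>s. if m = s then (\<Sum>i\<in>UNIV. snd p (Suc s) $ i * partial_deriv i F (snd p s)) else 0)"
    by (intro sum.cong refl) (auto simp: jd_lift[OF F p])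
  ultimately have "total_deriv (\<lambda>p. F (snd p s)) p = (\<Sum>i\<in>UNIV. snd p (Suc s) $ i * partial_deriv i F (snd p s))"
    using total_deriv_eq[OF _ order_refl p] by (simp add: jd_lift(2)[OF F p])
  then show "DD (lift F) p = (\<Sum>k\<in>UNIV. pdd s k (lift F) * zz (Suc s) k) p"
    unfolding sum using p F
    by (simp add: pdd_lift zz_def lift_def[of "partial_deriv _ F"] mult.commute) (simp add: lift_def DD_R)
qed (use F lift_in in auto)

lemma lift_apply: "p \<in> \<Omega> \<Longrightarrow> lift F p = F (snd p s)" by (simp add: lift_def)

lemma lift_eq_iff: "lift F = lift G \<longleftrightarrow> (\<forall>u\<in>U. F u = G u)"
proof
  assume eq: "lift F = lift G"
  show "\<forall>u\<in>U. F u = G u"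
  proof
    fix u assume u: "u \<in> U"
    have p: "(0, \<lambda>_. u) \<in> \<Omega>" using u by (simp add: jets_over_def)
    show "F u = G u" using fun_cong[OF eq, of "(0, \<lambda>_. u)"] by (simp add: lift_apply[OF p])
  qed
next
  assume "\<forall>u\<in>U. F u = G u"
  then show "lift F = lift G" unfolding lift_def by (intro R_eq) (auto simp: \<Omega>_iff)
qed

lemma lift_ring: "lift (\<lambda>u. F u + G u) = lift F + lift G" "lift (\<lambda>u. F u * G u) = lift F * lift G"
  "lift (\<lambda>u. - F u) = - lift F" "lift (\<lambda>u. F u - G u) = lift F - lift G"
  by (auto simp: lift_def R_def fun_eq_iff)

lemma lift_const: "lift (\<lambda>u. if P then 1 else 0) = (if P then 1 else 0)" "lift (\<lambda>u. 0) = 0"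
  by (auto simp: lift_def R_def fun_eq_iff)

lemma lift_sum: "lift (\<lambda>u. \<Sum>i\<in>I. F i u) = (\<Sum>i\<in>I. lift (F i))"
  by (induction I rule: infinite_finite_induct) (auto simp: lift_ring lift_const)

end

lemma (in jets) null_functional_iff: assumes "s = 0" shows "null_functional U f \<longleftrightarrow> nul (R f)"
proof
  assume "null_functional U f"
  then obtain K where K: "diff_fun s U K" "\<And>p. p \<in> \<Omega> \<Longrightarrow> f p = total_deriv K p"
    using assms by (auto simp: null_functional_def)
  have "R f = DD (R K)" unfolding DD_R by (rule R_eq) (rule K)
  then show "nul (R f)" using nul_D R_in K(1) by simp
next
  assume "nul (R f)"
  then obtain K where K: "K \<in> AA" "R f = DD K" by (auto simp: nul_def)
  then have "f p = total_deriv K p" if "p \<in> \<Omega>" for p using that R_apply DD_apply by metis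
  then show "null_functional U f" unfolding null_functional_def using AA_diff_fun[OF K(1)] assms by auto
qed


section \<open>Smooth coefficients\<close>

lemma matrix_inv_inverse: assumes "invertible (A :: real^'n^'n)"
  shows "A ** matrix_inv A = mat 1" "matrix_inv A ** A = mat 1"
  using someI_ex[OF assms[unfolded invertible_def]] by (auto simp: matrix_inv_def)

context
  fixes U :: "(real^'n::finite) set" assumes U: "open U"
begin

lemma eventually_axis: "u \<in> U \<Longrightarrow> eventually (\<lambda>t. u + t *\<^sub>R axis i 1 \<in> U) (nhds (0::real))"
proof -
  assume u: "u \<in> U"
  have "continuous_on UNIV (\<lambda>t::real. u + t *\<^sub>R axis i 1)" by (intro continuous_intros)
  then have "open ((\<lambda>t::real. u + t *\<^sub>R axis i 1) -` U)" using U open_vimage by metis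
  then show ?thesis using u unfolding eventually_nhds by (intro exI[of _ "(\<lambda>t::real. u + t *\<^sub>R axis i 1) -` U"]) auto
qed

definition has_pd :: "'n \<Rightarrow> (real^'n \<Rightarrow> real) \<Rightarrow> (real^'n \<Rightarrow> real) \<Rightarrow> bool" where
  "has_pd i f f' \<longleftrightarrow> (\<forall>u\<in>U. ((\<lambda>t. f (u + t *\<^sub>R axis i 1)) has_real_derivative f' u) (at 0))"

lemma has_pd_eq: "has_pd i f f' \<Longrightarrow> u \<in> U \<Longrightarrow> partial_deriv i f u = f' u"
  unfolding has_pd_def partial_deriv_def using DERIV_imp_deriv by blast

lemma has_pd_cong: assumes "\<And>u. u \<in> U \<Longrightarrow> f u = g u" "has_pd i f f'" shows "has_pd i g f'"
  unfolding has_pd_def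
proof
  fix u assume u: "u \<in> U"
  have "eventually (\<lambda>t. f (u + t *\<^sub>R axis i 1) = g (u + t *\<^sub>R axis i 1)) (nhds 0)"
    by (rule eventually_mono[OF eventually_axis[OF u, of i]]) (rule assms(1))
  from iffD1[OF DERIV_cong_ev[OF refl this refl]] assms(2) u
  show "((\<lambda>t. g (u + t *\<^sub>R axis i 1)) has_real_derivative f' u) (at 0)" by (auto simp: has_pd_def)
qed

lemma Ck_on_Suc: "Ck_on (Suc k) U f \<longleftrightarrow> continuous_on U f \<and>
    (\<forall>i. has_pd i f (partial_deriv i f) \<and> Ck_on k U (partial_deriv i f))"
proof -
  have "(\<lambda>t. f (u + t *\<^sub>R axis i 1)) field_differentiable (at 0)
    \<longleftrightarrow> ((\<lambda>t. f (u + t *\<^sub>R axis i 1)) has_real_derivative partial_deriv i f u) (at 0)" for i u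
    unfolding partial_deriv_def using field_differentiable_derivI field_differentiable_def by blast
  then show ?thesis by (simp add: has_pd_def)
qed

declare Ck_on.simps(2) [simp del]

lemma partial_deriv_cong: "(\<And>u. u \<in> U \<Longrightarrow> f u = g u) \<Longrightarrow> u \<in> U \<Longrightarrow> partial_deriv i f u = partial_deriv i g u"
  unfolding partial_deriv_def
  by (rule deriv_cong_ev[OF eventually_mono[OF eventually_axis[of u i]]]) auto

lemma Ck_on_cong: "(\<And>u. u \<in> U \<Longrightarrow> f u = g u) \<Longrightarrow> Ck_on k U f \<Longrightarrow> Ck_on k U g"
proof (induction k arbitrary: f g)
  case 0 then show ?case using continuous_on_cong by (metis Ck_on.simps(1))
next
  case (Suc k)
  have "continuous_on U g" using Suc.prems continuous_on_cong unfolding Ck_on_Suc by metis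
  moreover have "has_pd i g (partial_deriv i g) \<and> Ck_on k U (partial_deriv i g)" for i
  proof
    have "has_pd i g (partial_deriv i f)" using Suc.prems has_pd_cong unfolding Ck_on_Suc by blast
    then show "has_pd i g (partial_deriv i g)" unfolding has_pd_def
      using has_pd_eq[OF \<open>has_pd i g (partial_deriv i f)\<close>] by simp
    show "Ck_on k U (partial_deriv i g)"
      using Suc.IH[of "partial_deriv i f" "partial_deriv i g"] partial_deriv_cong Suc.prems unfolding Ck_on_Suc by blast
  qed
  ultimately show ?case unfolding Ck_on_Suc by blast
qed

lemma Ck_on_SucI: assumes "continuous_on U f" "\<And>i. has_pd i f (f' i)" "\<And>i. Ck_on k U (f' i)"
  shows "Ck_on (Suc k) U f"
  unfolding Ck_on_Suc
proof (intro conjI allI assms(1))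
  fix i
  show "has_pd i f (partial_deriv i f)" using assms(2)[of i] has_pd_eq[OF assms(2)] by (simp add: has_pd_def)
  show "Ck_on k U (partial_deriv i f)"
    using Ck_on_cong[OF _ assms(3), of i "partial_deriv i f"] has_pd_eq[OF assms(2)] by simp
qed

lemma Ck_on_dec: "Ck_on (Suc k) U f \<Longrightarrow> Ck_on k U f"
proof (induction k arbitrary: f)
  case 0 then show ?case by (simp add: Ck_on_Suc)
next
  case (Suc k)
  from Suc.prems have "continuous_on U f \<and> (\<forall>i. has_pd i f (partial_deriv i f) \<and> Ck_on (Suc k) U (partial_deriv i f))"
    using Ck_on_Suc by blast
  then show ?case using Suc.IH Ck_on_Suc[of k f] by blast
qed

lemma has_pd_const: "has_pd i (\<lambda>u. c) (\<lambda>u. 0)" by (simp add: has_pd_def)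

lemma has_pd_add: "has_pd i f f' \<Longrightarrow> has_pd i g g' \<Longrightarrow> has_pd i (\<lambda>u. f u + g u) (\<lambda>u. f' u + g' u)"
  by (auto simp: has_pd_def intro!: DERIV_add)

lemma has_pd_mult: "has_pd i f f' \<Longrightarrow> has_pd i g g' \<Longrightarrow> has_pd i (\<lambda>u. f u * g u) (\<lambda>u. f' u * g u + f u * g' u)"
proof -
  have "((\<lambda>t. f (u + t *\<^sub>R axis i 1) * g (u + t *\<^sub>R axis i 1)) has_real_derivative a * g u + f u * b) (at 0)"
    if "((\<lambda>t. f (u + t *\<^sub>R axis i 1)) has_real_derivative a) (at 0)"
      "((\<lambda>t. g (u + t *\<^sub>R axis i 1)) has_real_derivative b) (at 0)" for u a b
    using DERIV_mult[OF that] by (simp add: algebra_simps)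
  then show "has_pd i f f' \<Longrightarrow> has_pd i g g' \<Longrightarrow> ?thesis" by (auto simp: has_pd_def)
qed

lemma has_pd_inverse: "has_pd i f f' \<Longrightarrow> (\<And>u. u \<in> U \<Longrightarrow> f u \<noteq> 0)
   \<Longrightarrow> has_pd i (\<lambda>u. inverse (f u)) (\<lambda>u. - 1 * f' u * (inverse (f u) * inverse (f u)))"
proof -
  have "((\<lambda>t. inverse (f (u + t *\<^sub>R axis i 1))) has_real_derivative - 1 * a * (inverse (f u) * inverse (f u))) (at 0)"
    if "((\<lambda>t. f (u + t *\<^sub>R axis i 1)) has_real_derivative a) (at 0)" "f u \<noteq> 0" for u a
    using DERIV_inverse'[OF that(1)] that(2) by (simp add: algebra_simps)
  then show "has_pd i f f' \<Longrightarrow> (\<And>u. u \<in> U \<Longrightarrow> f u \<noteq> 0) \<Longrightarrow> ?thesis" by (auto simp: has_pd_def)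
qed

lemma has_pd_coord: "has_pd i (\<lambda>u. u $ j) (\<lambda>u. if i = j then 1 else 0)"
  by (auto simp: has_pd_def axis_def intro!: derivative_eq_intros)

lemma Ck_on_const: "Ck_on k U (\<lambda>u. c)"
  by (induction k arbitrary: c) (auto intro!: Ck_on_SucI has_pd_const)

lemma Ck_on_coord: "Ck_on k U (\<lambda>u. u $ j)"
  by (cases k) (auto intro!: Ck_on_SucI has_pd_coord continuous_intros Ck_on_const)

lemma Ck_on_add: "Ck_on k U f \<Longrightarrow> Ck_on k U g \<Longrightarrow> Ck_on k U (\<lambda>u. f u + g u)"
proof (induction k arbitrary: f g)
  case (Suc k)
  show ?case
    by (rule Ck_on_SucI[of _ "\<lambda>i u. partial_deriv i f u + partial_deriv i g u"])
      (use Suc in \<open>auto simp: Ck_on_Suc intro: continuous_on_add has_pd_add\<close>)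
qed (auto intro: continuous_on_add)

lemma Ck_on_mult: "Ck_on k U f \<Longrightarrow> Ck_on k U g \<Longrightarrow> Ck_on k U (\<lambda>u. f u * g u)"
proof (induction k arbitrary: f g)
  case (Suc k)
  have fg: "Ck_on k U f" "Ck_on k U g" using Suc.prems Ck_on_dec by auto
  show ?case
    by (rule Ck_on_SucI[of _ "\<lambda>i u. partial_deriv i f u * g u + f u * partial_deriv i g u"])
      (use Suc fg in \<open>auto simp: Ck_on_Suc intro: continuous_on_mult has_pd_mult intro!: Ck_on_add\<close>)
qed (auto intro: continuous_on_mult)

lemma Ck_on_inverse: "Ck_on k U f \<Longrightarrow> (\<And>u. u \<in> U \<Longrightarrow> f u \<noteq> 0) \<Longrightarrow> Ck_on k U (\<lambda>u. inverse (f u))"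
proof (induction k arbitrary: f)
  case (Suc k)
  have "Ck_on k U (\<lambda>u. inverse (f u))" using Suc Ck_on_dec by blast
  then show ?case
    by (intro Ck_on_SucI[of _ "\<lambda>i u. - 1 * partial_deriv i f u * (inverse (f u) * inverse (f u))"] continuous_on_inverse
       has_pd_inverse Ck_on_mult Ck_on_const)
      (use Suc.prems in \<open>auto simp: Ck_on_Suc\<close>)
qed (auto intro: continuous_on_inverse)

lemma smooth_on_const: "smooth_on U (\<lambda>u. c)" and smooth_on_coord: "smooth_on U (\<lambda>u. u $ j)"
  by (simp_all add: smooth_on_def Ck_on_const Ck_on_coord)

lemma smooth_on_add: "smooth_on U f \<Longrightarrow> smooth_on U g \<Longrightarrow> smooth_on U (\<lambda>u. f u + g u)"
  by (simp add: smooth_on_def Ck_on_add)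

lemma smooth_on_mult: "smooth_on U f \<Longrightarrow> smooth_on U g \<Longrightarrow> smooth_on U (\<lambda>u. f u * g u)"
  by (simp add: smooth_on_def Ck_on_mult)

lemma smooth_on_inverse: "smooth_on U f \<Longrightarrow> (\<And>u. u \<in> U \<Longrightarrow> f u \<noteq> 0) \<Longrightarrow> smooth_on U (\<lambda>u. inverse (f u))"
  by (simp add: smooth_on_def Ck_on_inverse)

lemma smooth_on_cong: assumes "\<And>u. u \<in> U \<Longrightarrow> f u = g u" "smooth_on U f" shows "smooth_on U g"
  unfolding smooth_on_def
proof
  fix k show "Ck_on k U g" by (rule Ck_on_cong[OF assms(1)]) (use assms(2) in \<open>simp_all add: smooth_on_def\<close>)
qed

lemma smooth_on_sum: "(\<And>i. i \<in> I \<Longrightarrow> smooth_on U (f i)) \<Longrightarrow> smooth_on U (\<lambda>u. \<Sum>i\<in>I. f i u)"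
  by (induction I rule: infinite_finite_induct) (auto intro: smooth_on_const smooth_on_add)

lemma smooth_on_prod: "(\<And>i. i \<in> I \<Longrightarrow> smooth_on U (f i)) \<Longrightarrow> smooth_on U (\<lambda>u. \<Prod>i\<in>I. f i u)"
  by (induction I rule: infinite_finite_induct) (auto intro: smooth_on_const smooth_on_mult)

lemma smooth_on_has_pd: "smooth_on U f \<Longrightarrow> has_pd i f (partial_deriv i f)"
  unfolding smooth_on_def using Ck_on_Suc by blast

lemma partial_deriv_add: "smooth_on U f \<Longrightarrow> smooth_on U g \<Longrightarrow> u \<in> U \<Longrightarrow>
    partial_deriv i (\<lambda>u. f u + g u) u = partial_deriv i f u + partial_deriv i g u"
  and partial_deriv_mult: "smooth_on U f \<Longrightarrow> smooth_on U g \<Longrightarrow> u \<in> U \<Longrightarrow>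
    partial_deriv i (\<lambda>u. f u * g u) u = partial_deriv i f u * g u + f u * partial_deriv i g u"
  by (rule has_pd_eq[OF has_pd_add[OF smooth_on_has_pd smooth_on_has_pd]]
      has_pd_eq[OF has_pd_mult[OF smooth_on_has_pd smooth_on_has_pd]]; assumption)+

lemma partial_deriv_const: "u \<in> U \<Longrightarrow> partial_deriv i (\<lambda>u. c) u = 0"
  by (rule has_pd_eq[OF has_pd_const])

lemma partial_deriv_sum: "(\<And>j. j \<in> I \<Longrightarrow> smooth_on U (f j)) \<Longrightarrow> u \<in> U \<Longrightarrow>
    partial_deriv i (\<lambda>u. \<Sum>j\<in>I. f j u) u = (\<Sum>j\<in>I. partial_deriv i (f j) u)"
proof (induction I rule: infinite_finite_induct)
  case (insert j I)
  then show ?case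
    using partial_deriv_add[of "f j" "\<lambda>u. \<Sum>j\<in>I. f j u" u i] smooth_on_sum[of I f] by simp
qed (auto simp: partial_deriv_const)

lemma smooth_on_det: "(\<And>i j. smooth_on U (\<lambda>u. M u $ i $ j)) \<Longrightarrow> smooth_on U (\<lambda>u. det (M u :: real^'m^'m))"
  unfolding det_def by (intro smooth_on_sum smooth_on_mult smooth_on_const smooth_on_prod)

text \<open>Cramer's rule writes the entries of the inverse as quotients of determinants, and
  determinants are polynomial in the entries.\<close>

lemma smooth_on_matrix_inv:
  fixes M :: "real^'n \<Rightarrow> real^'m^'m"
  assumes M: "\<And>i j. smooth_on U (\<lambda>u. M u $ i $ j)" and det: "\<And>u. u \<in> U \<Longrightarrow> det (M u) \<noteq> 0"
  shows "smooth_on U (\<lambda>u. matrix_inv (M u) $ k $ j)"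
proof (rule smooth_on_cong)
  fix u assume u: "u \<in> U"
  have "M u ** matrix_inv (M u) = mat 1"
    using det[OF u] by (intro matrix_inv_inverse) (simp add: invertible_det_nz)
  then have "M u *v column j (matrix_inv (M u)) = axis j 1"
    by (auto simp: vec_eq_iff matrix_matrix_mult_def matrix_vector_mult_def column_def mat_def axis_def)
  then have "column j (matrix_inv (M u)) = (\<chi> k. det (\<chi> i l. if l = k then axis j 1 $ i else M u $ i $ l) / det (M u))"
    using cramer[OF det[OF u]] by blast
  then show "det (\<chi> i l. if l = k then axis j 1 $ i else M u $ i $ l) * inverse (det (M u)) = matrix_inv (M u) $ k $ j"
    by (metis (no_types, lifting) column_def divide_inverse vec_lambda_beta)
next
  have "smooth_on U (\<lambda>u. (if l = k then axis j 1 $ i else M u $ i $ l))" for i l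
    by (cases "l = k") (simp_all add: smooth_on_const M)
  then show "smooth_on U (\<lambda>u. det (\<chi> i l. if l = k then axis j 1 $ i else M u $ i $ l) * inverse (det (M u)))"
    by (intro smooth_on_mult smooth_on_inverse smooth_on_det M) (use det in auto)
qed

end


section \<open>The metric relation from skew-symmetry of the bracket\<close>

context diff_algebra
begin

text \<open>The inner operator in the given coefficients. It is set up outside
  \<open>third_order\<close>, whose axiom \<open>metric\<close> is what skew-symmetry has yet to
  deliver.\<close>

definition QQ :: "('n \<Rightarrow> 'n \<Rightarrow> 'r) \<Rightarrow> ('n \<Rightarrow> 'n \<Rightarrow> 'n \<Rightarrow> 'r) \<Rightarrow> nat \<Rightarrow> ('n \<Rightarrow> 'r) \<Rightarrow> 'n \<Rightarrow> 'r" where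
  "QQ gg cc s b = (\<lambda>i. (\<Sum>j\<in>UNIV. gg i j * D (b j)) + (\<Sum>j\<in>UNIV. \<Sum>k\<in>UNIV. cc i j k * z (Suc s) k * b j))"

definition bk0 :: "('n \<Rightarrow> 'n \<Rightarrow> 'r) \<Rightarrow> ('n \<Rightarrow> 'n \<Rightarrow> 'n \<Rightarrow> 'r) \<Rightarrow> 'r \<Rightarrow> 'r \<Rightarrow> 'r" where
  "bk0 gg cc F G = dot (eul F) (D \<circ> QQ gg cc 0 (D \<circ> eul G))"

text \<open>For the density \<open>xx * z 0 j\<close> the covector \<open>D \<circ> eul G\<close> is
  constant, and skew-symmetry collapses to a pairing of \<open>D \<circ> eul F\<close> with a vector
  \<open>t\<close> linear in the first derivatives of u. Non-degeneracy gives
  \<open>D \<circ> t = 0\<close>, so every coefficient of \<open>t\<close> vanishes.\<close>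

lemma skew_imp_metric:
  assumes gg [simp]: "\<And>i j. gg i j \<in> AA" and cc [simp]: "\<And>i j k. cc i j k \<in> AA"
    and pd_gg: "\<And>m k i j. 0 < m \<Longrightarrow> pd m k (gg i j) = 0"
    and pd_cc: "\<And>m k i j l. 0 < m \<Longrightarrow> pd m k (cc i j l) = 0"
    and D_gg: "\<And>i j. D (gg i j) = (\<Sum>k\<in>UNIV. pd 0 k (gg i j) * z (Suc 0) k)"
    and skew: "\<And>F G. F \<in> AA \<Longrightarrow> G \<in> AA \<Longrightarrow> nul (bk0 gg cc F G + bk0 gg cc G F)"
  shows "pd 0 k (gg j i) = cc i j k + cc j i k"
proof -
  have QQ [simp]: "vct (QQ gg cc 0 a)" if "vct a" for a
    using that by (auto simp: QQ_def vct_def)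
  define b where "b = (\<lambda>i. if i = j then (1::'r) else 0)"
  have b [simp]: "vct b" by (auto simp: b_def vct_def)
  define G where "G = xx * z 0 j"
  have G: "G \<in> AA" by (simp add: G_def)
  have eG: "D \<circ> eul G = b"
    by (auto simp: G_def b_def fun_eq_iff eul_def euler_mult_const[of 0])
  define t where "t = (\<lambda>i. \<Sum>k\<in>UNIV. (cc i j k + cc j i k - pd 0 k (gg j i)) * z (Suc 0) k)"
  have t [simp]: "vct t" by (auto simp: t_def vct_def)
  have "nul (dot (eul F) (D \<circ> t))" if F: "F \<in> AA" for F
  proof -
    define a where "a = D \<circ> eul F"
    have a [simp]: "vct a" using F by (simp add: a_def)
    have 1: "nul (dot (eul F) (D \<circ> QQ gg cc 0 b) + dot a (QQ gg cc 0 b))"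
      unfolding a_def by (rule nul_dot_D) (use F in auto)
    have 2: "nul (dot (eul G) (D \<circ> QQ gg cc 0 a) + dot b (QQ gg cc 0 a))"
      unfolding eG[symmetric] by (rule nul_dot_D) (use G in auto)
    have 3: "nul (dot (eul F) (D \<circ> QQ gg cc 0 b) + dot (eul G) (D \<circ> QQ gg cc 0 a))"
      using skew[OF F G] by (simp only: bk0_def eG a_def)
    \<comment> \<open>Subtracting this exact term removes the derivatives of the test
      covector.\<close>
    have 4: "nul (D (\<Sum>i\<in>UNIV. gg j i * a i))" by (intro nul_D) auto
    have 5: "dot a (QQ gg cc 0 b) = (\<Sum>i\<in>UNIV. \<Sum>k\<in>UNIV. a i * (cc i j k * z (Suc 0) k))"
    proof -
      have "D (b l) = 0" for l by (simp add: b_def)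
      moreover have "(\<Sum>l\<in>UNIV. \<Sum>k\<in>UNIV. cc i l k * z (Suc 0) k * b l) = (\<Sum>k\<in>UNIV. cc i j k * z (Suc 0) k)" for i
        by (simp add: b_def sum_distrib_right[symmetric] sum_delta_mult)
      ultimately show ?thesis by (simp add: dot_def QQ_def sum_distrib_left)
    qed
    have 6: "dot b (QQ gg cc 0 a) = (\<Sum>i\<in>UNIV. gg j i * D (a i)) + (\<Sum>i\<in>UNIV. \<Sum>k\<in>UNIV. a i * (cc j i k * z (Suc 0) k))"
      by (simp add: dot_def b_def sum_delta_mult QQ_def mult_ac)
    have 7: "D (\<Sum>i\<in>UNIV. gg j i * a i) = (\<Sum>i\<in>UNIV. gg j i * D (a i)) + (\<Sum>i\<in>UNIV. \<Sum>k\<in>UNIV. a i * (pd 0 k (gg j i) * z (Suc 0) k))"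
      by (simp add: D_gg sum.distrib sum_distrib_left sum_distrib_right mult_ac)
    have "dot a t = dot a (QQ gg cc 0 b) + dot b (QQ gg cc 0 a) - D (\<Sum>i\<in>UNIV. gg j i * a i)"
      unfolding 5 6 7
      by (simp add: dot_def t_def algebra_simps sum.distrib sum_subtractf sum_distrib_left)
    moreover have "nul (dot a (QQ gg cc 0 b) + dot b (QQ gg cc 0 a))"
      using nul_diff[OF nul_add[OF 1 2] 3] by (simp add: algebra_simps)
    ultimately have "nul (dot a t)" using 4 nul_diff by metis
    then show ?thesis using nul_diff[OF nul_dot_D[of "eul F" t], of "dot (D \<circ> eul F) t"] F a_def by simp
  qed
  then have "(D \<circ> t) i = 0"
    using euler_nondegenerate[of "D \<circ> t" i] vec_D[OF t] by (simp only: dot_def eul_def)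
  then have "pd 1 k (t i) = 0" using D_eq_0_pd[of "t i"] by simp
  moreover have "pd 1 k (pd 0 l (gg j i)) = 0" for l using pd_commute[of "gg j i" 1 k 0 l] pd_gg by simp
  ultimately show ?thesis
    by (simp add: t_def pd_z pd_gg pd_cc sum_delta_mult if_distrib[of "\<lambda>x. _ * x"] cong: if_cong)
qed

end

context jets
begin

lemma R_in_imp_diff_fun: "R f \<in> AA \<Longrightarrow> diff_fun s U f"
  using AA_diff_fun diff_fun_cong R_apply by metis

lemma R_sum: "R (\<lambda>p. \<Sum>i\<in>I. f i p) = (\<Sum>i\<in>I. R (f i))"
  by (induction I rule: infinite_finite_induct) (auto simp: R_def fun_eq_iff)

lemma R_mult: "R (\<lambda>p. f p * g p) = R f * R g" and R_add: "R (\<lambda>p. f p + g p) = R f + R g"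
  by (auto simp: R_def fun_eq_iff)

lemma R_inner_op:
  "R (inner_op s g c w i) = QQ (\<lambda>i j. lift (\<lambda>u. g u $ i $ j)) (\<lambda>i j k. lift (\<lambda>u. c u $ i $ j $ k)) s (\<lambda>j. R (w j)) i"
proof -
  have "R (inner_op s g c w i) = R (\<lambda>p. (\<Sum>j\<in>UNIV. g (snd p s) $ i $ j * total_deriv (w j) p)
     + (\<Sum>j\<in>UNIV. \<Sum>k\<in>UNIV. c (snd p s) $ i $ j $ k * snd p (Suc s) $ k * w j p))"
    by (rule R_eq) (auto simp: inner_op_def)
  also have "\<dots> = QQ (\<lambda>i j. lift (\<lambda>u. g u $ i $ j)) (\<lambda>i j k. lift (\<lambda>u. c u $ i $ j $ k)) s (\<lambda>j. R (w j)) i"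
    by (simp only: R_sum R_mult R_add QQ_def lift_def zz_def DD_R)
  finally show ?thesis .
qed

lemma QQ_in: "(\<And>i j. gg i j \<in> AA) \<Longrightarrow> (\<And>i j k. cc i j k \<in> AA) \<Longrightarrow> vct b \<Longrightarrow> vct (QQ gg cc s' b)"
  by (auto simp: QQ_def vct_def)

end

section \<open>Transfer between concrete operators and the algebra\<close>

locale operator_jets = jets 0 U u0 for U :: "(real^'n::finite) set" and u0 +
  fixes g :: "real^'n \<Rightarrow> real^'n^'n" and c :: "real^'n \<Rightarrow> real^'n^'n^'n"
  assumes g: "\<And>i j. smooth_on U (\<lambda>u. g u $ i $ j)" and c: "\<And>i j k. smooth_on U (\<lambda>u. c u $ i $ j $ k)"
begin

abbreviation "gg \<equiv> (\<lambda>i j. lift (\<lambda>u. g u $ i $ j))"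
abbreviation "cc \<equiv> (\<lambda>i j k. lift (\<lambda>u. c u $ i $ j $ k))"

lemma R_bracket: assumes F: "diff_fun 0 U F" and G: "diff_fun 0 U G"
  shows "R (bracket g c F G) = bk0 gg cc (R F) (R G)" "diff_fun 0 U (bracket g c F G)"
proof -
  have "R (third_order_op g c (\<lambda>j. variational_deriv j G) i) = (DD \<circ> QQ gg cc 0 (DD \<circ> eul (R G))) i" for i
  proof -
    have 1: "(\<lambda>j. DD (R (variational_deriv j G))) = DD \<circ> eul (R G)"
      by (auto simp: fun_eq_iff eul_def euler_R[OF G])
    show ?thesis
      unfolding third_order_op_def DD_R[symmetric] R_inner_op 1 by simp
  qed
  then show 1: "R (bracket g c F G) = bk0 gg cc (R F) (R G)"
    unfolding bracket_def R_sum R_mult bk0_def dot_def eul_def by (simp add: euler_R[OF F] eul_def)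
  have "bk0 gg cc (R F) (R G) \<in> AA"
    unfolding bk0_def using g c F G by (intro dot_in eul_vec vec_D QQ_in lift_in R_in)
  then show "diff_fun 0 U (bracket g c F G)" using 1 R_in_imp_diff_fun by metis
qed

lemma hamiltonian_operator_iff:
  "third_order_hamiltonian_operator U g c \<longleftrightarrow>
     (\<forall>u\<in>U. transpose (g u) = g u \<and> det (g u) \<noteq> 0) \<and>
     (\<forall>F\<in>AA. \<forall>G\<in>AA. nul (bk0 gg cc F G + bk0 gg cc G F)) \<and>
     (\<forall>F\<in>AA. \<forall>G\<in>AA. \<forall>H\<in>AA. nul (bk0 gg cc (bk0 gg cc F G) H + bk0 gg cc (bk0 gg cc G H) F + bk0 gg cc (bk0 gg cc H F) G))"
proof -
  have n1: "null_functional U (\<lambda>p. bracket g c F G p + bracket g c G F p)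
      \<longleftrightarrow> nul (bk0 gg cc (R F) (R G) + bk0 gg cc (R G) (R F))" if "diff_fun 0 U F" "diff_fun 0 U G" for F G
    using that by (simp add: null_functional_iff[OF refl] R_add R_bracket)
  have n2: "null_functional U (\<lambda>p. bracket g c (bracket g c F G) H p + bracket g c (bracket g c G H) F p
        + bracket g c (bracket g c H F) G p)
      \<longleftrightarrow> nul (bk0 gg cc (bk0 gg cc (R F) (R G)) (R H) + bk0 gg cc (bk0 gg cc (R G) (R H)) (R F)
         + bk0 gg cc (bk0 gg cc (R H) (R F)) (R G))"
    if "diff_fun 0 U F" "diff_fun 0 U G" "diff_fun 0 U H" for F G H
    using that by (simp add: null_functional_iff[OF refl] R_add R_bracket)
  have q1: "(\<forall>F G. diff_fun 0 U F \<and> diff_fun 0 U G \<longrightarrow> P (R F) (R G)) \<longleftrightarrow> (\<forall>F\<in>AA. \<forall>G\<in>AA. P F G)" for P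
    using R_in AA_R AA_diff_fun by metis
  have q2: "(\<forall>F G H. diff_fun 0 U F \<and> diff_fun 0 U G \<and> diff_fun 0 U H \<longrightarrow> P (R F) (R G) (R H))
     \<longleftrightarrow> (\<forall>F\<in>AA. \<forall>G\<in>AA. \<forall>H\<in>AA. P F G H)" for P
  proof (intro iffI allI impI ballI)
    fix F G H assume a: "\<forall>F G H. diff_fun 0 U F \<and> diff_fun 0 U G \<and> diff_fun 0 U H \<longrightarrow> P (R F) (R G) (R H)"
      and "F \<in> AA" "G \<in> AA" "H \<in> AA"
    then show "P F G H" using a[rule_format, of F G H] by (simp add: AA_R AA_diff_fun)
  qed (simp add: R_in)
  show ?thesis
    unfolding third_order_hamiltonian_operator_def
      q1[of "\<lambda>F G. nul (bk0 gg cc F G + bk0 gg cc G F)", symmetric]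
      q2[of "\<lambda>F G H. nul (bk0 gg cc (bk0 gg cc F G) H + bk0 gg cc (bk0 gg cc G H) F + bk0 gg cc (bk0 gg cc H F) G)", symmetric]
    using g c n1 n2 by (simp cong: conj_cong)
qed

end

text \<open>The position \<open>s\<close> of u stays open: with 0 the coefficients define the
  operator on local functionals, with 1 they enter the evolution equation written in the
  potentials.\<close>

locale pencil = jets s U u0 for s and U :: "(real^'n::finite) set" and u0 +
  fixes gu gl :: "'n \<Rightarrow> 'n \<Rightarrow> real^'n \<Rightarrow> real" and Gam :: "'n \<Rightarrow> 'n \<Rightarrow> 'n \<Rightarrow> real^'n \<Rightarrow> real"
  assumes smooth_gu: "smooth_on U (gu i j)" and smooth_gl: "smooth_on U (gl i j)" and smooth_Gam: "smooth_on U (Gam p i k)"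
    and sym_gl: "u \<in> U \<Longrightarrow> gl i j u = gl j i u"
    and inv_gl: "u \<in> U \<Longrightarrow> (\<Sum>j\<in>UNIV. gl i j u * gu j k u) = (if i = k then 1 else 0)"
    and inv_gu: "u \<in> U \<Longrightarrow> (\<Sum>j\<in>UNIV. gu i j u * gl j k u) = (if i = k then 1 else 0)"
    and metric_gl: "u \<in> U \<Longrightarrow> partial_deriv k (gl i j) u
       = - (\<Sum>p\<in>UNIV. gl i p u * Gam p j k u) - (\<Sum>p\<in>UNIV. gl j p u * Gam p i k u)"
begin

lemma lift_eqI: "(\<And>u. u \<in> U \<Longrightarrow> F u = G u) \<Longrightarrow> lift F = lift G"
  by (simp add: lift_eq_iff)

lemma third_order_lift:
  "third_order AA DD pdd zz x1 s (\<lambda>i j. lift (gu i j)) (\<lambda>i j. lift (gl i j)) (\<lambda>p i k. lift (Gam p i k))"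
proof unfold_locales
  show "lift (gl i j) = lift (gl j i)" for i j by (rule lift_eqI) (rule sym_gl)
  show "(\<Sum>j\<in>UNIV. lift (gl i j) * lift (gu j k)) = (if i = k then 1 else 0)" for i k
    unfolding lift_ring(2)[symmetric] lift_sum[symmetric] lift_const(1)[symmetric] by (rule lift_eqI) (rule inv_gl)
  show "(\<Sum>j\<in>UNIV. lift (gu i j) * lift (gl j k)) = (if i = k then 1 else 0)" for i k
    unfolding lift_ring(2)[symmetric] lift_sum[symmetric] lift_const(1)[symmetric] by (rule lift_eqI) (rule inv_gu)
  show "pdd s k (lift (gl i j)) = - (\<Sum>p\<in>UNIV. lift (gl i p) * lift (Gam p j k)) - (\<Sum>p\<in>UNIV. lift (gl j p) * lift (Gam p i k))" for i j k
    unfolding pdd_lift[OF smooth_gl] lift_ring(2)[symmetric] lift_sum[symmetric] lift_ring(3)[symmetric] lift_ring(4)[symmetric]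
    by simp (rule lift_eqI, simp add: metric_gl)
qed (simp_all add: smooth_gu smooth_gl smooth_Gam lift_in pdd_lift DD_lift)

definition rskew :: bool where "rskew \<longleftrightarrow> (\<forall>u\<in>U. \<forall>p i k. Gam p i k u = - Gam p k i u)"
definition rcyclic :: bool where
  "rcyclic \<longleftrightarrow> (\<forall>u\<in>U. \<forall>i j k. (\<Sum>p\<in>UNIV. gl i p u * Gam p j k u) + (\<Sum>p\<in>UNIV. gl j p u * Gam p k i u)
     + (\<Sum>p\<in>UNIV. gl k p u * Gam p i j u) = 0)"
definition rparallel :: bool where
  "rparallel \<longleftrightarrow> (\<forall>u\<in>U. \<forall>p i k v. partial_deriv v (Gam p i k) u = (\<Sum>r\<in>UNIV. Gam r i k u * Gam p r v u))"

sublocale to: third_order AA DD pdd zz x1 s "\<lambda>i j. lift (gu i j)" "\<lambda>i j. lift (gl i j)" "\<lambda>p i k. lift (Gam p i k)"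
  by (rule third_order_lift)

lemma skew_iff: "to.skew \<longleftrightarrow> rskew"
  unfolding to.skew_def rskew_def lift_ring(3)[symmetric] lift_eq_iff by blast

lemma cyclic_iff: "to.cyclic \<longleftrightarrow> rcyclic"
proof -
  have *: "to.ip (to.ee i) (to.br (to.ee j) (to.ee k)) = (\<Sum>p\<in>UNIV. lift (gl i p) * lift (Gam p j k))" for i j k
    by (simp add: to.ip_ee to.flat_def to.br_ee_ee)
  show ?thesis
    unfolding to.cyclic_def rcyclic_def to.CC_def * lift_ring(2)[symmetric] lift_sum[symmetric] lift_ring(1)[symmetric]
      lift_const(2)[symmetric] lift_eq_iff by blast
qed

lemma parallel_iff: "to.parallel \<longleftrightarrow> rparallel"
  unfolding to.parallel_def rparallel_def pdd_lift[OF smooth_Gam] lift_ring(2)[symmetric] lift_sum[symmetric]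
  by (simp add: lift_eq_iff) blast

end


text \<open>Differentiate the cyclic identity in the direction q and rewrite derivatives of the
  bracket by parallelism; one of the two quadratic terms cancels against the metric rule.\<close>

lemma (in third_order) quadratic_relation: assumes cyclic parallel
  shows "ip (br (ee i) (ee q)) (br (ee j) (ee k)) + ip (br (ee j) (ee q)) (br (ee k) (ee i))
    + ip (br (ee k) (ee q)) (br (ee i) (ee j)) = 0"
proof -
  have par: "dbr v x y = br (br x y) v" for v x y
    using BB_zero[OF assms(2), of v x y] by (simp add: BB_def)
  have d: "pd s q (ip (ee i) (br (ee j) (ee k))) = - ip (br (ee i) (ee q)) (br (ee j) (ee k))" for i j k
    by (simp add: ip_der[OF cder_pd_s] br_der[OF cder_pd_s] der_ee[OF der_pd] par linear_simps ip_sym[of "br (ee j) (ee k)"])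
  have "pd s q (CC (ee i) (ee j) (ee k)) = 0" using CC_zero[OF assms(1)] by simp
  then have "- (ip (br (ee i) (ee q)) (br (ee j) (ee k)) + ip (br (ee j) (ee q)) (br (ee k) (ee i))
    + ip (br (ee k) (ee q)) (br (ee i) (ee j))) = 0"
    by (simp add: CC_def d)
  then show ?thesis by (simp only: neg_equal_0_iff_equal)
qed

locale pencil0 = pencil 0 U u0 gu gl Gam
  for U :: "(real^'n::finite) set" and u0 gu gl Gam
begin

sublocale tu: third_order_u AA DD pdd zz x1 "\<lambda>i j. lift (gu i j)" "\<lambda>i j. lift (gl i j)" "\<lambda>p i k. lift (Gam p i k)"
  by (intro third_order_u.intro third_order_lift)

lemma bk0_eq_bk: 
  assumes c: "\<And>u i j k. u \<in> U \<Longrightarrow> cu i j k u = (\<Sum>p\<in>UNIV. gu i p u * Gam j p k u)"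
    and G: "G \<in> AA"
  shows "bk0 (\<lambda>i j. lift (gu i j)) (\<lambda>i j k. lift (cu i j k)) F G = tu.bk F G"
proof -
  have cc: "lift (cu i j k) = (\<Sum>p\<in>UNIV. lift (gu i p) * lift (Gam j p k))" for i j k
    unfolding lift_ring(2)[symmetric] lift_sum[symmetric] by (rule lift_eqI) (rule c)
  have "QQ (\<lambda>i j. lift (gu i j)) (\<lambda>i j k. lift (cu i j k)) 0 b = to.QL b" if "vct b" for b
    unfolding QQ_def cc using to.QL_eq[OF that] by (intro ext) simp
  then show ?thesis using G by (simp add: bk0_def tu.bk_def tu.PP_def)
qed

text \<open>With the metric relation built into the locale, skew-symmetry of the bracket is
  automatic, and the Jacobi identity carries the three structure conditions.\<close>

lemma hamiltonian_operator_iff_structure: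
  assumes g: "\<And>u i j. u \<in> U \<Longrightarrow> g u $ i $ j = gu i j u" "\<And>i j. smooth_on U (\<lambda>u. g u $ i $ j)"
    and c: "\<And>u i j k. u \<in> U \<Longrightarrow> c u $ i $ j $ k = (\<Sum>p\<in>UNIV. gu i p u * Gam j p k u)"
      "\<And>i j k. smooth_on U (\<lambda>u. c u $ i $ j $ k)"
  shows "third_order_hamiltonian_operator U g c \<longleftrightarrow>
    (\<forall>u\<in>U. transpose (g u) = g u \<and> det (g u) \<noteq> 0) \<and> rskew \<and> rcyclic \<and> rparallel"
proof -
  interpret O: operator_jets U u0 g c by unfold_locales (rule g(2) c(2))+
  have gg: "lift (\<lambda>u. g u $ i $ j) = lift (gu i j)" for i j by (rule lift_eqI) (rule g(1))
  have bk: "bk0 O.gg O.cc F G = tu.bk F G" if "G \<in> AA" for F G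
    unfolding gg by (rule bk0_eq_bk[OF c(1) that])
  have bk_in: "tu.bk F G \<in> AA" if "F \<in> AA" "G \<in> AA" for F G using that by (simp add: tu.bk_def)
  have "(\<forall>F\<in>AA. \<forall>G\<in>AA. \<forall>H\<in>AA. nul (tu.bk (tu.bk F G) H + tu.bk (tu.bk G H) F + tu.bk (tu.bk H F) G))
     \<longleftrightarrow> rskew \<and> rcyclic \<and> rparallel"
  proof
    assume jac: "\<forall>F\<in>AA. \<forall>G\<in>AA. \<forall>H\<in>AA. nul (tu.bk (tu.bk F G) H + tu.bk (tu.bk G H) F + tu.bk (tu.bk H F) G)"
    have J: "nul (tu.Tt (to.sharp (DD \<circ> eul F)) (to.sharp (DD \<circ> eul G)) (to.sharp (DD \<circ> eul H)))"
      if "F \<in> AA" "G \<in> AA" "H \<in> AA" for F G H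
      using nul_diff[OF tu.bk_jacobi[OF that] jac[rule_format, OF that]] by simp
    show "rskew \<and> rcyclic \<and> rparallel"
      using tu.J_imp_skew[OF J] tu.J_imp_cyclic[OF J] tu.J_imp_parallel[OF J] skew_iff cyclic_iff parallel_iff by blast
  next
    assume "rskew \<and> rcyclic \<and> rparallel"
    then have st: "to.skew" "to.cyclic" "to.parallel" using skew_iff cyclic_iff parallel_iff by blast+
    show "\<forall>F\<in>AA. \<forall>G\<in>AA. \<forall>H\<in>AA. nul (tu.bk (tu.bk F G) H + tu.bk (tu.bk G H) F + tu.bk (tu.bk H F) G)"
    proof (intro ballI)
      fix F G H assume a: "F \<in> AA" "G \<in> AA" "H \<in> AA"
      have "nul (tu.Tt (to.sharp (DD \<circ> eul F)) (to.sharp (DD \<circ> eul G)) (to.sharp (DD \<circ> eul H)))"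
        by (rule tu.nul_Tt[OF st]) (use a in auto)
      from nul_diff[OF tu.bk_jacobi[OF a] this] show "nul (tu.bk (tu.bk F G) H + tu.bk (tu.bk G H) F + tu.bk (tu.bk H F) G)"
        by simp
    qed
  qed
  moreover have "\<forall>F\<in>AA. \<forall>G\<in>AA. nul (tu.bk F G + tu.bk G F)" using tu.bk_skew by blast
  ultimately show ?thesis
    unfolding O.hamiltonian_operator_iff by (simp add: bk bk_in)
qed

end

lemma hamiltonian_operator_metric:
  assumes op: "third_order_hamiltonian_operator U g c" and U: "open U" and u: "u \<in> U"
  shows "partial_deriv k (\<lambda>u. g u $ j $ i) u = c u $ i $ j $ k + c u $ j $ i $ k"
proof -
  have g: "smooth_on U (\<lambda>u. g u $ i $ j)" and c: "smooth_on U (\<lambda>u. c u $ i $ j $ k)" for i j k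
    using op by (auto simp: third_order_hamiltonian_operator_def)
  interpret O: operator_jets U u g c by unfold_locales (use U u g c in auto)
  have "O.pdd 0 k (O.gg j i) = O.cc i j k + O.cc j i k"
    by (rule O.skew_imp_metric)
      (use op[unfolded O.hamiltonian_operator_iff] in \<open>auto simp: O.lift_in g c O.pdd_lift O.DD_lift\<close>)
  then have "O.lift (partial_deriv k (\<lambda>u. g u $ j $ i)) = O.lift (\<lambda>u. c u $ i $ j $ k + c u $ j $ i $ k)"
    by (simp add: O.pdd_lift g O.lift_ring)
  then show ?thesis using u by (simp add: O.lift_eq_iff)
qed

text \<open>Lowering indices: the relation known for the derivatives of the contravariant metric is
  turned into the one for its inverse.\<close>

lemma pencil_of_metric:
  fixes g :: "real^'n::finite \<Rightarrow> real^'n^'n" and c :: "real^'n \<Rightarrow> real^'n^'n^'n"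
  assumes U: "open U" and u0: "u0 \<in> U"
    and g: "\<And>i j. smooth_on U (\<lambda>u. g u $ i $ j)" and c: "\<And>i j k. smooth_on U (\<lambda>u. c u $ i $ j $ k)"
    and sym: "\<And>u. u \<in> U \<Longrightarrow> transpose (g u) = g u" and det: "\<And>u. u \<in> U \<Longrightarrow> det (g u) \<noteq> 0"
    and metric: "\<And>u i j k. u \<in> U \<Longrightarrow> partial_deriv k (\<lambda>u. g u $ j $ i) u = c u $ i $ j $ k + c u $ j $ i $ k"
  defines "gl \<equiv> (\<lambda>i j u. matrix_inv (g u) $ i $ j)"
  defines "Gam \<equiv> (\<lambda>p i k u. \<Sum>m\<in>UNIV. gl i m u * c u $ m $ p $ k)"
  shows "pencil U u0 (\<lambda>i j u. g u $ i $ j) gl Gam"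
    and "u \<in> U \<Longrightarrow> c u $ i $ j $ k = (\<Sum>p\<in>UNIV. g u $ i $ p * Gam j p k u)"
proof -
  have inv: "g u ** matrix_inv (g u) = mat 1" "matrix_inv (g u) ** g u = mat 1" if "u \<in> U" for u
    using det[OF that] by (auto intro!: matrix_inv_inverse simp: invertible_det_nz)
  have gu_gl: "(\<Sum>j\<in>UNIV. g u $ i $ j * gl j k u) = (if i = k then 1 else 0)" if "u \<in> U" for u i k
    using inv(1)[OF that] by (simp add: vec_eq_iff matrix_matrix_mult_def mat_def gl_def)
  have gl_gu: "(\<Sum>j\<in>UNIV. gl i j u * g u $ j $ k) = (if i = k then 1 else 0)" if "u \<in> U" for u i k
    using inv(2)[OF that] by (simp add: vec_eq_iff matrix_matrix_mult_def mat_def gl_def)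
  have gl_sym: "gl i j u = gl j i u" if "u \<in> U" for u i j
  proof -
    have "transpose (matrix_inv (g u)) ** g u = mat 1"
      using arg_cong[OF inv(1)[OF that], of transpose] sym[OF that] by (simp add: matrix_transpose_mul)
    then have "transpose (matrix_inv (g u)) ** (g u ** matrix_inv (g u)) = matrix_inv (g u)"
      by (simp add: matrix_mul_assoc)
    then have "transpose (matrix_inv (g u)) = matrix_inv (g u)" by (simp add: inv(1)[OF that])
    then have "transpose (matrix_inv (g u)) $ i $ j = matrix_inv (g u) $ i $ j" by simp
    then show ?thesis by (simp add: gl_def transpose_def)
  qed
  have sgl: "smooth_on U (gl i j)" for i j
    unfolding gl_def by (rule smooth_on_matrix_inv[OF U g det])
  have sGam: "smooth_on U (Gam p i k)" for p i k
    unfolding Gam_def by (intro smooth_on_sum[OF U] smooth_on_mult[OF U] sgl c)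
  show "pencil U u0 (\<lambda>i j u. g u $ i $ j) gl Gam"
  proof
    fix u k i m assume u: "u \<in> U"
    define L where "L = (\<lambda>j. partial_deriv k (gl i j) u)"
    \<comment> \<open>The product rule on inverse times metric, which is constant; multiplying by
      the inverse once more isolates \<open>L\<close>.\<close>
    have 0: "(\<Sum>j\<in>UNIV. L j * g u $ j $ l) = - (\<Sum>j\<in>UNIV. gl i j u * (c u $ l $ j $ k + c u $ j $ l $ k))" for l
    proof -
      have "partial_deriv k (\<lambda>u. \<Sum>j\<in>UNIV. gl i j u * g u $ j $ l) u = partial_deriv k (\<lambda>u. if i = l then 1 else 0) u"
        by (rule partial_deriv_cong[OF U _ u]) (rule gl_gu)
      also have "\<dots> = 0" by (rule partial_deriv_const[OF U u])
      also have "partial_deriv k (\<lambda>u. \<Sum>j\<in>UNIV. gl i j u * g u $ j $ l) u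
         = (\<Sum>j\<in>UNIV. L j * g u $ j $ l + gl i j u * (c u $ l $ j $ k + c u $ j $ l $ k))"
        by (simp add: partial_deriv_sum[OF U smooth_on_mult[OF U sgl g] u] partial_deriv_mult[OF U sgl g u] L_def metric[OF u])
      finally show ?thesis by (simp add: sum.distrib eq_neg_iff_add_eq_0)
    qed
    have "L m = (\<Sum>j\<in>UNIV. L j * (\<Sum>l\<in>UNIV. g u $ j $ l * gl l m u))"
      by (simp add: gu_gl[OF u] sum_delta_mult)
    also have "\<dots> = (\<Sum>l\<in>UNIV. (\<Sum>j\<in>UNIV. L j * g u $ j $ l) * gl l m u)"
      unfolding sum_distrib_left sum_distrib_right by (subst sum.swap) (simp add: mult.assoc)
    also have "\<dots> = - (\<Sum>l\<in>UNIV. \<Sum>j\<in>UNIV. gl i j u * gl m l u * c u $ l $ j $ k)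
       - (\<Sum>l\<in>UNIV. \<Sum>j\<in>UNIV. gl m l u * gl i j u * c u $ j $ l $ k)"
      unfolding 0 by (simp add: gl_sym[OF u, of _ m] sum_distrib_left sum_distrib_right sum_negf algebra_simps sum.distrib sum_subtractf)
    also have "(\<Sum>l\<in>UNIV. \<Sum>j\<in>UNIV. gl i j u * gl m l u * c u $ l $ j $ k) = (\<Sum>p\<in>UNIV. gl i p u * Gam p m k u)"
      unfolding Gam_def sum_distrib_left by (subst sum.swap) (simp add: mult.assoc)
    also have "(\<Sum>l\<in>UNIV. \<Sum>j\<in>UNIV. gl m l u * gl i j u * c u $ j $ l $ k) = (\<Sum>p\<in>UNIV. gl m p u * Gam p i k u)"
      unfolding Gam_def sum_distrib_left by (simp add: mult.assoc)
    finally show "partial_deriv k (gl i m) u = - (\<Sum>p\<in>UNIV. gl i p u * Gam p m k u) - (\<Sum>p\<in>UNIV. gl m p u * Gam p i k u)"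
      by (simp add: L_def)
  qed (use U u0 g sgl sGam gl_sym gl_gu gu_gl in auto)
  show "c u $ i $ j $ k = (\<Sum>p\<in>UNIV. g u $ i $ p * Gam j p k u)" if u: "u \<in> U"
  proof -
    have "(\<Sum>p\<in>UNIV. g u $ i $ p * Gam j p k u) = (\<Sum>m\<in>UNIV. (\<Sum>p\<in>UNIV. g u $ i $ p * gl p m u) * c u $ m $ j $ k)"
      unfolding Gam_def sum_distrib_left sum_distrib_right by (subst sum.swap) (simp add: mult.assoc)
    then show ?thesis by (simp add: gu_gl[OF u] sum_delta_mult)
  qed
qed

section \<open>Velocity relations at a point\<close>

locale pencil1 = pencil "Suc 0" U u0 gu gl Gam
  for U :: "(real^'n::finite) set" and u0 gu gl Gam
begin

sublocale tb: third_order_b AA DD pdd zz x1 "\<lambda>i j. lift (gu i j)" "\<lambda>i j. lift (gl i j)" "\<lambda>p i k. lift (Gam p i k)"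
  by (intro third_order_b.intro third_order_lift)

text \<open>The relations involve the jet only through u, so a single jet over \<open>u0\<close>
  reads off all of their content at \<open>u0\<close>.\<close>

definition pt :: "'n jet" where "pt = (0, \<lambda>_. u0)"

lemma pt_in: "pt \<in> \<Omega>" and pt_s: "snd pt m = u0"
  using u0 by (auto simp: pt_def jets_over_def)

lemma sum_apply: "(\<Sum>i\<in>I. f i) p = (\<Sum>i\<in>I. f i p)" for f :: "'a \<Rightarrow> 'n jet \<Rightarrow> real"
  by (induction I rule: infinite_finite_induct) auto

lemma ip_pt: "to.ip x y pt = (\<Sum>i\<in>UNIV. \<Sum>j\<in>UNIV. gl i j u0 * x i pt * y j pt)"
  and br_pt: "to.br x y p pt = (\<Sum>i\<in>UNIV. \<Sum>k\<in>UNIV. Gam p i k u0 * x i pt * y k pt)"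
  and ee_pt: "to.ee i j pt = (if j = i then 1 else 0)"
  by (auto simp: to.ip_def to.br_def to.ee_def sum_apply lift_apply[OF pt_in] pt_s)

lemma velocity_relations_real:
  assumes str: rskew rcyclic rparallel
    and V: "\<And>i. smooth_on U (\<lambda>u. V u $ i)"
    and g: "\<And>u i j. u \<in> U \<Longrightarrow> g u $ i $ j = gu i j u" 
    and c: "\<And>u i j k. u \<in> U \<Longrightarrow> c u $ i $ j $ k = (\<Sum>p\<in>UNIV. gu i p u * Gam j p k u)"
    and ham: "hamiltonian_wrt U V g c"
  defines "J \<equiv> (\<lambda>l p. partial_deriv l (\<lambda>u. V u $ p) u0)"
    and "e \<equiv> (\<lambda>i p. if p = i then 1 else (0::real))"
    and "rip \<equiv> (\<lambda>x y. \<Sum>i\<in>UNIV. \<Sum>j\<in>UNIV. gl i j u0 * x i * y j)"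
    and "rbr \<equiv> (\<lambda>x y p. \<Sum>i\<in>UNIV. \<Sum>k\<in>UNIV. Gam p i k u0 * x i * y k)"
  shows "rip (e i) (J l) = rip (e l) (J i)"
    and "partial_deriv r (partial_deriv l (\<lambda>u. V u $ p)) u0 = rbr (J r) (e l) p + rbr (J l) (e r) p"
    and "rip (J j) (rbr (e k) (e i)) + rip (J i) (rbr (e j) (e k)) + rip (J k) (rbr (e i) (e j)) = 0"
    and "rip (rbr (e i) (e l)) (rbr (e j) (e k)) + rip (rbr (e j) (e l)) (rbr (e k) (e i))
       + rip (rbr (e k) (e l)) (rbr (e i) (e j)) = 0"
proof -
  have st: "to.skew" "to.cyclic" "to.parallel" using str skew_iff cyclic_iff parallel_iff by blast+
  obtain h where h: "diff_fun 1 U h"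
    and eq: "\<And>p i. p \<in> jets_over 1 U \<Longrightarrow> total_deriv (\<lambda>(x, z). V (z 1) $ i) p
           = total_deriv (inner_op 1 g c (\<lambda>j q. - variational_deriv j h q) i) p"
    using ham by (auto simp: hamiltonian_wrt_def)
  have h': "diff_fun (Suc 0) U h" using h by simp
  define H where "H = R h"
  have H: "H \<in> AA" unfolding H_def by (rule R_in[OF h'])
  define W where "W = to.Q (to.sharp (- eul H))"
  have W [simp]: "vct W" using H by (simp add: W_def)
  have DV: "DD (lift (\<lambda>u. V u $ i)) = DD (W i)" for i
  proof -
    have "DD (lift (\<lambda>u. V u $ i)) = R (total_deriv (\<lambda>(x, z). V (z 1) $ i))"
      by (simp add: lift_def DD_R case_prod_unfold)
    also have "\<dots> = R (total_deriv (inner_op (Suc 0) g c (\<lambda>j q. - variational_deriv j h q) i))"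
      by (rule R_eq) (use eq in simp)
    also have "\<dots> = DD (QQ (\<lambda>i j. lift (\<lambda>u. g u $ i $ j)) (\<lambda>i j k. lift (\<lambda>u. c u $ i $ j $ k)) (Suc 0)
         (\<lambda>j. R (\<lambda>q. - variational_deriv j h q)) i)"
      unfolding DD_R[symmetric] R_inner_op ..
    also have 1: "(\<lambda>j. R (\<lambda>q. - variational_deriv j h q)) = - eul H"
    proof
      fix j
      have "R (\<lambda>q. - variational_deriv j h q) = - R (variational_deriv j h)" by (simp add: R_def fun_eq_iff)
      then show "R (\<lambda>q. - variational_deriv j h q) = (- eul H) j"
        by (simp add: eul_def H_def euler_R[OF h'])
    qed
    finally have 2: "DD (lift (\<lambda>u. V u $ i)) = DD (QQ (\<lambda>i j. lift (\<lambda>u. g u $ i $ j))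
        (\<lambda>i j k. lift (\<lambda>u. c u $ i $ j $ k)) (Suc 0) (- eul H) i)" .
    have 3: "QQ (\<lambda>i j. lift (\<lambda>u. g u $ i $ j)) (\<lambda>i j k. lift (\<lambda>u. c u $ i $ j $ k)) (Suc 0) (- eul H) i = W i"
    proof -
      have gg: "lift (\<lambda>u. g u $ i $ j) = lift (gu i j)" for i j by (rule lift_eqI) (rule g)
      have cc: "lift (\<lambda>u. c u $ i $ j $ k) = (\<Sum>p\<in>UNIV. lift (gu i p) * lift (Gam j p k))" for i j k
        unfolding lift_ring(2)[symmetric] lift_sum[symmetric] by (rule lift_eqI) (rule c)
      have "vct (- eul H)" using H by simp
      from to.QL_eq[OF this, of i] show ?thesis
        unfolding QQ_def gg cc W_def to.QL_def by simp
    qed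
    show ?thesis unfolding 2 3 ..
  qed
  \<comment> \<open>The Hamiltonian equation gives equality only after applying the total
    derivative. The difference of velocity and \<open>W\<close> lies in the kernel of
    \<open>DD\<close>, hence has no jet derivatives, and only these are used.\<close>
  have pW: "pdd m j (W i) = pdd m j (lift (\<lambda>u. V u $ i))" for m j i
    using D_eq_0_pd[of "lift (\<lambda>u. V u $ i) - W i" m j] DV[of i] V by (simp add: lift_in)
  have W0: "pdd m j (W i) = 0" if "m \<noteq> Suc 0" for m j i using that by (simp add: pW pdd_lift V)
  have Jpt: "(pdd (Suc 0) l \<circ> W) p pt = J l p" for l p
    by (simp add: pW pdd_lift V lift_apply[OF pt_in] pt_s J_def)
  have Jpt2: "(pdd (Suc 0) r \<circ> (pdd (Suc 0) l \<circ> W)) p pt = partial_deriv r (partial_deriv l (\<lambda>u. V u $ p)) u0" for r l p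
    by (simp add: pW pdd_lift V smooth_on_partial_deriv lift_apply[OF pt_in] pt_s)
  have vr1: "to.ip (to.ee i) (pdd (Suc 0) l \<circ> W) = to.ip (to.ee l) (pdd (Suc 0) i \<circ> W)" for i l
    by (rule tb.velocity_relations(1)[OF st H W_def]) (rule W0)
  have vr2: "pdd (Suc 0) r \<circ> (pdd (Suc 0) l \<circ> W)
      = to.br (pdd (Suc 0) r \<circ> W) (to.ee l) + to.br (pdd (Suc 0) l \<circ> W) (to.ee r)" for r l
    by (rule tb.velocity_relations(2)[OF st H W_def]) (rule W0)
  have vr3: "to.ip (pdd (Suc 0) j \<circ> W) (to.br (to.ee k) (to.ee i))
      + to.ip (pdd (Suc 0) i \<circ> W) (to.br (to.ee j) (to.ee k))
      + to.ip (pdd (Suc 0) k \<circ> W) (to.br (to.ee i) (to.ee j)) = 0" for i j k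
    by (rule tb.velocity_relations(3)[OF st H W_def]) (rule W0)
  have ev: "to.ip x y pt = rip (\<lambda>i. x i pt) (\<lambda>i. y i pt)" "(\<lambda>p. to.br x y p pt) = rbr (\<lambda>i. x i pt) (\<lambda>i. y i pt)"
     "(\<lambda>p. to.ee i p pt) = e i" for x y i
    by (auto simp: ip_pt br_pt ee_pt rip_def rbr_def e_def)
  have Jv: "(\<lambda>p. (pdd (Suc 0) l \<circ> W) p pt) = J l" for l using Jpt by auto
  show "rip (e i) (J l) = rip (e l) (J i)"
    using fun_cong[OF vr1[of i l], of pt] by (simp only: ev Jv)
  show "partial_deriv r (partial_deriv l (\<lambda>u. V u $ p)) u0 = rbr (J r) (e l) p + rbr (J l) (e r) p"
    using fun_cong[OF fun_cong[OF vr2[of r l], of p], of pt] unfolding Jpt2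
    by (simp only: plus_fun_apply fun_cong[OF ev(2)] ev(3) Jv)
  show "rip (J j) (rbr (e k) (e i)) + rip (J i) (rbr (e j) (e k)) + rip (J k) (rbr (e i) (e j)) = 0"
    using fun_cong[OF vr3[of j k i], of pt] by (simp only: plus_fun_apply zero_fun_apply ev Jv)
  show "rip (rbr (e i) (e l)) (rbr (e j) (e k)) + rip (rbr (e j) (e l)) (rbr (e k) (e i))
       + rip (rbr (e k) (e l)) (rbr (e i) (e j)) = 0"
    using fun_cong[OF to.quadratic_relation[OF st(2,3), of i l j k], of pt]
    by (simp only: plus_fun_apply zero_fun_apply ev)
qed

end


section \<open>Linear congruences\<close>

lemma linear_zero_axis:
  fixes f :: "real^'n \<Rightarrow> 'b::real_vector"
  assumes f: "linear f" and z: "\<And>i. f (axis i 1) = 0" shows "f x = 0"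
proof -
  have "x = (\<Sum>i\<in>UNIV. x $ i *\<^sub>R axis i 1)"
    using basis_expansion[of x] by (simp add: scalar_mult_eq_scaleR)
  then have "f x = (\<Sum>i\<in>UNIV. x $ i *\<^sub>R f (axis i 1))"
    using linear_sum[OF f] linear_scale[OF f] by (metis (no_types, lifting) sum.cong)
  then show ?thesis by (simp add: z)
qed

lemma eigenvectors_independent:
  fixes A :: "real^'n^'n" and r :: "real \<Rightarrow> real^'n"
  assumes "finite S" "\<And>l. l \<in> S \<Longrightarrow> r l \<noteq> 0 \<and> A *v r l = l *\<^sub>R r l"
    "(\<Sum>l\<in>S. c l *\<^sub>R r l) = 0" "l \<in> S"
  shows "c l = 0"
  using assms
proof (induction S arbitrary: c l rule: finite_induct)
  case (insert m S)
  have "A *v (c l *\<^sub>R r l) = (c l * l) *\<^sub>R r l" if "l \<in> insert m S" for l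
  proof -
    have "A *v (c l *\<^sub>R r l) = c l *\<^sub>R (A *v r l)" by (rule linear_scale[OF matrix_vector_mul_linear])
    then show ?thesis using insert.prems(1)[OF that] by (metis scaleR_scaleR)
  qed
  then have "A *v (\<Sum>l\<in>insert m S. c l *\<^sub>R r l) = (\<Sum>l\<in>insert m S. (c l * l) *\<^sub>R r l)"
    unfolding linear_sum[OF matrix_vector_mul_linear] by (intro sum.cong refl)
  then have "(\<Sum>l\<in>insert m S. (c l * l) *\<^sub>R r l) - m *\<^sub>R (\<Sum>l\<in>insert m S. c l *\<^sub>R r l) = 0"
    using insert.prems(2) by simp
  then have "(\<Sum>l\<in>S. (c l * (l - m)) *\<^sub>R r l) = 0"
    using insert.hyps by (simp add: scaleR_right.sum algebra_simps sum_subtractf scaleR_diff_left scaleR_diff_right)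
  then have "c l * (l - m) = 0" if "l \<in> S" for l
    using insert.IH[of "\<lambda>l. c l * (l - m)" l] insert.prems(1) that by blast
  then have z: "c l = 0" if "l \<in> S" for l using that insert.hyps(2) by fastforce
  then have "c m *\<^sub>R r m = 0" using insert.prems(2) insert.hyps by simp
  then show ?case using z insert.prems(1,3) by auto
qed simp

text \<open>On eigenvectors for l and m the relation becomes
  \<open>(m - l) * d (r l) (r m) = 0\<close>, while the diagonal values vanish by skewness.
  Simplicity of the spectrum makes the eigenvectors a basis.\<close>

lemma simple_spectrum_skew_zero:
  fixes A :: "real^'n^'n" and d :: "real^'n \<Rightarrow> real^'n \<Rightarrow> real"
  assumes card: "card {l::real. \<exists>r. r \<noteq> 0 \<and> A *v r = l *\<^sub>R r} = CARD('n)"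
    and bil: "\<And>x. linear (d x)" "\<And>y. linear (\<lambda>x. d x y)" and skew: "\<And>x y. d x y = - d y x"
    and rel: "\<And>x y. d x (A *v y) + d y (A *v x) = 0"
  shows "d x y = 0"
proof -
  define S where "S = {l::real. \<exists>r. r \<noteq> 0 \<and> A *v r = l *\<^sub>R r}"
  have "card S \<noteq> 0" using card zero_less_card_finite[where 'a='n] by (simp add: S_def)
  then have fin: "finite S" by (rule card_ge_0_finite[OF neq0_conv[THEN iffD1]])
  have "\<forall>l\<in>S. \<exists>r. r \<noteq> 0 \<and> A *v r = l *\<^sub>R r" unfolding S_def by blast
  from bchoice[OF this] obtain r where r: "\<And>l. l \<in> S \<Longrightarrow> r l \<noteq> 0 \<and> A *v r l = l *\<^sub>R r l" by blast
  have inj: "inj_on r S"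
  proof (rule inj_onI)
    fix l m assume lm: "l \<in> S" "m \<in> S" "r l = r m"
    then have "l *\<^sub>R r l = m *\<^sub>R r l" using r by metis
    then show "l = m" using r[OF lm(1)] by simp
  qed
  have ind: "independent (r ` S)"
  proof
    assume dep: "dependent (r ` S)"
    then obtain c where c: "(\<Sum>v\<in>r ` S. c v *\<^sub>R v) = 0" "\<exists>v\<in>r ` S. c v \<noteq> 0"
      using dep[unfolded dependent_finite[OF finite_imageI[OF fin]]] by blast
    have z: "(\<Sum>l\<in>S. c (r l) *\<^sub>R r l) = 0" using c(1) by (simp add: sum.reindex[OF inj])
    have "c (r l) = 0" if "l \<in> S" for l
      by (rule eigenvectors_independent[where S=S and A=A and c="\<lambda>l. c (r l)", OF fin r z that])
    with c(2) show False by blast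
  qed
  have "card (r ` S) = DIM(real^'n)" using card card_image[OF inj] by (simp add: S_def[symmetric])
  then have sp: "span (r ` S) = UNIV"
    using card_ge_dim_independent[of "r ` S" UNIV] ind by (simp add: dim_UNIV top.extremum_unique)
  have e: "d (r l) (r m) = 0" if "l \<in> S" "m \<in> S" for l m
  proof (cases "l = m")
    case True then show ?thesis using skew[of "r l" "r l"] by simp
  next
    case False
    have "d (r l) (m *\<^sub>R r m) + d (r m) (l *\<^sub>R r l) = 0" using rel[of "r l" "r m"] r that by simp
    then have "m * d (r l) (r m) + l * d (r m) (r l) = 0" by (simp add: linear_scale[OF bil(1)])
    then have "(m - l) * d (r l) (r m) = 0" using skew[of "r m" "r l"] by (simp add: algebra_simps)
    then show ?thesis using False by simp
  qed
  have "d (r l) y = 0" if "l \<in> S" for l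
    using linear_eq_0_on_span[OF bil(1), of "r ` S" "r l" y] e that sp by auto
  then show ?thesis using linear_eq_0_on_span[OF bil(2), of "r ` S" y x] sp by auto
qed

text \<open>The shape of \<open>\<phi> A \<and> A\<close> for vectors \<open>x + \<lambda> p + \<mu> q\<close> once \<open>A\<close> is expressed through the
  bracket \<open>br\<close>, the metric \<open>ip\<close> and the velocity matrix \<open>J\<close>.\<close>

locale frame_algebra =
  fixes ip :: "real^'n \<Rightarrow> real^'n \<Rightarrow> real" and br :: "real^'n \<Rightarrow> real^'n \<Rightarrow> real^'n" and J :: "real^'n \<Rightarrow> real^'n"
  assumes bil_ip: "bilinear ip" and bil_br: "bilinear br" and lin_J: "linear J"
    and sym_ip: "ip x y = ip y x" and skew_br: "br x y = - br y x"
    and cyc: "ip x (br y w) + ip y (br w x) + ip w (br x y) = 0"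
    and symJ: "ip x (J y) = ip y (J x)"
    and cycJ: "ip (J x) (br y w) + ip (J y) (br w x) + ip (J w) (br x y) = 0"
    and quad: "ip (br x v) (br y w) + ip (br y v) (br w x) + ip (br w v) (br x y) = 0"
begin

lemmas bl = bilinear_ladd[OF bil_ip] bilinear_radd[OF bil_ip] bilinear_lsub[OF bil_ip] bilinear_rsub[OF bil_ip]
  bilinear_lmul[OF bil_ip] bilinear_rmul[OF bil_ip] bilinear_lneg[OF bil_ip] bilinear_rneg[OF bil_ip]

definition BV :: "real^'n \<Rightarrow> real \<Rightarrow> real \<Rightarrow> real^'n \<Rightarrow> real \<Rightarrow> real \<Rightarrow> real^'n" where
  "BV x a m x' a' m' = br x x' + a *\<^sub>R x' - a' *\<^sub>R x + m *\<^sub>R J x' - m' *\<^sub>R J x"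

text \<open>Brackets are oriented with increasing indices, and each pairing of the vector of largest
  index with a bracket is eliminated by \<open>cyc\<close> or \<open>cycJ\<close>. In this normal
  form everything cancels except the purely quadratic terms, which are \<open>quad\<close>.\<close>

lemma pfaffian_zero:
  "ip (BV x1 a1 m1 x2 a2 m2) (BV x3 a3 m3 x4 a4 m4) - ip (BV x1 a1 m1 x3 a3 m3) (BV x2 a2 m2 x4 a4 m4)
   + ip (BV x1 a1 m1 x4 a4 m4) (BV x2 a2 m2 x3 a3 m3) = 0"
proof -
  have b: "br x2 x1 = - br x1 x2" "br x3 x1 = - br x1 x3" "br x4 x1 = - br x1 x4"
    "br x3 x2 = - br x2 x3" "br x4 x2 = - br x2 x4" "br x4 x3 = - br x3 x4" by (rule skew_br)+
  have c: "ip x3 (br x1 x2) = - ip x1 (br x2 x3) + ip x2 (br x1 x3)"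
    "ip x4 (br x1 x2) = - ip x1 (br x2 x4) + ip x2 (br x1 x4)"
    "ip x4 (br x1 x3) = - ip x1 (br x3 x4) + ip x3 (br x1 x4)"
    "ip x4 (br x2 x3) = - ip x2 (br x3 x4) + ip x3 (br x2 x4)"
    using cyc[of x1 x2 x3] cyc[of x1 x2 x4] cyc[of x1 x3 x4] cyc[of x2 x3 x4] by (simp_all add: b bl)
  have cJ: "ip (J x3) (br x1 x2) = - ip (J x1) (br x2 x3) + ip (J x2) (br x1 x3)"
    "ip (J x4) (br x1 x2) = - ip (J x1) (br x2 x4) + ip (J x2) (br x1 x4)"
    "ip (J x4) (br x1 x3) = - ip (J x1) (br x3 x4) + ip (J x3) (br x1 x4)"
    "ip (J x4) (br x2 x3) = - ip (J x2) (br x3 x4) + ip (J x3) (br x2 x4)"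
    using cycJ[of x1 x2 x3] cycJ[of x1 x2 x4] cycJ[of x1 x3 x4] cycJ[of x2 x3 x4] by (simp_all add: b bl)
  have s: "ip x2 (J x1) = ip x1 (J x2)" "ip x3 (J x1) = ip x1 (J x3)" "ip x4 (J x1) = ip x1 (J x4)"
    "ip x3 (J x2) = ip x2 (J x3)" "ip x4 (J x2) = ip x2 (J x4)" "ip x4 (J x3) = ip x3 (J x4)" by (rule symJ)+
  have q: "ip (br x1 x2) (br x3 x4) - ip (br x1 x3) (br x2 x4) + ip (br x1 x4) (br x2 x3) = 0"
    using quad[of x1 x4 x2 x3] by (simp add: b bl sym_ip[of "br x2 x4" "br x1 x3"] sym_ip[of "br x3 x4" "br x1 x2"])
  have o: "ip (br x2 x4) (br x1 x3) = ip (br x1 x3) (br x2 x4)" "ip x2 x1 = ip x1 x2" "ip x3 x1 = ip x1 x3" "ip x4 x1 = ip x1 x4"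
    "ip x3 x2 = ip x2 x3" "ip x4 x2 = ip x2 x4" "ip x4 x3 = ip x3 x4"
    "ip (J x2) (J x1) = ip (J x1) (J x2)" "ip (J x3) (J x1) = ip (J x1) (J x3)" "ip (J x4) (J x1) = ip (J x1) (J x4)"
    "ip (J x3) (J x2) = ip (J x2) (J x3)" "ip (J x4) (J x2) = ip (J x2) (J x4)" "ip (J x4) (J x3) = ip (J x3) (J x4)"
    by (rule sym_ip)+
  have ib: "ip (br y w) x1 = ip x1 (br y w)" "ip (br y w) x2 = ip x2 (br y w)" "ip (br y w) x3 = ip x3 (br y w)"
    "ip (br y w) x4 = ip x4 (br y w)" "ip (br y w) (J x1) = ip (J x1) (br y w)" "ip (br y w) (J x2) = ip (J x2) (br y w)"
    "ip (br y w) (J x3) = ip (J x3) (br y w)" "ip (br y w) (J x4) = ip (J x4) (br y w)" for y w by (rule sym_ip)+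
  have ij: "ip (J y) x1 = ip x1 (J y)" "ip (J y) x2 = ip x2 (J y)" "ip (J y) x3 = ip x3 (J y)" "ip (J y) x4 = ip x4 (J y)" for y
    by (rule sym_ip)+
  have "ip (BV x1 a1 m1 x2 a2 m2) (BV x3 a3 m3 x4 a4 m4) - ip (BV x1 a1 m1 x3 a3 m3) (BV x2 a2 m2 x4 a4 m4)
   + ip (BV x1 a1 m1 x4 a4 m4) (BV x2 a2 m2 x3 a3 m3)
    = ip (br x1 x2) (br x3 x4) - ip (br x1 x3) (br x2 x4) + ip (br x1 x4) (br x2 x3)"
    unfolding BV_def by (simp add: bl ib ij) (simp add: o c cJ s algebra_simps)
  then show ?thesis using q by simp
qed

end


definition em :: "real^'n \<Rightarrow> 'n::finite hvec" where "em x = (x, 0, 0)"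

lemma em_linear: "em (x + y) = em x + em y" "em (c *\<^sub>R x) = c *\<^sub>R em x"
  by (simp_all add: em_def)

section \<open>The vector-valued form of a congruence and its derivatives\<close>

locale congruence =
  fixes U :: "(real^'n::finite) set" and V :: "real^'n \<Rightarrow> real^'n" and \<A> :: "'n bilin set" and A :: "'n \<Rightarrow> 'n bilin"
  assumes open_U: "open U" and smooth_V: "\<And>i. smooth_on U (\<lambda>u. V u $ i)"
    and lc: "linear_congruence U V \<A>" and span_A: "span (range A) = \<A>"
begin

definition Av :: "'n hvec \<Rightarrow> 'n hvec \<Rightarrow> real^'n" where "Av w w' = (\<chi> \<gamma>. ev2 (A \<gamma>) w w')"
definition p1 :: "'n hvec" where "p1 = (0, 1, 0)"
definition fv :: "'n hvec" where "fv = (0, 0, 1)"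
definition M :: "real^'n \<Rightarrow> real^'n \<Rightarrow> real^'n" where "M u x = Av (line_p u) (em x)"
definition aa :: "real^'n \<Rightarrow> real^'n \<Rightarrow> real^'n" where "aa x y = Av (em x) (em y)"

lemma bil_Av: "bilinear Av"
  unfolding bilinear_def
  by (intro conjI allI linearI) (simp_all add: Av_def vec_eq_iff blinfun.add_left blinfun.add_right
      blinfun.scaleR_left blinfun.scaleR_right)

lemmas Av_simps = bilinear_ladd[OF bil_Av] bilinear_radd[OF bil_Av] bilinear_lsub[OF bil_Av] bilinear_rsub[OF bil_Av]
  bilinear_lmul[OF bil_Av] bilinear_rmul[OF bil_Av] bilinear_lneg[OF bil_Av] bilinear_rneg[OF bil_Av]

lemma Av_skew: "Av w w' = - Av w' w"
proof -
  have "A \<gamma> \<in> two_forms" for \<gamma>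
    using lc span_A span_superset[of "range A"] by (auto simp: linear_congruence_def)
  then have "ev2 (A \<gamma>) w w' = - ev2 (A \<gamma>) w' w" for \<gamma> unfolding two_forms_def by blast
  then show ?thesis by (simp add: Av_def vec_eq_iff)
qed

lemma line_p_eq: "line_p u = em u + p1" and line_q_eq: "line_q v = em v + fv"
  by (simp_all add: line_p_def line_q_def em_def p1_def fv_def)

lemma M_eq: "M u x = aa u x + Av p1 (em x)"
  by (simp add: M_def aa_def line_p_eq Av_simps)

lemma bil_aa: "bilinear aa"
  unfolding bilinear_def by (intro conjI allI linearI) (simp_all add: aa_def em_linear Av_simps)

lemma lin_M: "linear (M u)"
  by (intro linearI) (simp_all add: M_def em_linear Av_simps)

lemma Av_zero: "u \<in> U \<Longrightarrow> Av (line_p u) (line_q (V u)) = 0"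
  using lc span_A span_superset[of "range A"] by (auto simp: linear_congruence_def Av_def vec_eq_iff)

lemma M_V: "u \<in> U \<Longrightarrow> M u (V u) = - Av (line_p u) fv"
  using Av_zero[of u] by (simp add: M_def line_q_eq Av_simps eq_neg_iff_add_eq_0)

text \<open>A kernel vector x would make \<open>V u + x\<close> a second solution of the defining
  equations. The equations pass from the basis to all of \<open>\<A>\<close> by linearity.\<close>

lemma M_inj: assumes u: "u \<in> U" and x: "M u x = 0" shows "x = 0"
proof -
  have 0: "Av (line_p u) (line_q (V u + x)) = 0"
    using Av_zero[OF u] x by (simp add: M_def line_q_eq Av_simps em_linear algebra_simps)
  have "ev2 B (line_p u) (line_q (V u + x)) = 0" if "B \<in> span (range A)" for B
    using that
  proof (induction rule: span_induct_alt)
    case (step c B B')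
    then show ?case using 0 by (auto simp: Av_def vec_eq_iff blinfun.add_left blinfun.scaleR_left)
  qed simp
  then have "V u + x = V u" using lc u span_A unfolding linear_congruence_def by blast
  then show ?thesis by simp
qed

definition Mm :: "real^'n \<Rightarrow> real^'n^'n" where "Mm u = matrix (M u)"

lemma Mm: "Mm u *v x = M u x" unfolding Mm_def by (rule matrix_works[OF lin_M[folded linear_matrix_vector_mul_eq]])

lemma Mm_nth: "Mm u $ \<gamma> $ i = M u (axis i 1) $ \<gamma>" by (simp add: Mm_def matrix_def)

lemma Mm_invertible: assumes "u \<in> U" shows "invertible (Mm u)"
proof -
  have "\<forall>x. Mm u *v x = 0 \<longrightarrow> x = 0" using M_inj[OF assms] by (simp add: Mm)
  then show ?thesis unfolding invertible_left_inverse matrix_left_invertible_ker .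
qed

lemma has_pd_sum: "(\<And>j. j \<in> I \<Longrightarrow> has_pd U i (f j) (f' j)) \<Longrightarrow> has_pd U i (\<lambda>u. \<Sum>j\<in>I. f j u) (\<lambda>u. \<Sum>j\<in>I. f' j u)"
proof (induction I rule: infinite_finite_induct)
  case (insert j I)
  then show ?case using has_pd_add[OF open_U, of i "f j" "f' j" "\<lambda>u. \<Sum>j\<in>I. f j u"] by simp
qed (auto simp: has_pd_const[OF open_U])

lemma has_pd_M: "has_pd U l (\<lambda>u. M u x $ \<gamma>) (\<lambda>u. aa (axis l 1) x $ \<gamma>)"
proof -
  have e: "M (u + t *\<^sub>R axis l 1) x $ \<gamma> = M u x $ \<gamma> + t * aa (axis l 1) x $ \<gamma>" for u t
    by (simp add: M_eq bilinear_ladd[OF bil_aa] bilinear_lmul[OF bil_aa])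
  show ?thesis unfolding has_pd_def[OF open_U] e by (auto intro!: derivative_eq_intros)
qed

lemma has_pd_Af: "has_pd U l (\<lambda>u. Av (line_p u) fv $ \<gamma>) (\<lambda>u. Av (em (axis l 1)) fv $ \<gamma>)"
proof -
  have e: "Av (line_p (u + t *\<^sub>R axis l 1)) fv $ \<gamma> = Av (line_p u) fv $ \<gamma> + t * Av (em (axis l 1)) fv $ \<gamma>" for u t
    by (simp add: line_p_eq em_linear Av_simps)
  show ?thesis unfolding has_pd_def[OF open_U] e by (auto intro!: derivative_eq_intros)
qed

lemma has_pd_zero: assumes "has_pd U l f f'" "\<And>u. u \<in> U \<Longrightarrow> f u = 0" "u \<in> U" shows "f' u = 0"
proof -
  have "f' u = partial_deriv l f u" using has_pd_eq[OF open_U assms(1,3)] by simp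
  also have "\<dots> = partial_deriv l (\<lambda>_. 0) u"
    by (rule partial_deriv_cong[OF open_U _ assms(3)]) (rule assms(2))
  also have "\<dots> = 0" by (rule partial_deriv_const[OF open_U assms(3)])
  finally show ?thesis .
qed

definition J :: "real^'n \<Rightarrow> real^'n \<Rightarrow> real^'n" where "J u x = jacobian_matrix V u *v x"

lemma J_axis: "J u (axis l 1) $ p = partial_deriv l (\<lambda>u. V u $ p) u"
  by (simp add: J_def jacobian_matrix_def matrix_vector_mult_basis column_def)

lemma bil_sum_axis: fixes f :: "real^'n \<Rightarrow> real^'n"
  assumes "linear f" shows "(\<Sum>i\<in>UNIV. f (axis i 1) $ \<gamma> * x $ i) = f x $ \<gamma>"
proof -
  have "matrix f *v x = f x" by (rule matrix_works[OF assms[folded linear_matrix_vector_mul_eq]])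
  then have "(matrix f *v x) $ \<gamma> = f x $ \<gamma>" by simp
  then show ?thesis by (simp add: matrix_vector_mult_def matrix_def)
qed

lemma lin_aa: "linear (aa x)" "linear (\<lambda>x. aa x y)" using bil_aa by (auto simp: bilinear_def)

text \<open>The incidence relation is used in the form A(p, f) + M V = 0. Since p is affine in u,
  the derivative of \<open>M\<close> is the constant form \<open>aa\<close>, so a second
  differentiation leaves just two mixed terms and the second derivatives of V.\<close>

lemma first_derivative: assumes u: "u \<in> U" shows "Av (em (axis l 1)) fv + aa (axis l 1) (V u) + M u (J u (axis l 1)) = 0"
  and second_derivative: "aa (axis l 1) (J u (axis r 1)) + aa (axis r 1) (J u (axis l 1))
     + M u (\<chi> i. partial_deriv r (partial_deriv l (\<lambda>u. V u $ i)) u) = 0"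
proof -
  have pV: "has_pd U l (\<lambda>u. V u $ i) (partial_deriv l (\<lambda>u. V u $ i))" for l i
    by (rule smooth_on_has_pd[OF open_U smooth_V])
  have sV: "smooth_on U (partial_deriv l (\<lambda>u. V u $ i))" for l i
    using smooth_V[of i] unfolding smooth_on_def by (metis Ck_on.simps(2))
  have ppV: "has_pd U r (partial_deriv l (\<lambda>u. V u $ i)) (partial_deriv r (partial_deriv l (\<lambda>u. V u $ i)))" for r l i
    by (rule smooth_on_has_pd[OF open_U sV])
  have f0: "Av (line_p u) fv $ \<gamma> + (\<Sum>i\<in>UNIV. M u (axis i 1) $ \<gamma> * V u $ i) = 0" if "u \<in> U" for u \<gamma>
    using M_V[OF that] by (simp add: bil_sum_axis[OF lin_M])
  have f1: "Av (em (axis l 1)) fv $ \<gamma> + (\<Sum>i\<in>UNIV. aa (axis l 1) (axis i 1) $ \<gamma> * V u $ i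
      + M u (axis i 1) $ \<gamma> * partial_deriv l (\<lambda>u. V u $ i) u) = 0" if u: "u \<in> U" for u \<gamma> l
    by (rule has_pd_zero[OF has_pd_add[OF open_U has_pd_Af has_pd_sum[OF has_pd_mult[OF open_U has_pd_M pV]]] f0 u])
  show "Av (em (axis l 1)) fv + aa (axis l 1) (V u) + M u (J u (axis l 1)) = 0"
  proof -
    have "Av (em (axis l 1)) fv $ \<gamma> + aa (axis l 1) (V u) $ \<gamma> + M u (J u (axis l 1)) $ \<gamma> = 0" for \<gamma>
      using f1[OF u, of l \<gamma>] bil_sum_axis[OF lin_aa(1), of "axis l 1" \<gamma> "V u"] bil_sum_axis[OF lin_M, of u \<gamma> "J u (axis l 1)"]
      by (simp add: sum.distrib J_axis)
    then show ?thesis by (simp add: vec_eq_iff)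
  qed
  have f2: "0 + (\<Sum>i\<in>UNIV. (0 * V u $ i + aa (axis l 1) (axis i 1) $ \<gamma> * partial_deriv r (\<lambda>u. V u $ i) u)
      + (aa (axis r 1) (axis i 1) $ \<gamma> * partial_deriv l (\<lambda>u. V u $ i) u
       + M u (axis i 1) $ \<gamma> * partial_deriv r (partial_deriv l (\<lambda>u. V u $ i)) u)) = 0" for \<gamma>
    by (rule has_pd_zero[OF has_pd_add[OF open_U has_pd_const[OF open_U] has_pd_sum[OF has_pd_add[OF open_U
         has_pd_mult[OF open_U has_pd_const[OF open_U] pV] has_pd_mult[OF open_U has_pd_M ppV]]]] f1 u])
  have "aa (axis l 1) (J u (axis r 1)) $ \<gamma> + aa (axis r 1) (J u (axis l 1)) $ \<gamma>
     + M u (\<chi> i. partial_deriv r (partial_deriv l (\<lambda>u. V u $ i)) u) $ \<gamma> = 0" for \<gamma>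
    using f2[of \<gamma>] bil_sum_axis[OF lin_aa(1), of "axis l 1" \<gamma> "J u (axis r 1)"]
      bil_sum_axis[OF lin_aa(1), of "axis r 1" \<gamma> "J u (axis l 1)"]
      bil_sum_axis[OF lin_M, of u \<gamma> "\<chi> i. partial_deriv r (partial_deriv l (\<lambda>u. V u $ i)) u"]
    by (simp add: sum.distrib J_axis)
  then show "aa (axis l 1) (J u (axis r 1)) + aa (axis r 1) (J u (axis l 1))
     + M u (\<chi> i. partial_deriv r (partial_deriv l (\<lambda>u. V u $ i)) u) = 0" by (simp add: vec_eq_iff)
qed

definition pf :: "real^'n^'n \<Rightarrow> real^'n \<Rightarrow> real^'n \<Rightarrow> real" where
  "pf \<phi> a b = (\<Sum>\<beta>\<in>UNIV. \<Sum>\<gamma>\<in>UNIV. \<phi> $ \<beta> $ \<gamma> * a $ \<beta> * b $ \<gamma>)"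

lemma bil_pf: "bilinear (pf \<phi>)"
  unfolding bilinear_def
  by (intro conjI allI linearI) (simp_all add: pf_def algebra_simps sum.distrib sum_distrib_left)

lemma pf_inner: "pf \<phi> a b = a \<bullet> (\<phi> *v b)"
  by (simp add: pf_def inner_vec_def matrix_vector_mult_def sum_distrib_left mult_ac)

lemma pf_sym: "transpose \<phi> = \<phi> \<Longrightarrow> pf \<phi> a b = pf \<phi> b a"
  by (metis dot_lmul_matrix inner_commute pf_inner vector_transpose_matrix)

text \<open>The six terms of the wedge product agree in pairs after summation against a symmetric
  matrix.\<close>

lemma sum_wedge:
  assumes "transpose \<phi> = \<phi>"
  shows "(\<Sum>\<beta>\<in>UNIV. \<Sum>\<gamma>\<in>UNIV. \<phi> $ \<beta> $ \<gamma> * wedge (A \<beta>) (A \<gamma>) w1 w2 w3 w4)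
    = 2 * (pf \<phi> (Av w1 w2) (Av w3 w4) - pf \<phi> (Av w1 w3) (Av w2 w4) + pf \<phi> (Av w1 w4) (Av w2 w3))"
proof -
  have "(\<Sum>\<beta>\<in>UNIV. \<Sum>\<gamma>\<in>UNIV. \<phi> $ \<beta> $ \<gamma> * wedge (A \<beta>) (A \<gamma>) w1 w2 w3 w4)
    = pf \<phi> (Av w1 w2) (Av w3 w4) - pf \<phi> (Av w1 w3) (Av w2 w4) + pf \<phi> (Av w1 w4) (Av w2 w3)
    + pf \<phi> (Av w2 w3) (Av w1 w4) - pf \<phi> (Av w2 w4) (Av w1 w3) + pf \<phi> (Av w3 w4) (Av w1 w2)"
    by (simp add: wedge_def pf_def Av_def algebra_simps sum.distrib sum_subtractf)
  then show ?thesis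
    using pf_sym[OF assms] by (simp add: pf_sym[OF assms, of "Av w2 w3"] pf_sym[OF assms, of "Av w2 w4" "Av w1 w3"] pf_sym[OF assms, of "Av w3 w4" "Av w1 w2"])
qed

end


section \<open>From a Hamiltonian structure to the constant matrix\<close>

lemma bilinear_zero_axis:
  fixes T :: "real^'n \<Rightarrow> real^'n \<Rightarrow> 'b::real_vector"
  assumes "\<And>y. linear (\<lambda>x. T x y)" "\<And>x. linear (T x)" "\<And>i j. T (axis i 1) (axis j 1) = 0"
  shows "T x y = 0"
proof -
  have "T (axis i 1) y = 0" for i using linear_zero_axis[OF assms(2)] assms(3) by blast
  then show ?thesis using linear_zero_axis[OF assms(1)] by blast
qed

lemma trilinear_zero_axis:
  fixes T :: "real^'n \<Rightarrow> real^'n \<Rightarrow> real^'n \<Rightarrow> 'b::real_vector"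
  assumes "\<And>y w. linear (\<lambda>x. T x y w)" "\<And>x w. linear (\<lambda>y. T x y w)" "\<And>x y. linear (T x y)"
    "\<And>i j k. T (axis i 1) (axis j 1) (axis k 1) = 0"
  shows "T x y w = 0"
proof -
  have "T (axis i 1) y w = 0" for i
    by (rule bilinear_zero_axis[of "T (axis i 1)"]) (rule assms)+
  then show ?thesis using linear_zero_axis[OF assms(1)] by blast
qed

context congruence
begin

lemma forward:
  assumes u0: "u0 \<in> U" and hyp: "strictly_hyperbolic U V"
    and op: "third_order_hamiltonian_operator U g c" and ham: "hamiltonian_wrt U V g c"
  shows "\<exists>\<phi>::real^'n^'n. transpose \<phi> = \<phi> \<and> det \<phi> \<noteq> 0 \<and> (\<forall>w1 w2 w3 w4.
      (\<Sum>\<beta>\<in>UNIV. \<Sum>\<gamma>\<in>UNIV. \<phi> $ \<beta> $ \<gamma> * wedge (A \<beta>) (A \<gamma>) w1 w2 w3 w4) = 0)"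
proof -
  have g: "smooth_on U (\<lambda>u. g u $ i $ j)" and c: "smooth_on U (\<lambda>u. c u $ i $ j $ k)" for i j k
    using op by (auto simp: third_order_hamiltonian_operator_def)
  have sym: "transpose (g u) = g u" and det: "det (g u) \<noteq> 0" if "u \<in> U" for u
    using op that by (auto simp: third_order_hamiltonian_operator_def)
  define gl where "gl = (\<lambda>i j u. matrix_inv (g u) $ i $ j)"
  define Gam where "Gam = (\<lambda>p i k u. \<Sum>m\<in>UNIV. gl i m u * c u $ m $ p $ k)"
  have pm1: "pencil U u0 (\<lambda>i j u. g u $ i $ j) gl Gam"
    unfolding gl_def Gam_def by (rule pencil_of_metric(1)[OF open_U u0 g c sym det hamiltonian_operator_metric[OF op open_U]])
  have pm2: "c u $ i $ j $ k = (\<Sum>p\<in>UNIV. g u $ i $ p * Gam j p k u)" if "u \<in> U" for u i j k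
    unfolding gl_def Gam_def
    by (rule pencil_of_metric(2)[OF open_U u0 g c sym det hamiltonian_operator_metric[OF op open_U] that])
  interpret P0: pencil0 U u0 "\<lambda>i j u. g u $ i $ j" gl Gam by (intro pencil0.intro pm1)
  interpret P1: pencil1 U u0 "\<lambda>i j u. g u $ i $ j" gl Gam by (intro pencil1.intro pm1)
  have str: P0.rskew P0.rcyclic P0.rparallel
    using P0.hamiltonian_operator_iff_structure[OF refl g pm2 c] op by blast+
  note vr = P1.velocity_relations_real[OF str smooth_V refl pm2 ham]
  define ip :: "real^'n \<Rightarrow> real^'n \<Rightarrow> real" where "ip x y = (\<Sum>i\<in>UNIV. \<Sum>j\<in>UNIV. gl i j u0 * x $ i * y $ j)" for x y
  define br :: "real^'n \<Rightarrow> real^'n \<Rightarrow> real^'n" where "br x y = (\<chi> p. \<Sum>i\<in>UNIV. \<Sum>k\<in>UNIV. Gam p i k u0 * x $ i * y $ k)" for x y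
  have ev: "(\<Sum>i\<in>UNIV. \<Sum>j\<in>UNIV. gl i j u0 * x $ i * y $ j) = ip x y"
    "(\<Sum>i\<in>UNIV. \<Sum>k\<in>UNIV. Gam p i k u0 * x $ i * y $ k) = br x y $ p" for x y p
    by (simp_all add: ip_def br_def)
  have e: "(if p = i then 1 else 0) = axis i (1::real) $ p" for p i :: 'n by (simp add: axis_def)
  have bil_ip: "bilinear ip" unfolding bilinear_def
    by (intro conjI allI linearI) (simp_all add: ip_def algebra_simps sum.distrib sum_distrib_left)
  have bil_br: "bilinear br" unfolding bilinear_def
    by (intro conjI allI linearI) (simp_all add: br_def vec_eq_iff algebra_simps sum.distrib sum_distrib_left)
  have lin_J: "linear (J u0)" unfolding J_def by simp
  note bl = bilinear_ladd[OF bil_ip] bilinear_radd[OF bil_ip] bilinear_lsub[OF bil_ip] bilinear_rsub[OF bil_ip]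
    bilinear_lmul[OF bil_ip] bilinear_rmul[OF bil_ip] bilinear_lneg[OF bil_ip] bilinear_rneg[OF bil_ip]
    bilinear_ladd[OF bil_br] bilinear_radd[OF bil_br] bilinear_lsub[OF bil_br] bilinear_rsub[OF bil_br]
    bilinear_lmul[OF bil_br] bilinear_rmul[OF bil_br] bilinear_lneg[OF bil_br] bilinear_rneg[OF bil_br]
    linear_add[OF lin_J] linear_scale[OF lin_J]
  have br_ax: "br (axis i 1) (axis k 1) $ p = Gam p i k u0" for i k p
    by (simp add: br_def axis_def sum_delta_mult if_distrib[of "\<lambda>x. _ * x"] cong: if_cong)
  have ip_ax: "ip (axis i 1) y = (\<Sum>p\<in>UNIV. gl i p u0 * y $ p)" for i y
  proof -
    have "ip (axis i 1) y = (\<Sum>k\<in>UNIV. (if k = i then 1 else 0) * (\<Sum>p\<in>UNIV. gl k p u0 * y $ p))"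
      unfolding ip_def axis_def sum_distrib_left by (intro sum.cong refl) simp
    then show ?thesis by (simp only: sum_delta_mult mult_1)
  qed
  have sym_ip: "ip x y = ip y x" for x y
    unfolding ip_def by (subst sum.swap) (simp add: P0.sym_gl[OF u0, of _ _] mult_ac)
  have skew_br: "br x y = - br y x" for x y
  proof -
    have "br x y + br y x = 0"
    proof (rule bilinear_zero_axis[of "\<lambda>x y. br x y + br y x"])
      fix i j
      have "Gam p i j u0 = - Gam p j i u0" for p using str(1) u0 unfolding P0.rskew_def by blast
      then show "br (axis i 1) (axis j 1) + br (axis j 1) (axis i 1) = 0" by (simp add: vec_eq_iff br_ax)
    qed (auto intro!: linearI simp: bl algebra_simps)
    then show ?thesis by (simp add: eq_neg_iff_add_eq_0)
  qed
  have cyc: "ip x (br y w) + ip y (br w x) + ip w (br x y) = 0" for x y w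
  proof (rule trilinear_zero_axis[of "\<lambda>x y w. ip x (br y w) + ip y (br w x) + ip w (br x y)"])
    fix i j k
    show "ip (axis i 1) (br (axis j 1) (axis k 1)) + ip (axis j 1) (br (axis k 1) (axis i 1))
       + ip (axis k 1) (br (axis i 1) (axis j 1)) = 0"
      unfolding ip_ax br_ax using str(2) u0 unfolding P0.rcyclic_def by blast
  qed (auto intro!: linearI simp: bl algebra_simps)
  have symJ: "ip x (J u0 y) = ip y (J u0 x)" for x y
  proof -
    have "ip x (J u0 y) - ip y (J u0 x) = 0"
    proof (rule bilinear_zero_axis[of "\<lambda>x y. ip x (J u0 y) - ip y (J u0 x)"])
      fix i j
      show "ip (axis i 1) (J u0 (axis j 1)) - ip (axis j 1) (J u0 (axis i 1)) = 0"
        using vr(1)[of i j] unfolding e J_axis[symmetric] ev by simp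
    qed (auto intro!: linearI simp: bl algebra_simps)
    then show ?thesis by simp
  qed
  have cycJ: "ip (J u0 x) (br y w) + ip (J u0 y) (br w x) + ip (J u0 w) (br x y) = 0" for x y w
  proof (rule trilinear_zero_axis[of "\<lambda>x y w. ip (J u0 x) (br y w) + ip (J u0 y) (br w x) + ip (J u0 w) (br x y)"])
    fix i j k
    show "ip (J u0 (axis i 1)) (br (axis j 1) (axis k 1)) + ip (J u0 (axis j 1)) (br (axis k 1) (axis i 1))
       + ip (J u0 (axis k 1)) (br (axis i 1) (axis j 1)) = 0"
      using vr(3)[of j k i] unfolding e J_axis[symmetric] ev by simp
  qed (auto intro!: linearI simp: bl algebra_simps)
  have quad: "ip (br x v) (br y w) + ip (br y v) (br w x) + ip (br w v) (br x y) = 0" for x y w v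
  proof (rule trilinear_zero_axis[of "\<lambda>x y w. ip (br x v) (br y w) + ip (br y v) (br w x) + ip (br w v) (br x y)"])
    fix i j k
    show "ip (br (axis i 1) v) (br (axis j 1) (axis k 1)) + ip (br (axis j 1) v) (br (axis k 1) (axis i 1))
       + ip (br (axis k 1) v) (br (axis i 1) (axis j 1)) = 0"
    proof (rule linear_zero_axis[of "\<lambda>v. ip (br (axis i 1) v) (br (axis j 1) (axis k 1)) + ip (br (axis j 1) v) (br (axis k 1) (axis i 1))
       + ip (br (axis k 1) v) (br (axis i 1) (axis j 1))"])
      fix l
      show "ip (br (axis i 1) (axis l 1)) (br (axis j 1) (axis k 1)) + ip (br (axis j 1) (axis l 1)) (br (axis k 1) (axis i 1))
       + ip (br (axis k 1) (axis l 1)) (br (axis i 1) (axis j 1)) = 0"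
        using vr(4)[of i l j k] unfolding e ev by simp
    qed (intro linearI; simp add: bl algebra_simps)
  qed (auto intro!: linearI simp: bl algebra_simps)
  interpret F: frame_algebra ip br "J u0"
    by (rule frame_algebra.intro[OF bil_ip bil_br lin_J sym_ip skew_br cyc symJ cycJ quad])
  \<comment> \<open>Comparing the second derivative of the incidence relation with the velocity
    relations shows that the difference of the two sides satisfies the hypotheses of
    \<open>simple_spectrum_skew_zero\<close>, component by component. This is where strict
    hyperbolicity enters.\<close>
  have aa_br: "aa x y = M u0 (br x y)" for x y
  proof -
    have ba: "aa (x + x') y = aa x y + aa x' y" "aa y (x + x') = aa y x + aa y x'"
      "aa (r *\<^sub>R x) y = r *\<^sub>R aa x y" "aa y (r *\<^sub>R x) = r *\<^sub>R aa y x" for x x' y r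
      using bil_aa by (simp_all add: bilinear_ladd bilinear_radd bilinear_lmul bilinear_rmul)
    have Ml: "M u0 (x + y) = M u0 x + M u0 y" "M u0 (r *\<^sub>R x) = r *\<^sub>R M u0 x" "M u0 (- x) = - M u0 x" for x y r
      using lin_M[of u0] by (simp_all add: linear_add linear_scale linear_neg)
    have rel: "aa x (J u0 y) + aa y (J u0 x) + M u0 (br (J u0 y) x + br (J u0 x) y) = 0" for x y
    proof (rule bilinear_zero_axis[of "\<lambda>x y. aa x (J u0 y) + aa y (J u0 x) + M u0 (br (J u0 y) x + br (J u0 x) y)"])
      fix l r
      have "(\<chi> i. partial_deriv r (partial_deriv l (\<lambda>u. V u $ i)) u0) = br (J u0 (axis r 1)) (axis l 1) + br (J u0 (axis l 1)) (axis r 1)"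
        using vr(2)[of r l] unfolding e J_axis[symmetric] ev by (simp add: vec_eq_iff)
      then show "aa (axis l 1) (J u0 (axis r 1)) + aa (axis r 1) (J u0 (axis l 1))
         + M u0 (br (J u0 (axis r 1)) (axis l 1) + br (J u0 (axis l 1)) (axis r 1)) = 0"
        using second_derivative[OF u0, of l r] by simp
    qed (auto intro!: linearI simp: bl ba Ml algebra_simps)
    have sk: "aa x y = - aa y x" for x y unfolding aa_def by (rule Av_skew)
    have "(aa x y - M u0 (br x y)) $ \<gamma> = 0" for \<gamma>
    proof (rule simple_spectrum_skew_zero[of "jacobian_matrix V u0" "\<lambda>x y. (aa x y - M u0 (br x y)) $ \<gamma>"])
      show "card {l::real. \<exists>r. r \<noteq> 0 \<and> jacobian_matrix V u0 *v r = l *\<^sub>R r} = CARD('n)"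
        using hyp u0 by (simp add: strictly_hyperbolic_def)
      fix x y
      show "(aa x y - M u0 (br x y)) $ \<gamma> = - (aa y x - M u0 (br y x)) $ \<gamma>"
        by (simp add: sk[of x y] skew_br[of x y] Ml)
      have 1: "M u0 (br x (J u0 y)) = - M u0 (br (J u0 y) x)" for x y by (subst skew_br) (simp only: Ml)
      have "(aa x (J u0 y) + aa y (J u0 x) + M u0 (br (J u0 y) x + br (J u0 x) y)) $ \<gamma> = 0" unfolding rel by simp
      then show "(aa x (jacobian_matrix V u0 *v y) - M u0 (br x (jacobian_matrix V u0 *v y))) $ \<gamma>
         + (aa y (jacobian_matrix V u0 *v x) - M u0 (br y (jacobian_matrix V u0 *v x))) $ \<gamma> = 0"
        unfolding J_def[symmetric] 1 by (simp add: Ml(1))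
    qed (auto intro!: linearI simp: bl ba Ml algebra_simps)
    then show ?thesis by (simp add: vec_eq_iff)
  qed
  define p q where "p = line_p u0" and "q = line_q (V u0)"
  have pp: "Av p p = 0" "Av q q = 0" "Av p q = 0" "Av q p = 0"
    using Av_skew[of p p] Av_skew[of q q] Av_zero[OF u0] Av_skew[of q p] by (simp_all add: p_def q_def vec_eq_iff)
  have px: "Av p (em x) = M u0 x" "Av (em x) p = - M u0 x" for x
    using Av_skew[of "em x" p] by (simp_all add: p_def M_def)
  \<comment> \<open>The first derivative of the incidence relation expresses pairing with q through
    the Jacobian.\<close>
  have qx: "Av q (em x) = M u0 (J u0 x)" for x
  proof -
    have "Av q (em x) - M u0 (J u0 x) = 0"
    proof (rule linear_zero_axis[of "\<lambda>x. Av q (em x) - M u0 (J u0 x)"])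
      fix l
      have "Av (em (axis l 1)) q + M u0 (J u0 (axis l 1)) = 0"
        using first_derivative[OF u0, of l] by (simp add: q_def line_q_eq Av_simps aa_def algebra_simps)
      moreover have "Av q (em (axis l 1)) - M u0 (J u0 (axis l 1)) = - (Av (em (axis l 1)) q + M u0 (J u0 (axis l 1)))"
        by (subst Av_skew) simp
      ultimately show "Av q (em (axis l 1)) - M u0 (J u0 (axis l 1)) = 0" by simp
    qed (intro linearI; simp add: bl em_linear Av_simps linear_add[OF lin_M] linear_scale[OF lin_M] algebra_simps)
    then show ?thesis by simp
  qed
  have qx': "Av (em x) q = - M u0 (J u0 x)" for x using Av_skew[of "em x" q] qx by simp
  \<comment> \<open>Every vector is a combination of an embedded x with p and q at
    \<open>u0\<close>, the coefficients of p and q being its last two coordinates. Hence the form is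
    known completely from its values at one point.\<close>
  have Av_BV: "Av w w' = M u0 (F.BV (fst w - fst (snd w) *\<^sub>R u0 - snd (snd w) *\<^sub>R V u0) (fst (snd w)) (snd (snd w))
      (fst w' - fst (snd w') *\<^sub>R u0 - snd (snd w') *\<^sub>R V u0) (fst (snd w')) (snd (snd w')))" for w w'
  proof -
    have dec: "w = em (fst w - fst (snd w) *\<^sub>R u0 - snd (snd w) *\<^sub>R V u0) + fst (snd w) *\<^sub>R p + snd (snd w) *\<^sub>R q" for w
      by (simp add: em_def p_def q_def line_p_def line_q_def prod_eq_iff)
    have bv: "Av (em x + a *\<^sub>R p + m *\<^sub>R q) (em x' + a' *\<^sub>R p + m' *\<^sub>R q) = M u0 (F.BV x a m x' a' m')" for x a m x' a' m'
      by (simp add: Av_simps pp px qx qx' aa_def[symmetric] aa_br F.BV_def linear_add[OF lin_M] linear_diff[OF lin_M] linear_scale[OF lin_M])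
    have "Av w w' = Av (em (fst w - fst (snd w) *\<^sub>R u0 - snd (snd w) *\<^sub>R V u0) + fst (snd w) *\<^sub>R p + snd (snd w) *\<^sub>R q)
        (em (fst w' - fst (snd w') *\<^sub>R u0 - snd (snd w') *\<^sub>R V u0) + fst (snd w') *\<^sub>R p + snd (snd w') *\<^sub>R q)"
      by (rule arg_cong2[OF dec dec])
    then show ?thesis unfolding bv .
  qed
  define N where "N = matrix_inv (Mm u0)"
  define G where "G = (\<chi> i j. gl i j u0)"
  \<comment> \<open>The metric at \<open>u0\<close> transported through \<open>M u0\<close>; it is
    non-degenerate since both \<open>G\<close> and \<open>N\<close> are invertible.\<close>
  define \<phi> where "\<phi> = transpose N ** G ** N"
  have N: "N ** Mm u0 = mat 1" "Mm u0 ** N = mat 1"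
    using matrix_inv_inverse[OF Mm_invertible[OF u0]] by (auto simp: N_def)
  have NM: "N *v M u0 x = x" for x
    unfolding Mm[symmetric] by (simp add: matrix_vector_mul_assoc N)
  have G: "x \<bullet> (G *v y) = ip x y" for x y
    by (simp add: G_def ip_def inner_vec_def matrix_vector_mult_def sum_distrib_left mult_ac)
  have pf_ip: "pf \<phi> (M u0 x) (M u0 y) = ip x y" for x y
  proof -
    have "pf \<phi> (M u0 x) (M u0 y) = M u0 x \<bullet> (transpose N *v (G *v (N *v M u0 y)))"
      by (simp add: pf_inner \<phi>_def matrix_vector_mul_assoc matrix_mul_assoc)
    also have "\<dots> = (N *v M u0 x) \<bullet> (G *v (N *v M u0 y))"
      by (metis dot_lmul_matrix inner_commute vector_transpose_matrix transpose_transpose)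
    finally show ?thesis by (simp add: NM G)
  qed
  have Gs: "transpose G = G" using P0.sym_gl[OF u0] by (simp add: G_def transpose_def vec_eq_iff)
  have s\<phi>: "transpose \<phi> = \<phi>"
    by (simp add: \<phi>_def matrix_transpose_mul Gs matrix_mul_assoc)
  have "det G \<noteq> 0"
  proof -
    have "G = matrix_inv (g u0)" by (simp add: G_def gl_def vec_eq_iff)
    then have "G ** g u0 = mat 1" using matrix_inv_inverse(2)[of "g u0"] det[OF u0] by (simp add: invertible_det_nz)
    then have "det G * det (g u0) = 1" by (metis det_I det_mul)
    then show ?thesis by auto
  qed
  moreover have "det N \<noteq> 0"
  proof -
    have "det N * det (Mm u0) = 1" using N(1) by (metis det_I det_mul)
    then show ?thesis by auto
  qed
  ultimately have d\<phi>: "det \<phi> \<noteq> 0" by (simp add: \<phi>_def det_mul)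
  have "(\<Sum>\<beta>\<in>UNIV. \<Sum>\<gamma>\<in>UNIV. \<phi> $ \<beta> $ \<gamma> * wedge (A \<beta>) (A \<gamma>) w1 w2 w3 w4) = 0" for w1 w2 w3 w4
    unfolding sum_wedge[OF s\<phi>] Av_BV[of w1] Av_BV[of w2] Av_BV[of w3] pf_ip F.pfaffian_zero by simp
  with s\<phi> d\<phi> show ?thesis by blast
qed

end


section \<open>From the constant matrix to a Hamiltonian operator\<close>

lemma linear_sum_axis:
  fixes f :: "real^'n \<Rightarrow> 'b::real_vector"
  assumes "linear f" shows "(\<Sum>i\<in>UNIV. x $ i *\<^sub>R f (axis i 1)) = f x"
proof -
  have "(\<Sum>i\<in>UNIV. x $ i *\<^sub>R axis i 1) = x"
    using basis_expansion[of x] by (simp add: scalar_mult_eq_scaleR)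
  then have "f (\<Sum>i\<in>UNIV. x $ i *\<^sub>R axis i 1) = f x" by simp
  then show ?thesis by (simp add: linear_sum[OF assms] linear_scale[OF assms])
qed

locale congruence_metric = congruence U V \<A> A
  for U :: "(real^'n::finite) set" and V :: "real^'n \<Rightarrow> real^'n" and \<A> :: "'n bilin set" and A :: "'n \<Rightarrow> 'n bilin" +
  fixes \<phi> :: "real^'n^'n"
  assumes sym_\<phi>: "transpose \<phi> = \<phi>" and det_\<phi>: "det \<phi> \<noteq> 0"
    and plucker: "pf \<phi> (Av w1 w2) (Av w3 w4) - pf \<phi> (Av w1 w3) (Av w2 w4) + pf \<phi> (Av w1 w4) (Av w2 w3) = 0"
begin

lemmas pf_simps = bilinear_ladd[OF bil_pf] bilinear_radd[OF bil_pf] bilinear_lsub[OF bil_pf] bilinear_rsub[OF bil_pf]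
  bilinear_lmul[OF bil_pf] bilinear_rmul[OF bil_pf] bilinear_lneg[OF bil_pf] bilinear_rneg[OF bil_pf]

definition gl :: "'n \<Rightarrow> 'n \<Rightarrow> real^'n \<Rightarrow> real" where "gl i j u = pf \<phi> (M u (axis i 1)) (M u (axis j 1))"
definition Gl :: "real^'n \<Rightarrow> real^'n^'n" where "Gl u = (\<chi> i j. gl i j u)"
definition gg :: "real^'n \<Rightarrow> real^'n^'n" where "gg u = matrix_inv (Gl u)"
definition Minv :: "real^'n \<Rightarrow> real^'n \<Rightarrow> real^'n" where "Minv u x = matrix_inv (Mm u) *v x"
definition Gam :: "'n \<Rightarrow> 'n \<Rightarrow> 'n \<Rightarrow> real^'n \<Rightarrow> real" where "Gam p i k u = Minv u (aa (axis i 1) (axis k 1)) $ p"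
definition cc :: "real^'n \<Rightarrow> real^'n^'n^'n" where "cc u = (\<chi> i j k. \<Sum>p\<in>UNIV. gg u $ i $ p * Gam j p k u)"

lemma M_Minv: assumes "u \<in> U" shows "M u (Minv u x) = x"
  using matrix_inv_inverse(1)[OF Mm_invertible[OF assms]]
  by (simp add: Minv_def Mm[symmetric] matrix_vector_mul_assoc)

lemma lin_Minv: "linear (Minv u)" unfolding Minv_def by simp

lemma lin_pf_M: "linear (\<lambda>x. pf \<phi> a (M u x))" "linear (\<lambda>x. pf \<phi> (M u x) b)"
  by (auto intro!: linearI simp: pf_simps linear_add[OF lin_M] linear_scale[OF lin_M])

lemma det_Gl: assumes "u \<in> U" shows "det (Gl u) \<noteq> 0"
proof -
  have "Gl u = transpose (Mm u) ** \<phi> ** Mm u"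
    unfolding Gl_def gl_def pf_def vec_eq_iff
    by (simp add: matrix_matrix_mult_def transpose_def Mm_nth sum_distrib_right, subst sum.swap) (simp add: mult_ac)
  moreover have "det (Mm u) \<noteq> 0" using Mm_invertible[OF assms] by (simp add: invertible_det_nz)
  ultimately show ?thesis using det_\<phi> by (simp add: det_mul det_transpose)
qed

lemma gl_sym: "gl i j u = gl j i u" unfolding gl_def by (rule pf_sym[OF sym_\<phi>])

lemma Gl_gg: assumes "u \<in> U" shows "Gl u ** gg u = mat 1" "gg u ** Gl u = mat 1"
  using matrix_inv_inverse[of "Gl u"] det_Gl[OF assms] by (auto simp: gg_def invertible_det_nz)

lemma gl_gg: "u \<in> U \<Longrightarrow> (\<Sum>j\<in>UNIV. gl i j u * gg u $ j $ k) = (if i = k then 1 else 0)"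
  and gg_gl: "u \<in> U \<Longrightarrow> (\<Sum>j\<in>UNIV. gg u $ i $ j * gl j k u) = (if i = k then 1 else 0)"
  using Gl_gg by (simp_all add: vec_eq_iff matrix_matrix_mult_def mat_def Gl_def)

lemma transpose_gg: assumes u: "u \<in> U" shows "transpose (gg u) = gg u"
proof -
  have G: "transpose (Gl u) = Gl u" using gl_sym by (simp add: Gl_def transpose_def vec_eq_iff)
  have "transpose (gg u) ** Gl u = mat 1"
    using arg_cong[OF Gl_gg(1)[OF u], of transpose] by (simp add: matrix_transpose_mul G)
  then have "transpose (gg u) ** (Gl u ** gg u) = gg u" by (simp add: matrix_mul_assoc)
  then show ?thesis by (simp add: Gl_gg[OF u])
qed

lemma smooth_M: "smooth_on U (\<lambda>u. M u x $ \<gamma>)"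
proof -
  have "(\<lambda>u. M u x $ \<gamma>) = (\<lambda>u. (\<Sum>i\<in>UNIV. aa (axis i 1) x $ \<gamma> * u $ i) + Av p1 (em x) $ \<gamma>)"
    by (simp add: M_eq bil_sum_axis[OF lin_aa(2)])
  then show ?thesis
    by (simp only:) (intro smooth_on_add[OF open_U] smooth_on_sum[OF open_U] smooth_on_mult[OF open_U]
      smooth_on_const[OF open_U] smooth_on_coord[OF open_U])
qed

lemma smooth_gl: "smooth_on U (gl i j)"
  unfolding gl_def pf_def
  by (intro smooth_on_sum[OF open_U] smooth_on_mult[OF open_U] smooth_on_const[OF open_U] smooth_M)

lemma smooth_gg: "smooth_on U (\<lambda>u. gg u $ i $ j)"
  unfolding gg_def by (rule smooth_on_matrix_inv[OF open_U _ det_Gl]) (simp add: Gl_def smooth_gl)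

lemma smooth_Gam: "smooth_on U (Gam p i k)"
proof -
  have "smooth_on U (\<lambda>u. matrix_inv (Mm u) $ p $ q)" for q
  proof (rule smooth_on_matrix_inv[OF open_U])
    show "det (Mm u) \<noteq> 0" if "u \<in> U" for u using Mm_invertible[OF that] by (simp add: invertible_det_nz)
  qed (simp add: Mm_nth smooth_M)
  then show ?thesis
    unfolding Gam_def Minv_def matrix_vector_mult_def vec_lambda_beta
    by (intro smooth_on_sum[OF open_U] smooth_on_mult[OF open_U] smooth_on_const[OF open_U])
qed

lemma smooth_cc: "smooth_on U (\<lambda>u. cc u $ i $ j $ k)"
  unfolding cc_def vec_lambda_beta
  by (intro smooth_on_sum[OF open_U] smooth_on_mult[OF open_U] smooth_gg smooth_Gam)

text \<open>Lowering the index of \<open>Gam\<close> cancels the inverse of \<open>M\<close>, which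
  leaves an expression in the constant form \<open>aa\<close>.\<close>

lemma gl_Gam: assumes "u \<in> U"
  shows "(\<Sum>p\<in>UNIV. gl i p u * Gam p j k u) = pf \<phi> (M u (axis i 1)) (aa (axis j 1) (axis k 1))"
  using linear_sum_axis[OF lin_pf_M(1), of "Minv u (aa (axis j 1) (axis k 1))" "M u (axis i 1)" u]
  by (simp add: gl_def Gam_def M_Minv[OF assms] mult.commute)

lemma metric: assumes u: "u \<in> U"
  shows "partial_deriv k (gl i j) u = - (\<Sum>p\<in>UNIV. gl i p u * Gam p j k u) - (\<Sum>p\<in>UNIV. gl j p u * Gam p i k u)"
proof -
  have "has_pd U k (gl i j) (\<lambda>u. \<Sum>\<beta>\<in>UNIV. \<Sum>\<gamma>\<in>UNIV.
      (0 * M u (axis i 1) $ \<beta> + \<phi> $ \<beta> $ \<gamma> * aa (axis k 1) (axis i 1) $ \<beta>) * M u (axis j 1) $ \<gamma>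
      + \<phi> $ \<beta> $ \<gamma> * M u (axis i 1) $ \<beta> * aa (axis k 1) (axis j 1) $ \<gamma>)"
    unfolding gl_def pf_def
    by (intro has_pd_sum has_pd_mult[OF open_U] has_pd_M has_pd_const[OF open_U])
  from has_pd_eq[OF open_U this u]
  have "partial_deriv k (gl i j) u = pf \<phi> (aa (axis k 1) (axis i 1)) (M u (axis j 1)) + pf \<phi> (M u (axis i 1)) (aa (axis k 1) (axis j 1))"
    by (simp add: pf_def sum.distrib)
  moreover have "aa (axis k 1) x = - aa x (axis k 1)" for x unfolding aa_def by (rule Av_skew)
  ultimately have "partial_deriv k (gl i j) u = pf \<phi> (- aa (axis i 1) (axis k 1)) (M u (axis j 1)) + pf \<phi> (M u (axis i 1)) (- aa (axis j 1) (axis k 1))"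
    by simp
  then show ?thesis
    by (simp add: pf_simps gl_Gam[OF u] pf_sym[OF sym_\<phi>, of _ "M u (axis j 1)"])
qed

text \<open>\<open>M u\<close> applied to the bracket of two basis vectors is the constant
  \<open>aa\<close>. Differentiating this product and inverting \<open>M u\<close> yields the
  bracket rule, the sign being absorbed by skewness of \<open>aa\<close>.\<close>

lemma Gam_parallel: assumes u: "u \<in> U"
  shows "partial_deriv v (Gam p i k) u = (\<Sum>r\<in>UNIV. Gam r i k u * Gam p r v u)"
proof -
  define x where "x = Minv u (aa (axis i 1) (axis k 1))"
  define d where "d = (\<chi> p. partial_deriv v (Gam p i k) u)"
  have "aa (axis v 1) x $ \<gamma> + M u d $ \<gamma> = 0" for \<gamma>
  proof -
    have "(\<Sum>p\<in>UNIV. M u (axis p 1) $ \<gamma> * Gam p i k u) + (- aa (axis i 1) (axis k 1) $ \<gamma>) = 0" if "u \<in> U" for u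
      using bil_sum_axis[OF lin_M, of u \<gamma> "Minv u (aa (axis i 1) (axis k 1))"] by (simp add: Gam_def M_Minv[OF that])
    from has_pd_zero[OF has_pd_add[OF open_U has_pd_sum[OF has_pd_mult[OF open_U has_pd_M
          smooth_on_has_pd[OF open_U smooth_Gam]]] has_pd_const[OF open_U]] this u, of v]
    have "(\<Sum>p\<in>UNIV. aa (axis v 1) (axis p 1) $ \<gamma> * x $ p) + (\<Sum>p\<in>UNIV. M u (axis p 1) $ \<gamma> * d $ p) = 0"
      by (simp add: sum.distrib x_def d_def Gam_def)
    then show ?thesis by (simp only: bil_sum_axis[OF lin_aa(1)] bil_sum_axis[OF lin_M])
  qed
  then have "M u d = - aa (axis v 1) x" by (simp add: vec_eq_iff eq_neg_iff_add_eq_0 add.commute)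
  also have "\<dots> = aa x (axis v 1)" unfolding aa_def by (rule Av_skew[symmetric])
  finally have "M u (d - Minv u (aa x (axis v 1))) = 0"
    by (simp add: linear_diff[OF lin_M] M_Minv[OF u])
  then have d: "d = Minv u (aa x (axis v 1))" using M_inj[OF u] by fastforce
  have lin: "linear (\<lambda>x. Minv u (aa x (axis v 1)))"
    by (intro linearI) (simp_all add: linear_add[OF lin_aa(2)] linear_scale[OF lin_aa(2)] linear_add[OF lin_Minv] linear_scale[OF lin_Minv])
  have "d $ p = (\<Sum>r\<in>UNIV. Minv u (aa (axis r 1) (axis v 1)) $ p * x $ r)"
    unfolding d by (rule bil_sum_axis[OF lin, symmetric])
  then show ?thesis by (simp add: d_def x_def Gam_def mult.commute)
qed

lemma hamiltonian_operator: assumes u0: "u0 \<in> U" shows "third_order_hamiltonian_operator U gg cc"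
proof -
  interpret P0: pencil0 U u0 "\<lambda>i j u. gg u $ i $ j" gl Gam
    by unfold_locales (use open_U u0 in \<open>auto simp: smooth_gl smooth_gg smooth_Gam gl_gg gg_gl metric intro: gl_sym\<close>)
  have sk: "aa x y = - aa y x" for x y unfolding aa_def by (rule Av_skew)
  have "P0.rskew" unfolding P0.rskew_def Gam_def
  proof (intro ballI allI)
    fix u p i k
    have "Minv u (aa (axis i 1) (axis k 1)) = - Minv u (aa (axis k 1) (axis i 1))"
      by (subst sk) (rule linear_neg[OF lin_Minv])
    then show "Minv u (aa (axis i 1) (axis k 1)) $ p = - Minv u (aa (axis k 1) (axis i 1)) $ p" by simp
  qed
  \<comment> \<open>The cyclic identity is the quadratic relation for \<phi> evaluated on p and
    three embedded basis vectors.\<close>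
  moreover have "P0.rcyclic" unfolding P0.rcyclic_def
  proof (intro ballI allI)
    fix u i j k assume u: "u \<in> U"
    have "pf \<phi> (M u (axis j 1)) (aa (axis k 1) (axis i 1)) = - pf \<phi> (M u (axis j 1)) (aa (axis i 1) (axis k 1))"
      by (subst sk) (simp only: pf_simps)
    then show "(\<Sum>p\<in>UNIV. gl i p u * Gam p j k u) + (\<Sum>p\<in>UNIV. gl j p u * Gam p k i u) + (\<Sum>p\<in>UNIV. gl k p u * Gam p i j u) = 0"
      using plucker[of "line_p u" "em (axis i 1)" "em (axis j 1)" "em (axis k 1)"]
      by (simp add: gl_Gam[OF u] M_def aa_def)
  qed
  moreover have "P0.rparallel" unfolding P0.rparallel_def using Gam_parallel by blast
  moreover have "\<forall>u\<in>U. transpose (gg u) = gg u \<and> det (gg u) \<noteq> 0"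
  proof (intro ballI conjI transpose_gg)
    fix u assume u: "u \<in> U"
    have "det (Gl u) * det (gg u) = 1" using Gl_gg(1)[OF u] by (metis det_I det_mul)
    then show "det (gg u) \<noteq> 0" by auto
  qed
  ultimately show ?thesis
    by (subst P0.hamiltonian_operator_iff_structure[OF refl smooth_gg _ smooth_cc]) (simp_all add: cc_def)
qed

end

section \<open>The generating density\<close>

definition jP :: "'n jet \<Rightarrow> 'n::finite hvec" where "jP p = (snd p 0, fst p, 0)"
definition jX :: "'n jet \<Rightarrow> 'n::finite hvec" where "jX p = line_p (snd p 1)"

fun dP :: "'n::finite dir \<Rightarrow> 'n hvec" where
  "dP DX = (0, 1, 0)"
| "dP (DZ m j) = (if m = 0 then em (axis j 1) else 0)"

fun dX :: "'n::finite dir \<Rightarrow> 'n hvec" where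
  "dX DX = 0"
| "dX (DZ m j) = (if m = 1 then em (axis j 1) else 0)"

lemma jP_sh: "jP (sh d t p) = jP p + t *\<^sub>R dP d" and jX_sh: "jX (sh d t p) = jX p + t *\<^sub>R dX d"
  by (cases d; auto simp: jP_def jX_def em_def line_p_def)+

lemma jP_der: "((\<lambda>t. jP (sh d t p)) has_vector_derivative dP d) (at 0)"
  and jX_der: "((\<lambda>t. jX (sh d t p)) has_vector_derivative dX d) (at 0)"
  unfolding jP_sh jX_sh by (auto intro!: derivative_eq_intros)

text \<open>If all directional derivatives factor through the increments of \<open>jP\<close> and
  \<open>jX\<close>, the total derivative substitutes for these increments the total derivatives of
  \<open>jP\<close> and \<open>jX\<close>, namely \<open>jX p\<close> and
  \<open>em (snd p 2)\<close>.\<close>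

lemma total_deriv_linear:
  fixes F :: "'a::finite hvec \<times> 'a hvec \<Rightarrow> real"
  assumes F: "linear F" and jd: "\<And>d. jd d f p = F (dP d, dX d)"
  shows "total_deriv f p = F (jX p, em (snd p 2))"
proof -
  have F0: "F (0, 0) = 0" using linear_0[OF F] by (simp add: zero_prod_def)
  have "(\<Sum>m. \<Sum>i\<in>UNIV. snd p (Suc m) $ i * jd (DZ m i) f p) = (\<Sum>m\<in>{0, 1}. \<Sum>i\<in>UNIV. snd p (Suc m) $ i * jd (DZ m i) f p)"
    by (rule suminf_finite) (auto simp: jd F0)
  also have "\<dots> = (\<Sum>i\<in>UNIV. snd p 1 $ i * F (em (axis i 1), 0)) + (\<Sum>i\<in>UNIV. snd p 2 $ i * F (0, em (axis i 1)))"
    by (simp add: jd numeral_2_eq_2)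
  also have "(\<Sum>i\<in>UNIV. snd p 1 $ i * F (em (axis i 1), 0)) = F (em (snd p 1), 0)"
  proof -
    have "linear (\<lambda>x. (em x, 0) :: 'a hvec \<times> 'a hvec)" by (auto intro!: linearI simp: em_linear)
    from linear_compose[OF this F] have "linear (\<lambda>x. F (em x, 0))" by (simp add: o_def)
    from linear_sum_axis[OF this, of "snd p 1"] show ?thesis by simp
  qed
  also have "(\<Sum>i\<in>UNIV. snd p 2 $ i * F (0, em (axis i 1))) = F (0, em (snd p 2))"
  proof -
    have "linear (\<lambda>x. (0, em x) :: 'a hvec \<times> 'a hvec)" by (auto intro!: linearI simp: em_linear)
    from linear_compose[OF this F] have "linear (\<lambda>x. F (0, em x))" by (simp add: o_def)
    from linear_sum_axis[OF this, of "snd p 2"] show ?thesis by simp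
  qed
  finally have "total_deriv f p = F ((0, 1, 0), 0) + (F (em (snd p 1), 0) + F (0, em (snd p 2)))"
    by (simp add: total_deriv_def case_prod_unfold jet_dx_jd jet_dz_jd jd)
  then show ?thesis by (simp add: linear_add[OF F, symmetric] jX_def line_p_def em_def)
qed

context congruence_metric
begin

lemmas Av_der = bounded_bilinear.has_vector_derivative[OF bil_Av[unfolded bilinear_conv_bounded_bilinear]]
lemmas pf_der = bounded_bilinear.has_vector_derivative[OF bil_pf[unfolded bilinear_conv_bounded_bilinear]]

text \<open>\<open>density\<close> depends only on \<open>b\<close>, \<open>u = b\<^sub>x\<close> and \<open>x\<close>: \<open>jP\<close> is \<open>(b, x, 0)\<close> and \<open>jX\<close> its total
  derivative. The family \<open>mom\<close> collects its derivatives with respect to \<open>u\<close>, \<open>wv\<close> the variational ones.\<close>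

definition density :: "'n jet \<Rightarrow> real" where
  "density p = pf \<phi> (Av (jX p) (jP p)) (Av (jP p) fv) / 3"
definition mom :: "'n \<Rightarrow> 'n jet \<Rightarrow> real" where
  "mom j p = pf \<phi> (Av (em (axis j 1)) (jP p)) (Av (jP p) fv) / 3"
definition wv :: "'n \<Rightarrow> 'n jet \<Rightarrow> real" where
  "wv j p = pf \<phi> (Av (jX p) (em (axis j 1))) (Av (jP p) fv)"

lemma jd_unique_vec: "((\<lambda>t. f (sh d t p)) has_vector_derivative c) (at 0) \<Longrightarrow> jd d f p = c"
  by (simp add: jd_def DERIV_imp_deriv has_real_derivative_iff_has_vector_derivative)

lemma jd_density: "jd d density p = (pf \<phi> (Av (jX p) (jP p)) (Av (dP d) fv)
   + pf \<phi> (Av (jX p) (dP d) + Av (dX d) (jP p)) (Av (jP p) fv)) / 3"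
proof (rule jd_unique_vec)
  have "((\<lambda>t. pf \<phi> (Av (jX (sh d t p)) (jP (sh d t p))) (Av (jP (sh d t p)) fv)) has_vector_derivative
    (pf \<phi> (Av (jX (sh d 0 p)) (jP (sh d 0 p))) (Av (jP (sh d 0 p)) 0 + Av (dP d) fv)
   + pf \<phi> (Av (jX (sh d 0 p)) (dP d) + Av (dX d) (jP (sh d 0 p))) (Av (jP (sh d 0 p)) fv))) (at 0)"
    by (intro pf_der Av_der jP_der jX_der has_vector_derivative_const)
  then show "((\<lambda>t. density (sh d t p)) has_vector_derivative (pf \<phi> (Av (jX p) (jP p)) (Av (dP d) fv)
     + pf \<phi> (Av (jX p) (dP d) + Av (dX d) (jP p)) (Av (jP p) fv)) / 3) (at 0)"
    unfolding density_def has_real_derivative_iff_has_vector_derivative[symmetric]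
    by (intro DERIV_cdivide) (simp add: bilinear_rzero[OF bil_Av])
qed

lemma jd_mom: "jd d (mom j) p = (pf \<phi> (Av (em (axis j 1)) (jP p)) (Av (dP d) fv)
   + pf \<phi> (Av (em (axis j 1)) (dP d)) (Av (jP p) fv)) / 3"
proof (rule jd_unique_vec)
  have "((\<lambda>t. pf \<phi> (Av (em (axis j 1)) (jP (sh d t p))) (Av (jP (sh d t p)) fv)) has_vector_derivative
    (pf \<phi> (Av (em (axis j 1)) (jP (sh d 0 p))) (Av (jP (sh d 0 p)) 0 + Av (dP d) fv)
   + pf \<phi> (Av (em (axis j 1)) (dP d) + Av 0 (jP (sh d 0 p))) (Av (jP (sh d 0 p)) fv))) (at 0)"
    by (intro pf_der Av_der jP_der has_vector_derivative_const)
  then show "((\<lambda>t. mom j (sh d t p)) has_vector_derivative (pf \<phi> (Av (em (axis j 1)) (jP p)) (Av (dP d) fv)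
     + pf \<phi> (Av (em (axis j 1)) (dP d)) (Av (jP p) fv)) / 3) (at 0)"
    unfolding mom_def has_real_derivative_iff_has_vector_derivative[symmetric]
    by (intro DERIV_cdivide) (simp add: bilinear_rzero[OF bil_Av] bilinear_lzero[OF bil_Av])
qed

lemma jd_wv: "jd d (wv j) p = pf \<phi> (Av (jX p) (em (axis j 1))) (Av (dP d) fv)
   + pf \<phi> (Av (dX d) (em (axis j 1))) (Av (jP p) fv)"
proof (rule jd_unique_vec)
  have "((\<lambda>t. pf \<phi> (Av (jX (sh d t p)) (em (axis j 1))) (Av (jP (sh d t p)) fv)) has_vector_derivative
    (pf \<phi> (Av (jX (sh d 0 p)) (em (axis j 1))) (Av (jP (sh d 0 p)) 0 + Av (dP d) fv)
   + pf \<phi> (Av (jX (sh d 0 p)) 0 + Av (dX d) (em (axis j 1))) (Av (jP (sh d 0 p)) fv))) (at 0)"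
    by (intro pf_der Av_der jP_der jX_der has_vector_derivative_const)
  then show "((\<lambda>t. wv j (sh d t p)) has_vector_derivative pf \<phi> (Av (jX p) (em (axis j 1))) (Av (dP d) fv)
     + pf \<phi> (Av (dX d) (em (axis j 1))) (Av (jP p) fv)) (at 0)"
    unfolding wv_def by (simp add: bilinear_rzero[OF bil_Av])
qed

lemmas bl_lin = em_linear Av_simps pf_simps bilinear_lzero[OF bil_Av] bilinear_rzero[OF bil_Av] bilinear_lzero[OF bil_pf] bilinear_rzero[OF bil_pf]

lemma total_deriv_mom: "total_deriv (mom j) p = (pf \<phi> (Av (em (axis j 1)) (jP p)) (Av (jX p) fv)
   + pf \<phi> (Av (em (axis j 1)) (jX p)) (Av (jP p) fv)) / 3"
  by (rule total_deriv_linear[of "\<lambda>v. (pf \<phi> (Av (em (axis j 1)) (jP p)) (Av (fst v) fv)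
     + pf \<phi> (Av (em (axis j 1)) (fst v)) (Av (jP p) fv)) / 3", simplified fst_conv])
    ((intro linearI)?; simp add: bl_lin jd_mom add_divide_distrib distrib_left)+

lemma total_deriv_wv: "total_deriv (wv j) p = pf \<phi> (Av (jX p) (em (axis j 1))) (Av (jX p) fv)
   + pf \<phi> (Av (em (snd p 2)) (em (axis j 1))) (Av (jP p) fv)"
  by (rule total_deriv_linear[of "\<lambda>v. pf \<phi> (Av (jX p) (em (axis j 1))) (Av (fst v) fv)
     + pf \<phi> (Av (snd v) (em (axis j 1))) (Av (jP p) fv)", simplified fst_conv snd_conv])
    ((intro linearI)?; simp add: bl_lin jd_wv add_divide_distrib distrib_left)+

text \<open>Let X be \<open>wv j p\<close>. Differentiation in b gives (X + Y) / 3, and subtracting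
  the total derivative of \<open>mom j\<close> adds (X + Z) / 3; \<open>plucker\<close> says X - Y =
  Z. The total is 3 X / 3, which explains the factor 1/3 in \<open>density\<close>.\<close>

lemma variational_deriv_density: "variational_deriv j density p = wv j p"
proof -
  have z: "total_deriv (\<lambda>p. 0) = (\<lambda>p :: 'n jet. 0 :: real)"
    by (simp add: total_deriv_def jet_dx_def jet_dz_def fun_eq_iff)
  have z': "(total_deriv ^^ m) (\<lambda>p. 0) = (\<lambda>p :: 'n jet. 0 :: real)" for m by (induction m) (simp_all add: z)
  have j1: "jd (DZ 1 j) density = mom j"
    by (simp add: fun_eq_iff jd_density mom_def bl_lin)
  have j2: "jd (DZ m j) density = (\<lambda>p. 0)" if "m \<notin> {0, 1}" for m
    using that by (simp add: fun_eq_iff jd_density bl_lin)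
  have "variational_deriv j density p = (\<Sum>m\<in>{0, 1}. (-1) ^ m * (total_deriv ^^ m) (jd (DZ m j) density) p)"
    unfolding variational_deriv_def jet_dz_jd
  proof (rule suminf_finite)
    fix m assume "m \<notin> {0, 1 :: nat}"
    from j2[OF this] show "(-1) ^ m * (total_deriv ^^ m) (jd (DZ m j) density) p = 0" by (simp only: z' mult_zero_right)
  qed simp
  also have "\<dots> = jd (DZ 0 j) density p - total_deriv (mom j) p"
    using j1 by simp
  also have "\<dots> = wv j p"
  proof -
    have ar: "(Y + X) / 3 - (- Z - X) / 3 = X" if "X - Y = Z" for X Y Z :: real using that by (simp add: field_simps)
    have s: "Av (em (axis j 1)) w = - Av w (em (axis j 1))" for w by (rule Av_skew)
    have "pf \<phi> (Av (jX p) (em (axis j 1))) (Av (jP p) fv) - pf \<phi> (Av (jX p) (jP p)) (Av (em (axis j 1)) fv)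
        + pf \<phi> (Av (jX p) fv) (Av (em (axis j 1)) (jP p)) = 0" by (rule plucker)
    then show ?thesis
      by (simp add: jd_density total_deriv_mom wv_def bl_lin s[of "jP p"] s[of "jX p"]
          pf_sym[OF sym_\<phi>, of "Av (jX p) fv"]) (rule ar)
  qed
  finally show ?thesis .
qed

text \<open>The density is a polynomial in x, b and u, so smoothness follows from expansion in
  coordinates.\<close>

lemma diff_fun_density: assumes u0: "u0 \<in> U" shows "diff_fun 1 U density"
proof -
  interpret jets "Suc 0" U u0 by unfold_locales (use open_U u0 in auto)
  note dc = diff_fun_add diff_fun_mult diff_fun_sum diff_fun_const diff_fun_coord diff_fun_fst
  have L: "(\<Sum>k\<in>UNIV. f (em (axis k 1)) * x $ k) = f (em x)" if "linear f" for f :: "'n hvec \<Rightarrow> real" and x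
  proof -
    have "linear (\<lambda>x. f (em x))" by (intro linearI) (simp_all add: em_linear linear_add[OF that] linear_scale[OF that])
    from linear_sum_axis[OF this, of x] show ?thesis by (simp add: mult.commute)
  qed
  have nl: "linear (\<lambda>v. Av v w $ \<gamma>)" "linear (\<lambda>v. Av w v $ \<gamma>)" for w \<gamma>
    by (intro linearI; simp add: Av_simps)+
  have jP: "jP p = em (snd p 0) + fst p *\<^sub>R p1" for p :: "'n jet" by (simp add: jP_def em_def p1_def)
  have jX: "jX p = em (snd p 1) + p1" for p :: "'n jet" by (simp add: jX_def line_p_eq)
  have "Av (jX p) v $ \<gamma> = (\<Sum>k\<in>UNIV. Av (em (axis k 1)) v $ \<gamma> * snd p 1 $ k) + Av p1 v $ \<gamma>" for p v \<gamma>
    by (simp only: L[OF nl(1)] jX Av_simps vector_add_component)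
  then have X: "diff_fun (Suc 0) U (\<lambda>p. Av (jX p) v $ \<gamma>)" for v \<gamma> by (simp only:) (intro dc)
  have "Av (jX p) (jP p) $ \<gamma> = (\<Sum>k\<in>UNIV. Av (jX p) (em (axis k 1)) $ \<gamma> * snd p 0 $ k) + fst p * Av (jX p) p1 $ \<gamma>" for p \<gamma>
    by (simp only: L[OF nl(2)] jP Av_simps vector_add_component vector_scaleR_component real_scaleR_def)
  then have XP: "diff_fun (Suc 0) U (\<lambda>p. Av (jX p) (jP p) $ \<gamma>)" for \<gamma> by (simp only:) (intro dc X)
  have "Av (jP p) fv $ \<gamma> = (\<Sum>k\<in>UNIV. Av (em (axis k 1)) fv $ \<gamma> * snd p 0 $ k) + fst p * Av p1 fv $ \<gamma>" for p \<gamma>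
    by (simp only: L[OF nl(1)] jP Av_simps vector_add_component vector_scaleR_component real_scaleR_def)
  then have Pf: "diff_fun (Suc 0) U (\<lambda>p. Av (jP p) fv $ \<gamma>)" for \<gamma> by (simp only:) (intro dc)
  have "diff_fun (Suc 0) U (\<lambda>p. pf \<phi> (Av (jX p) (jP p)) (Av (jP p) fv) * (1 / 3))"
    unfolding pf_def by (intro dc XP Pf)
  then show ?thesis by (simp add: density_def[abs_def])
qed

lemma total_deriv_uminus_wv: "total_deriv (\<lambda>q. - wv j q) p = - total_deriv (wv j) p"
proof -
  have jd: "jd d (\<lambda>q. - wv j q) p = - jd d (wv j) p" for d
  proof (rule jd_unique_vec)
    have "((\<lambda>t. - wv j (sh d t p)) has_vector_derivative - (pf \<phi> (Av (jX (sh d 0 p)) (em (axis j 1))) (Av (jP (sh d 0 p)) 0 + Av (dP d) fv)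
       + pf \<phi> (Av (jX (sh d 0 p)) 0 + Av (dX d) (em (axis j 1))) (Av (jP (sh d 0 p)) fv))) (at 0)"
      unfolding wv_def by (intro has_vector_derivative_minus pf_der Av_der jP_der jX_der has_vector_derivative_const)
    then show "((\<lambda>t. - wv j (sh d t p)) has_vector_derivative - jd d (wv j) p) (at 0)"
      by (simp add: jd_wv bilinear_rzero[OF bil_Av])
  qed
  show ?thesis unfolding total_deriv_wv
    by (rule total_deriv_linear[of "\<lambda>v. - (pf \<phi> (Av (jX p) (em (axis j 1))) (Av (fst v) fv)
       + pf \<phi> (Av (snd v) (em (axis j 1))) (Av (jP p) fv))", simplified fst_conv snd_conv])
      ((intro linearI)?; simp add: bl_lin jd jd_wv algebra_simps)+
qed

text \<open>The terms with the second derivative of b cancel between the derivative part and the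
  connection part of the operator. What remains is the inverse metric applied to the metric dual of
  V, since the total derivative of A(P, f) is - M V.\<close>

lemma inner_op_density: assumes p: "snd p 1 \<in> U"
  shows "inner_op 1 gg cc (\<lambda>j q. - variational_deriv j density q) i p = V (snd p 1) $ i"
proof -
  define u where "u = snd p 1"
  define \<theta> where "\<theta> = Av (jP p) fv"
  define ux where "ux = snd p 2"
  define S where "S = (\<lambda>i. inner_op 1 gg cc (\<lambda>j q. - wv j q) i p)"
  have u: "u \<in> U" using p by (simp add: u_def)
  have jX: "Av (jX p) (em x) = M u x" for x by (simp add: jX_def u_def M_def)
  have XV: "Av (jX p) fv = - M u (V u)" using M_V[OF u] by (simp add: jX_def u_def)
  have w: "wv j p = pf \<phi> (M u (axis j 1)) \<theta>" for j by (simp add: wv_def jX \<theta>_def)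
  define T where "T = (\<lambda>j. pf \<phi> (M u (axis j 1)) (M u (V u)) + pf \<phi> (aa (axis j 1) ux) \<theta>)"
  have Dw: "total_deriv (\<lambda>q. - wv j q) p = T j" for j
  proof -
    have "Av (em ux) (em (axis j 1)) = - aa (axis j 1) ux" unfolding aa_def by (rule Av_skew)
    then show ?thesis
      by (simp add: total_deriv_uminus_wv total_deriv_wv T_def jX XV \<theta>_def ux_def[symmetric] pf_simps)
  qed
  have S: "S i = (\<Sum>j\<in>UNIV. gg u $ i $ j * T j) + (\<Sum>j\<in>UNIV. \<Sum>k\<in>UNIV. cc u $ i $ j $ k * ux $ k * - pf \<phi> (M u (axis j 1)) \<theta>)" for i
    by (simp add: S_def inner_op_def case_prod_unfold Dw w u_def ux_def numeral_2_eq_2)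
  \<comment> \<open>Contracting \<open>Gam\<close> with \<open>M\<close> returns the constant form
    \<open>aa\<close>, so this is minus the second summand of \<open>T\<close>, with the index
    raised.\<close>
  have c: "(\<Sum>j\<in>UNIV. \<Sum>k\<in>UNIV. cc u $ i $ j $ k * ux $ k * - pf \<phi> (M u (axis j 1)) \<theta>)
     = (\<Sum>q\<in>UNIV. gg u $ i $ q * - pf \<phi> (aa (axis q 1) ux) \<theta>)" for i
  proof -
    have 1: "(\<Sum>j\<in>UNIV. \<Sum>k\<in>UNIV. Gam j q k u * ux $ k * pf \<phi> (M u (axis j 1)) \<theta>) = pf \<phi> (aa (axis q 1) ux) \<theta>" for q
    proof -
      have "(\<Sum>j\<in>UNIV. Gam j q k u * pf \<phi> (M u (axis j 1)) \<theta>) = pf \<phi> (aa (axis q 1) (axis k 1)) \<theta>" for k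
        using linear_sum_axis[OF lin_pf_M(2), of "Minv u (aa (axis q 1) (axis k 1))" u \<theta>] by (simp add: Gam_def M_Minv[OF u])
      then have "(\<Sum>k\<in>UNIV. \<Sum>j\<in>UNIV. Gam j q k u * ux $ k * pf \<phi> (M u (axis j 1)) \<theta>) = (\<Sum>k\<in>UNIV. ux $ k * pf \<phi> (aa (axis q 1) (axis k 1)) \<theta>)"
        by (simp add: mult_ac sum_distrib_left[symmetric])
      moreover have "linear (\<lambda>x. pf \<phi> (aa (axis q 1) x) \<theta>)"
        by (auto intro!: linearI simp: linear_add[OF lin_aa(1)] linear_scale[OF lin_aa(1)] pf_simps)
      note linear_sum_axis[OF this, of ux]
      ultimately show ?thesis by (subst sum.swap) simp
    qed
    have t: "cc u $ i $ j $ k * ux $ k * - P = (\<Sum>q\<in>UNIV. - (gg u $ i $ q * (Gam j q k u * ux $ k * P)))" for j k P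
      unfolding cc_def vec_lambda_beta sum_distrib_right by (intro sum.cong refl) simp
    have "(\<Sum>j\<in>UNIV. \<Sum>k\<in>UNIV. cc u $ i $ j $ k * ux $ k * - pf \<phi> (M u (axis j 1)) \<theta>)
       = (\<Sum>j\<in>UNIV. \<Sum>k\<in>UNIV. \<Sum>q\<in>UNIV. - (gg u $ i $ q * (Gam j q k u * ux $ k * pf \<phi> (M u (axis j 1)) \<theta>)))"
      unfolding t ..
    also have "\<dots> = (\<Sum>q\<in>UNIV. \<Sum>j\<in>UNIV. \<Sum>k\<in>UNIV. - (gg u $ i $ q * (Gam j q k u * ux $ k * pf \<phi> (M u (axis j 1)) \<theta>)))"
      by (rule sum_rotate)
    also have "\<dots> = (\<Sum>q\<in>UNIV. gg u $ i $ q * - pf \<phi> (aa (axis q 1) ux) \<theta>)"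
      unfolding 1[symmetric] by (simp add: sum_distrib_left sum_negf)
    finally show ?thesis .
  qed
  have gl_V: "pf \<phi> (M u (axis j 1)) (M u (V u)) = (\<Sum>m\<in>UNIV. gl j m u * V u $ m)" for j
    using linear_sum_axis[OF lin_pf_M(1), of "V u" "M u (axis j 1)" u] by (simp add: gl_def mult.commute)
  have "S i = (\<Sum>j\<in>UNIV. gg u $ i $ j * (\<Sum>m\<in>UNIV. gl j m u * V u $ m))"
    unfolding S c T_def gl_V[symmetric] by (simp add: sum.distrib[symmetric] algebra_simps)
  also have "\<dots> = (\<Sum>m\<in>UNIV. (\<Sum>j\<in>UNIV. gg u $ i $ j * gl j m u) * V u $ m)"
    unfolding sum_distrib_left sum_distrib_right by (subst sum.swap) (simp add: mult.assoc)
  also have "\<dots> = V u $ i" by (simp only: gg_gl[OF u] sum_delta_mult mult_1)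
  finally show ?thesis by (simp add: S_def u_def variational_deriv_density)
qed

lemma hamiltonian: assumes u0: "u0 \<in> U" shows "hamiltonian_wrt U V gg cc"
  unfolding hamiltonian_wrt_def
proof (intro exI[of _ density] conjI ballI allI)
  show "diff_fun 1 U density" by (rule diff_fun_density[OF u0])
next
  interpret jets "Suc 0" U u0 by unfold_locales (use open_U u0 in auto)
  fix p :: "'n jet" and i assume p: "p \<in> jets_over 1 U"
  show "total_deriv (\<lambda>(x, z). V (z 1) $ i) p = total_deriv (inner_op 1 gg cc (\<lambda>j q. - variational_deriv j density q) i) p"
  proof (rule total_deriv_cong)
    fix p :: "'n jet" assume "p \<in> jets_over (Suc 0) U"
    then show "(case p of (x, z) \<Rightarrow> V (z 1) $ i) = inner_op 1 gg cc (\<lambda>j q. - variational_deriv j density q) i p"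
      using inner_op_density[of p i] by (simp add: \<Omega>_iff case_prod_unfold)
  qed (use p in simp)
qed

end

theorem mainTheorem8:
  fixes U :: "(real^'n) set"
    and V :: "real^'n \<Rightarrow> real^'n"
    and \<A> :: "'n bilin set"
    and A :: "'n \<Rightarrow> 'n bilin"
  assumes "open U" and "U \<noteq> {}"
    and "\<forall>i. smooth_on U (\<lambda>u. V u $ i)"
    and "strictly_hyperbolic U V"
    and "linear_congruence U V \<A>"
    and "inj A" and "independent (range A)" and "span (range A) = \<A>"
  shows "(\<exists>g c. third_order_hamiltonian_operator U g c \<and> hamiltonian_wrt U V g c) \<longleftrightarrow>
         (\<exists>\<phi>::real^'n^'n. transpose \<phi> = \<phi> \<and> det \<phi> \<noteq> 0 \<and>
            (\<forall>w1 w2 w3 w4.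
               (\<Sum>\<beta>\<in>UNIV. \<Sum>\<gamma>\<in>UNIV. \<phi> $ \<beta> $ \<gamma> * wedge (A \<beta>) (A \<gamma>) w1 w2 w3 w4) = 0))"
proof -
  obtain u0 where u0: "u0 \<in> U" using assms(2) by blast
  interpret congruence U V \<A> A by unfold_locales (use assms in auto)
  show ?thesis
  proof (rule iffI; elim exE conjE)
    fix g c assume "third_order_hamiltonian_operator U g c" "hamiltonian_wrt U V g c"
    from forward[OF u0 assms(4) this]
    show "\<exists>\<phi>::real^'n^'n. transpose \<phi> = \<phi> \<and> det \<phi> \<noteq> 0 \<and> (\<forall>w1 w2 w3 w4.
      (\<Sum>\<beta>\<in>UNIV. \<Sum>\<gamma>\<in>UNIV. \<phi> $ \<beta> $ \<gamma> * wedge (A \<beta>) (A \<gamma>) w1 w2 w3 w4) = 0)" .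
  next
    fix \<phi> :: "real^'n^'n"
    assume \<phi>: "transpose \<phi> = \<phi>" "det \<phi> \<noteq> 0"
      and w: "\<forall>w1 w2 w3 w4. (\<Sum>\<beta>\<in>UNIV. \<Sum>\<gamma>\<in>UNIV. \<phi> $ \<beta> $ \<gamma> * wedge (A \<beta>) (A \<gamma>) w1 w2 w3 w4) = 0"
    have "pf \<phi> (Av w1 w2) (Av w3 w4) - pf \<phi> (Av w1 w3) (Av w2 w4) + pf \<phi> (Av w1 w4) (Av w2 w3) = 0" for w1 w2 w3 w4
      using w[rule_format, of w1 w2 w3 w4] unfolding sum_wedge[OF \<phi>(1)] by simp
    then interpret congruence_metric U V \<A> A \<phi>
      by unfold_locales (rule \<phi>)+
    show "\<exists>g c. third_order_hamiltonian_operator U g c \<and> hamiltonian_wrt U V g c"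
      using hamiltonian_operator[OF u0] hamiltonian[OF u0] by blast
  qed
qed

end
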